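(* Let $\mathcal{P}$ be a polytopic mesh of $\Omega$ with a simplicial covering $\mathcal{P}^\sharp$ (both in the sense of the context), let $K\in\mathcal{P}$, let $k\in\mathbb{N}$ be the polynomial degree of $V_{\mathcal{P}}$, and let $v\in H^{k+1}(K^\sharp)$ be a function with range in $[0,\kappa]$, where $K^\sharp\in\mathcal{P}^\sharp$ is the covering simplex associated with $K$. Then there exists $\pi_Hv\in V_{\mathcal{P}}$ whose range is contained in $[0,\kappa]$ such that $$|v-\pi_Hv|_{m,K}\ \le\ C_m\,H_K^{k+1-m}\,|v|_{k+1,K^\sharp},\qquad m=0,1,2.$$ The constant $C_m>0$ depends on the shape-regularity of $K^\sharp$ and on $k$. Moreover, for $m=1,2$, the constant $C_m>0$ also depends on $C_{\rm star}$, on the upper bound $\kappa$, and on $|v|_{1,d,\Omega}$ for $m=1$, or on $|v|_{2,\Omega}$ for $m=2$.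
   Context: $\Omega\subset\mathbb{R}^d$, $d\in\{2,3\}$, is an open bounded polygonal/polyhedral domain, and $\kappa>0$ is a given constant. $|\cdot|_{s,p,D}$ denotes the $W^{s,p}(D)$ seminorm, and $|\cdot|_{s,D}$ the $H^s(D)=W^{s,2}(D)$ seminorm ($s=0$: the $L^2(D)$ norm). Polytopic mesh. $\mathcal{P}$ is a subdivision of $\Omega$ into disjoint polygonal/polyhedral elements $K$, with $H_K:=\mathrm{diam}(K)$. It belongs to a family of meshes satisfying, with constants $C_{\rm star}>0$ and $C_{\rm qu}\ge1$ uniform over the family: (a) each element $K$ is star-shaped with respect to a ball of radius $\rho_K$ with $H_K\le C_{\rm star}\rho_K$; (b) $H_{K'}\le C_{\rm qu}H_K$ for all face neighbours $K'$ of $K$. Discrete space. For $k\ge1$, $V_{\mathcal{P}}:=\{v\in L^2(\Omega):v|_K\in\mathbb{P}_k(K)\ \forall K\in\mathcal{P}\}$, with $\mathbb{P}_k(K)$ the polynomials of total degree at most $k$ on $K$. Simplicial covering. $\mathcal{P}^\sharp=\{K^\sharp\}$ is a collection of open, shape-regular $d$-simplices (which may overlap), of minimal possible diameter $H_{K^\sharp}$, such that: (a) for each $K\in\mathcal{P}$ there is a fixed $K^\sharp\in\mathcal{P}^\sharp$ with $K\subset K^\sharp$ (this is the covering simplex associated with $K$); (b) there is a constant $C_{\rm sh}^\sharp\ge1$, uniform over the mesh family, with $H_{K^\sharp}\le C_{\rm sh}^\sharp H_K$ for all $K\in\mathcal{P}$; (c) $\mathcal{P}^\sharp$ covers exactly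 the domain $\Omega$: $\Omega=\bigcup_{K^\sharp\in\mathcal{P}^\sharp}K^\sharp$. *)

theory Defs
  imports "HOL-Analysis.Analysis"
begin

section \<open>Weak derivatives and Sobolev spaces\<close>

text \<open>Multi-indices are functions of type \<open>'d \<Rightarrow> nat\<close>.\<close>

definition mi_order :: "('d::finite \<Rightarrow> nat) \<Rightarrow> nat" where
  "mi_order \<alpha> = (\<Sum>i\<in>UNIV. \<alpha> i)"

fun partials :: "'d::finite list \<Rightarrow> (real^'d \<Rightarrow> real) \<Rightarrow> real^'d \<Rightarrow> real" where
  "partials [] f = f"
| "partials (i # is) f = (\<lambda>x. frechet_derivative (partials is f) (at x) (axis i 1))"

definition smooth :: "(real^'d \<Rightarrow> real) \<Rightarrow> bool" where
  "smooth f \<longleftrightarrow> (\<forall>is x. partials is f differentiable (at x))"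

definition test_function :: "(real^'d) set \<Rightarrow> (real^'d \<Rightarrow> real) \<Rightarrow> bool" where
  "test_function U \<phi> \<longleftrightarrow> smooth \<phi> \<and>
     compact (closure {x. \<phi> x \<noteq> 0}) \<and> closure {x. \<phi> x \<noteq> 0} \<subseteq> U"

definition locally_integrable :: "(real^'d) set \<Rightarrow> (real^'d \<Rightarrow> real) \<Rightarrow> bool" where
  "locally_integrable U f \<longleftrightarrow> (\<forall>C. compact C \<and> C \<subseteq> U \<longrightarrow> integrable (lebesgue_on C) f)"

text \<open>
  Partial derivatives of a smooth function commute, so every list of directions in which
  direction \<open>i\<close> occurs \<open>\<alpha> i\<close> times yields the classical derivative of multi-index \<open>\<alpha>\<close>.
\<close>

definition has_weak_deriv ::
  "(real^'d) set \<Rightarrow> ('d::finite \<Rightarrow> nat) \<Rightarrow> (real^'d \<Rightarrow> real) \<Rightarrow> (real^'d \<Rightarrow> real) \<Rightarrow> bool" where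
  "has_weak_deriv U \<alpha> v g \<longleftrightarrow> locally_integrable U v \<and> locally_integrable U g \<and>
     (\<forall>\<phi> is. test_function U \<phi> \<and> count_list is = \<alpha> \<longrightarrow>
        (LINT x|lebesgue_on U. v x * partials is \<phi> x)
          = (- 1) ^ mi_order \<alpha> * (LINT x|lebesgue_on U. g x * \<phi> x))"

text \<open>
  Weak derivatives on an open set are unique almost everywhere, so the choice of a
  representative is immaterial below. In particular the weak derivative of order \<open>0\<close> of a
  locally integrable \<open>v\<close> is \<open>v\<close> almost everywhere.
\<close>

definition weak_deriv ::
  "(real^'d) set \<Rightarrow> ('d::finite \<Rightarrow> nat) \<Rightarrow> (real^'d \<Rightarrow> real) \<Rightarrow> real^'d \<Rightarrow> real" where
  "weak_deriv U \<alpha> v = (SOME g. has_weak_deriv U \<alpha> v g)"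

definition in_Lp :: "real \<Rightarrow> (real^'d) set \<Rightarrow> (real^'d \<Rightarrow> real) \<Rightarrow> bool" where
  "in_Lp p U f \<longleftrightarrow> f \<in> borel_measurable (lebesgue_on U) \<and>
     integrable (lebesgue_on U) (\<lambda>x. \<bar>f x\<bar> powr p)"

definition in_sobolev :: "nat \<Rightarrow> real \<Rightarrow> (real^'d) set \<Rightarrow> (real^'d \<Rightarrow> real) \<Rightarrow> bool" where
  "in_sobolev s p U v \<longleftrightarrow> in_Lp p U v \<and>
     (\<forall>\<alpha>. mi_order \<alpha> \<le> s \<longrightarrow> (\<exists>g. has_weak_deriv U \<alpha> v g \<and> in_Lp p U g))"

definition sobolev_seminorm :: "nat \<Rightarrow> real \<Rightarrow> (real^'d) set \<Rightarrow> (real^'d \<Rightarrow> real) \<Rightarrow> real" where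
  "sobolev_seminorm s p U v =
     (\<Sum>\<alpha> | mi_order \<alpha> = s. LINT x|lebesgue_on U. \<bar>weak_deriv U \<alpha> v x\<bar> powr p) powr (1 / p)"


section \<open>Polytopic meshes and discrete spaces\<close>

text \<open>
  Polygonal/polyhedral domains and mesh elements need not be convex: only the boundary is
  required to consist of finitely many flat \<open>(d-1)\<close>-dimensional pieces.
\<close>

definition polyhedral_domain :: "(real^'d) set \<Rightarrow> bool" where
  "polyhedral_domain S \<longleftrightarrow> S \<noteq> {} \<and> open S \<and> connected S \<and> bounded S \<and>
     (\<exists>\<F>. finite \<F> \<and> (\<forall>F\<in>\<F>. polytope F \<and> aff_dim F = int CARD('d) - 1) \<and> frontier S = \<Union>\<F>)"

definition star_shaped_wrt_ball :: "(real^'d) set \<Rightarrow> real^'d \<Rightarrow> real \<Rightarrow> bool" where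
  "star_shaped_wrt_ball S c r \<longleftrightarrow> ball c r \<subseteq> S \<and>
     (\<forall>y\<in>ball c r. \<forall>x\<in>S. closed_segment y x \<subseteq> S)"

definition face_neighbours :: "(real^'d) set \<Rightarrow> (real^'d) set \<Rightarrow> bool" where
  "face_neighbours K K' \<longleftrightarrow> K \<noteq> K' \<and>
     (\<exists>F. polytope F \<and> aff_dim F = int CARD('d) - 1 \<and> F \<subseteq> frontier K \<inter> frontier K')"

text \<open>Elements are open sets, so disjointness is literal and \<open>\<Omega>\<close> is filled up to closures.\<close>

definition polytopic_mesh ::
  "real \<Rightarrow> real \<Rightarrow> (real^'d) set \<Rightarrow> (real^'d) set set \<Rightarrow> bool" where
  "polytopic_mesh C_star C_qu \<Omega> \<P> \<longleftrightarrow>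
     C_star > 0 \<and> C_qu \<ge> 1 \<and>
     finite \<P> \<and> (\<forall>K\<in>\<P>. polyhedral_domain K \<and> K \<subseteq> \<Omega>) \<and> disjoint \<P> \<and>
     closure \<Omega> = (\<Union>K\<in>\<P>. closure K) \<and>
     (\<forall>K\<in>\<P>. \<exists>c \<rho>. \<rho> > 0 \<and> star_shaped_wrt_ball K c \<rho> \<and> diameter K \<le> C_star * \<rho>) \<and>
     (\<forall>K\<in>\<P>. \<forall>K'\<in>\<P>. face_neighbours K K' \<longrightarrow> diameter K' \<le> C_qu * diameter K)"

text \<open>Polynomial functions of total degree at most \<open>k\<close>.\<close>

definition poly_space :: "nat \<Rightarrow> (real^'d \<Rightarrow> real) set" where
  "poly_space k =
     {q. \<exists>c. q = (\<lambda>x. \<Sum>\<alpha> | mi_order \<alpha> \<le> k. c \<alpha> * (\<Prod>i\<in>UNIV. (x $ i) ^ \<alpha> i))}"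

definition discrete_space ::
  "(real^'d) set \<Rightarrow> (real^'d) set set \<Rightarrow> nat \<Rightarrow> (real^'d \<Rightarrow> real) set" where
  "discrete_space \<Omega> \<P> k =
     {w. in_Lp 2 \<Omega> w \<and> (\<forall>K\<in>\<P>. \<exists>q\<in>poly_space k. \<forall>x\<in>K. w x = q x)}"


section \<open>Simplicial coverings\<close>

definition open_simplex :: "(real^'d) set \<Rightarrow> bool" where
  "open_simplex T \<longleftrightarrow> (\<exists>S. int CARD('d) simplex S \<and> T = interior S)"

definition shape_regular :: "real \<Rightarrow> (real^'d) set \<Rightarrow> bool" where
  "shape_regular \<sigma> T \<longleftrightarrow> (\<exists>c r. r > 0 \<and> ball c r \<subseteq> T \<and> diameter T \<le> \<sigma> * r)"

text \<open>
  The function \<open>cov\<close> selects the covering simplex of each element. Minimality of its diameter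
  is understood among all simplices that could serve for the element \<open>K\<close>: open,
  shape-regular with the same constant, containing \<open>K\<close> and contained in \<open>\<Omega>\<close>. The collection
  may contain further simplices, which need not be the covering simplex of any element.
\<close>

definition simplicial_covering ::
  "real \<Rightarrow> real \<Rightarrow> (real^'d) set \<Rightarrow> (real^'d) set set \<Rightarrow> (real^'d) set set \<Rightarrow>
     ((real^'d) set \<Rightarrow> (real^'d) set) \<Rightarrow> bool" where
  "simplicial_covering \<sigma> C_sh \<Omega> \<P> \<P>s cov \<longleftrightarrow>
     C_sh \<ge> 1 \<and>
     (\<forall>T\<in>\<P>s. open_simplex T \<and> shape_regular \<sigma> T) \<and>
     (\<forall>K\<in>\<P>. cov K \<in> \<P>s \<and> K \<subseteq> cov K) \<and>
     (\<forall>K\<in>\<P>. \<forall>T. open_simplex T \<and> shape_regular \<sigma> T \<and> K \<subseteq> T \<and> T \<subseteq> \<Omega> \<longrightarrow>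
        diameter (cov K) \<le> diameter T) \<and>
     (\<forall>K\<in>\<P>. diameter (cov K) \<le> C_sh * diameter K) \<and>
     \<Omega> = \<Union>\<P>s"

end

theory Submission
  imports Defs
begin

text \<open>
  Write \<open>T\<close> for the covering simplex of \<open>K\<close> and \<open>h\<close> for its diameter. Shrinking \<open>T\<close> homothetically onto
  \<open>K\<close> and using minimality, \<open>h\<close> is bounded by a multiple of the diameter of \<open>K\<close> that depends only on the
  shape regularity. Let \<open>p\<close> be the polynomial of degree at most \<open>k\<close> for which all derivatives of \<open>v - p\<close>
  up to order \<open>k\<close> have mean zero on \<open>T\<close>. The Poincare inequality, applied repeatedly, bounds the
  derivatives of \<open>v - p\<close> in \<open>L\<^sup>2(T)\<close>, and a second-order Taylor expansion averaged over \<open>T\<close> turns this into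
  a bound \<open>\<delta>\<close> for \<open>\<bar>v - p\<bar>\<close>; this is where \<open>d \<le> 3\<close> enters. So \<open>p\<close> takes values in \<open>[-\<delta>, \<kappa> + \<delta>]\<close>, and
  squeezing it affinely about \<open>\<kappa>/2\<close> produces a polynomial with values in \<open>[0, \<kappa>]\<close> that differs from \<open>p\<close> by at
  most \<open>\<delta>\<close>. An inverse estimate on the inscribed ball of \<open>T\<close> bounds the derivatives of this correction.
\<close>

section \<open>Smooth tensor products and polynomials\<close>

text \<open>The approximant has to stay a polynomial, so values outside \<open>[0, \<kappa>]\<close>
  cannot be cut off, and a pointwise bound on v - p is unavoidable. What makes it affordable is its
  scaling: the volume of T times \<delta>^2 is a constant times h^(2(k+1)) times the squared
  seminorm of order k+1. A function bounded by \<delta> / h^m therefore has an L^2(T) norm of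
  exactly the order claimed for m, and the volume cancels. Weak derivatives are known only through
  test functions, so the inequalities are proved for mollifications, at points whose ball of the
  mollification radius lies in T. There, differentiating and mollifying commute; convexity keeps
  whole segments inside this set, and Fatou's lemma removes the mollifier at the end. The kernels
  are tensor products of one-dimensional bumps, because their iterated partial derivatives depend
  only on how often each direction occurs, which matches the multi-indices of weak derivatives.
  Comparing diameters through minimality ties the constants to \<open>k\<close> and the shape
  regularity.\<close>

text \<open>\<open>F i n\<close> stands for the \<open>n\<close>-th derivative of the \<open>i\<close>-th factor, as enforced by \<open>deriv_seq\<close>.\<close>

definition tensor :: "('d::finite \<Rightarrow> nat \<Rightarrow> real \<Rightarrow> real) \<Rightarrow> ('d \<Rightarrow> nat) \<Rightarrow> real^'d \<Rightarrow> real" where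
  "tensor F n x = (\<Prod>i\<in>UNIV. F i (n i) (x $ i))"

definition deriv_seq :: "(nat \<Rightarrow> real \<Rightarrow> real) \<Rightarrow> bool" where
  "deriv_seq H \<longleftrightarrow> (\<forall>n t. (H n has_real_derivative H (Suc n) t) (at t))"

text \<open>Product rule: differentiating in direction \<open>i\<close> only raises the order of the
  \<open>i\<close>-th factor, so the tensors form a family closed under partial derivatives.\<close>

lemma tensor_has_derivative:
  fixes F :: "'d::finite \<Rightarrow> nat \<Rightarrow> real \<Rightarrow> real"
  assumes F: "\<And>i. deriv_seq (F i)"
  shows "(tensor F n has_derivative (\<lambda>y. \<Sum>i\<in>UNIV. y $ i * tensor F (n(i := Suc (n i))) x)) (at x)"
proof -
  have "((\<lambda>x::real^'d. (\<Prod>i\<in>UNIV. F i (n i) (x $ i))) has_derivative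
      (\<lambda>y. \<Sum>i\<in>UNIV. (F i (Suc (n i)) (x $ i) * y $ i) * (\<Prod>j\<in>UNIV - {i}. F j (n j) (x $ j)))) (at x)"
  proof (intro has_derivative_prod)
    fix i
    have "((\<lambda>x::real^'d. x $ i) has_derivative (\<lambda>y. y $ i)) (at x)"
      by (rule bounded_linear_imp_has_derivative) (simp add: bounded_linear_vec_nth)
    moreover have "(F i (n i) has_derivative (*) (F i (Suc (n i)) (x $ i))) (at (x $ i))"
      using F[of i] by (simp add: deriv_seq_def has_field_derivative_def)
    ultimately show "((\<lambda>x::real^'d. F i (n i) (x $ i)) has_derivative (\<lambda>y. F i (Suc (n i)) (x $ i) * y $ i)) (at x)"
      by (rule has_derivative_compose)
  qed
  moreover have "F i (Suc (n i)) (x $ i) * y $ i * (\<Prod>j\<in>UNIV - {i}. F j (n j) (x $ j))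
      = y $ i * tensor F (n(i := Suc (n i))) x" for i and y :: "real^'d"
  proof -
    have "(\<Prod>j\<in>UNIV - {i}. F j (n j) (x $ j)) = (\<Prod>j\<in>UNIV - {i}. F j ((n(i := Suc (n i))) j) (x $ j))"
      by (intro prod.cong) auto
    moreover have "tensor F (n(i := Suc (n i))) x = F i (Suc (n i)) (x $ i) * (\<Prod>j\<in>UNIV - {i}. F j ((n(i := Suc (n i))) j) (x $ j))"
      unfolding tensor_def by (subst prod.remove[of UNIV i]) auto
    ultimately show ?thesis by (simp only: mult_ac)
  qed
  moreover have "tensor F n = (\<lambda>x::real^'d. (\<Prod>i\<in>UNIV. F i (n i) (x $ i)))"
    by (simp add: tensor_def fun_eq_iff)
  ultimately show ?thesis by (simp only:)
qed

lemma sum_axis_mult: "(\<Sum>i\<in>UNIV. (axis j 1 :: real^'d::finite) $ i * f i) = f j"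
proof -
  have "(\<Sum>i\<in>UNIV. (axis j 1 :: real^'d) $ i * f i) = (\<Sum>i\<in>UNIV. if i = j then f i else 0)"
    by (intro sum.cong) (auto simp: axis_def)
  then show ?thesis by simp
qed

lemma count_list_Cons_upd: "count_list (j # is) = (count_list is)(j := Suc (count_list is j))"
  by auto

lemma partials_tensor:
  fixes F :: "'d::finite \<Rightarrow> nat \<Rightarrow> real \<Rightarrow> real"
  assumes F: "\<And>i. deriv_seq (F i)"
  shows "partials is (tensor F (\<lambda>_. 0)) = tensor F (count_list is)"
proof (induction "is")
  case (Cons j "is")
  show ?case
    unfolding partials.simps Cons.IH count_list_Cons_upd
      frechet_derivative_at[OF tensor_has_derivative[OF F], symmetric] sum_axis_mult ..
qed simp

lemma smooth_tensor:
  assumes F: "\<And>i. deriv_seq (F i)"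
  shows "smooth (tensor F (\<lambda>_. 0))"
  unfolding smooth_def partials_tensor[OF F]
  by (intro allI differentiableI[OF tensor_has_derivative] F)

lemma continuous_tensor: "(\<And>i. deriv_seq (F i)) \<Longrightarrow> continuous_on S (tensor F n)"
  by (intro continuous_at_imp_continuous_on ballI has_derivative_continuous[OF tensor_has_derivative])

section \<open>Smooth bump functions of one variable\<close>

text \<open>With the derivative as an existential witness, closure under sums, products and affine
  substitution is a plain induction, without a Leibniz formula.\<close>

fun Ck :: "nat \<Rightarrow> (real \<Rightarrow> real) \<Rightarrow> bool" where
  "Ck 0 f = True"
| "Ck (Suc n) f = (\<exists>g. (\<forall>x. (f has_real_derivative g x) (at x)) \<and> Ck n g)"

lemma Ck_Suc: "Ck (Suc n) f \<Longrightarrow> Ck n f"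
  by (induction n arbitrary: f) auto

lemma Ck_const: "Ck n (\<lambda>x. c)"
  by (induction n arbitrary: c) (auto intro!: exI[of _ "\<lambda>x. 0"] derivative_eq_intros)

lemma Ck_add: "Ck n f \<Longrightarrow> Ck n g \<Longrightarrow> Ck n (\<lambda>x. f x + g x)"
proof (induction n arbitrary: f g)
  case (Suc n)
  then obtain f' g' where "\<forall>x. (f has_real_derivative f' x) (at x)" "Ck n f'"
    "\<forall>x. (g has_real_derivative g' x) (at x)" "Ck n g'" by auto
  with Suc.IH show ?case
    by (auto intro!: exI[of _ "\<lambda>x. f' x + g' x"] derivative_eq_intros)
qed simp

lemma Ck_mult: "Ck n f \<Longrightarrow> Ck n g \<Longrightarrow> Ck n (\<lambda>x. f x * g x)"
proof (induction n arbitrary: f g)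
  case (Suc n)
  then obtain f' g' where d: "\<forall>x. (f has_real_derivative f' x) (at x)" "Ck n f'"
    "\<forall>x. (g has_real_derivative g' x) (at x)" "Ck n g'" by auto
  have "Ck n (\<lambda>x. f' x * g x + f x * g' x)"
    using Suc d Ck_Suc by (intro Ck_add Suc.IH) auto
  with d show ?case
    by (auto intro!: exI[of _ "\<lambda>x. f' x * g x + f x * g' x"] derivative_eq_intros)
qed simp

lemma Ck_affine: "Ck n f \<Longrightarrow> Ck n (\<lambda>x. f (a * x + b))"
proof (induction n arbitrary: f)
  case (Suc n)
  then obtain f' where d: "\<forall>x. (f has_real_derivative f' x) (at x)" "Ck n f'" by auto
  have "((\<lambda>x. f (a * x + b)) has_real_derivative a * f' (a * x + b)) (at x)" for x
  proof -
    have lin: "((\<lambda>x. a * x + b) has_real_derivative a) (at x)" by (auto intro!: derivative_eq_intros)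
    show ?thesis by (subst mult.commute) (rule DERIV_chain'[OF lin d(1)[rule_format]])
  qed
  moreover have "Ck n (\<lambda>x. a * f' (a * x + b))"
    using Suc.IH[OF d(2)] by (intro Ck_mult Ck_const)
  ultimately show ?case unfolding Ck.simps by (intro exI[of _ "\<lambda>x. a * f' (a * x + b)"] conjI allI)
qed simp

text \<open>For different \<open>n\<close> the hypothesis supplies unrelated witnesses. Uniqueness
  of the derivative identifies them, so the derivative is again in every \<open>Ck m\<close> and
  dependent choice can continue.\<close>

lemma Ck_all_sequence:
  assumes "\<And>n. Ck n f"
  obtains F where "F 0 = f" "\<And>n x. (F n has_real_derivative F (Suc n) x) (at x)"
proof -
  have "\<exists>F. \<forall>n. (\<forall>m. Ck m (F n)) \<and> (n = 0 \<longrightarrow> F n = f) \<and> (\<forall>x. (F n has_real_derivative F (Suc n) x) (at x))"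
  proof (rule dependent_nat_choice[where P="\<lambda>n f'. (\<forall>m. Ck m f') \<and> (n = 0 \<longrightarrow> f' = f)"
        and Q="\<lambda>n f g. \<forall>x. (f has_real_derivative g x) (at x)", simplified conj_assoc])
    show "\<exists>f'. (\<forall>m. Ck m f') \<and> (0 = 0 \<longrightarrow> f' = f)" using assms by auto
  next
    fix g :: "real \<Rightarrow> real" and n :: nat assume g: "(\<forall>m. Ck m g) \<and> (n = 0 \<longrightarrow> g = f)"
    then obtain h where h: "\<forall>x. (g has_real_derivative h x) (at x)" using Ck.simps(2)[of 0 g] by blast
    have "Ck m h" for m
    proof -
      obtain h' where "\<forall>x. (g has_real_derivative h' x) (at x)" "Ck m h'" using g Ck.simps(2)[of m g] by blast
      moreover from this(1) h have "h' = h" by (meson DERIV_unique ext)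
      ultimately show ?thesis by simp
    qed
    with h show "\<exists>y. (\<forall>m. Ck m y) \<and> (Suc n = 0 \<longrightarrow> y = f) \<and> (\<forall>x. (g has_real_derivative y x) (at x))" by auto
  qed
  then show ?thesis using that by blast
qed

text \<open>The polynomial factor closes the induction: with y = 1/x, the derivative of P(y) exp(-y)
  in x is y^2 (P(y) - P'(y)) exp(-y), which is the same shape with \<open>Q\<close> for
  \<open>P\<close>.\<close>

lemma Ck_exp_inverse: "Ck n (\<lambda>x. if x > 0 then poly P (1/x) * exp (- 1/x) else 0)"
proof (induction n arbitrary: P)
  case (Suc n)
  let ?f = "\<lambda>P x. if x > 0 then poly P (1/x) * exp (- 1/x) else (0::real)"
  define Q where "Q = [:0,0,1:] * (P - pderiv P)"
  have "(?f P has_real_derivative ?f Q x) (at x)" for x :: real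
  proof (cases x "0::real" rule: linorder_cases)
    case greater
    have "((\<lambda>x. poly P (1/x) * exp (- 1/x)) has_real_derivative ?f Q x) (at x)"
      using greater by (auto intro!: derivative_eq_intros simp: Q_def field_simps power2_eq_square)
    then show ?thesis
      by (rule has_field_derivative_transform_within_open[where S="{0<..}"]) (use greater in auto)
  next
    case less
    have "((\<lambda>x. 0) has_real_derivative ?f Q x) (at x)" using less by simp
    then show ?thesis
      by (rule has_field_derivative_transform_within_open[where S="{..<0}"]) (use less in auto)
  next
    case equal
    have lim: "((\<lambda>y. poly R y * exp (- y)) \<longlongrightarrow> 0) at_top" for R :: "real poly"
    proof -
      have "((\<lambda>y. \<Sum>i\<le>degree R. coeff R i * (y ^ i / exp y)) \<longlongrightarrow> (\<Sum>i\<le>degree R. coeff R i * 0)) at_top"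
        by (intro tendsto_intros tendsto_power_div_exp_0)
      then show ?thesis
        by (simp add: poly_altdef sum_divide_distrib exp_minus divide_inverse sum_distrib_right mult.assoc)
    qed
    have "((\<lambda>x. ?f P x / x) \<longlongrightarrow> 0) (at_right 0)"
    proof -
      \<comment> \<open>At 0 the difference quotient is y P(y) exp(-y) with y = 1/x, and
        \<open>pCons 0 P\<close> is the polynomial y P(y).\<close>
      have "((\<lambda>x. poly (pCons 0 P) (inverse x) * exp (- inverse x)) \<longlongrightarrow> 0) (at_right 0)"
        by (rule filterlim_compose[OF lim filterlim_inverse_at_top_right])
      then show ?thesis
        by (rule Lim_transform_eventually)
          (auto simp: eventually_at_filter field_simps)
    qed
    moreover have "((\<lambda>x. ?f P x / x) \<longlongrightarrow> 0) (at_left 0)"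
    proof (rule Lim_transform_eventually[OF tendsto_const])
      show "\<forall>\<^sub>F x in at_left 0. 0 = ?f P x / x" by (auto simp: eventually_at_filter)
    qed
    ultimately have "((\<lambda>x. ?f P x / x) \<longlongrightarrow> 0) (at 0)"
      by (simp add: filterlim_split_at)
    then show ?thesis using equal by (simp add: has_field_derivative_iff)
  qed
  with Suc.IH[of Q] show ?case unfolding Ck.simps by (intro exI[of _ "?f Q"] conjI allI)
qed simp

lemma bump_sequence:
  assumes "a > 0"
  obtains H :: "nat \<Rightarrow> real \<Rightarrow> real" where
    "deriv_seq H" "\<And>t. H 0 t \<ge> 0" "H 0 0 > 0" "\<And>n t. \<bar>t\<bar> > a \<Longrightarrow> H n t = 0"
proof -
  define g :: "real \<Rightarrow> real" where "g = (\<lambda>x. if x > 0 then exp (- 1/x) else 0)"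
  have g: "Ck n g" for n
    using Ck_exp_inverse[of n 1] by (simp add: g_def cong: if_cong)
  \<comment> \<open>One factor vanishes for x \<le> -a, the other for x \<ge> a; both are positive
    at 0.\<close>
  define h where "h = (\<lambda>x. g ((1/a) * x + 1) * g ((-1/a) * x + 1))"
  have "Ck n h" for n unfolding h_def by (intro Ck_mult Ck_affine g)
  then obtain H where H: "H 0 = h" "\<And>n x. (H n has_real_derivative H (Suc n) x) (at x)"
    using Ck_all_sequence by blast
  have h0: "h t = 0" if "\<bar>t\<bar> > a" for t
    using that assms by (auto simp: h_def g_def abs_real_def field_simps split: if_splits)
  have "\<forall>t. \<bar>t\<bar> > a \<longrightarrow> H n t = 0" for n
  proof (induction n)
    case 0 then show ?case using h0 H by auto
  next
    case (Suc n)
    show ?case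
    proof safe
      fix t :: real assume t: "\<bar>t\<bar> > a"
      have "open {t::real. \<bar>t\<bar> > a}" by (intro open_Collect_less continuous_intros)
      then have "(H n has_real_derivative 0) (at t)"
        using Suc t by (intro has_field_derivative_transform_within_open[OF DERIV_const[of 0], where S="{t. \<bar>t\<bar> > a}"]) auto
      with H(2)[of n t] show "H (Suc n) t = 0" by (rule DERIV_unique)
    qed
  qed
  then show ?thesis using that[of H] H by (auto simp: h_def g_def deriv_seq_def)
qed

text \<open>
  The derivative of multi-index \<open>\<beta>\<close> of the monomial of multi-index \<open>\<alpha>\<close>. Subtraction is truncated, so the
  coefficient vanishes as soon as \<open>\<beta> i > \<alpha> i\<close> for some \<open>i\<close>.
\<close>

definition dmono :: "('d::finite \<Rightarrow> nat) \<Rightarrow> ('d \<Rightarrow> nat) \<Rightarrow> real^'d \<Rightarrow> real" where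
  "dmono \<alpha> = tensor (\<lambda>i n t. real (\<Prod>m<n. \<alpha> i - m) * t ^ (\<alpha> i - n))"

lemma deriv_seq_power: "deriv_seq (\<lambda>n t. real (\<Prod>m<n. a - m) * t ^ (a - n))"
  unfolding deriv_seq_def
proof (intro allI)
  fix n t
  have "((\<lambda>t::real. real (\<Prod>m<n. a - m) * t ^ (a - n)) has_real_derivative
      real (\<Prod>m<n. a - m) * (real (a - n) * t ^ (a - n - 1))) (at t)"
    by (auto intro!: derivative_eq_intros)
  then show "((\<lambda>t::real. real (\<Prod>m<n. a - m) * t ^ (a - n)) has_real_derivative
      real (\<Prod>m<Suc n. a - m) * t ^ (a - Suc n)) (at t)"
    by (simp add: mult.assoc)
qed

lemma dmono_has_derivative:
  "(dmono \<alpha> \<beta> has_derivative (\<lambda>y. \<Sum>i\<in>UNIV. y $ i * dmono \<alpha> (\<beta>(i := Suc (\<beta> i))) x)) (at x)"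
  unfolding dmono_def by (intro tensor_has_derivative deriv_seq_power)

lemma dmono_0: "dmono \<alpha> (\<lambda>_. 0) x = (\<Prod>i\<in>UNIV. (x $ i) ^ \<alpha> i)"
  by (simp add: dmono_def tensor_def)

lemma continuous_dmono: "continuous_on S (dmono \<alpha> \<beta>)"
  unfolding dmono_def by (intro continuous_tensor deriv_seq_power)

section \<open>Multi-indices and lists of directions\<close>

lemma finite_mi_le: "finite {\<alpha>::'d::finite \<Rightarrow> nat. mi_order \<alpha> \<le> k}"
proof (rule finite_subset)
  show "{\<alpha>::'d \<Rightarrow> nat. mi_order \<alpha> \<le> k} \<subseteq> PiE UNIV (\<lambda>_. {..k})"
  proof (intro subsetI PiE_I)
    fix \<alpha> :: "'d \<Rightarrow> nat" and i assume "\<alpha> \<in> {\<alpha>. mi_order \<alpha> \<le> k}"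
    moreover have "\<alpha> i \<le> mi_order \<alpha>" unfolding mi_order_def by (intro member_le_sum) auto
    ultimately show "\<alpha> i \<in> {..k}" by simp
  qed auto
qed (auto intro: finite_PiE)

lemma finite_mi_eq: "finite {\<alpha>::'d::finite \<Rightarrow> nat. mi_order \<alpha> = k}"
  by (rule finite_subset[OF _ finite_mi_le[of k]]) auto

lemma mi_order_upd: "mi_order (\<beta>(i := Suc (\<beta> i))) = Suc (mi_order \<beta>)"
proof -
  have "(\<Sum>j\<in>UNIV - {i}. (\<beta>(i := Suc (\<beta> i))) j) = (\<Sum>j\<in>UNIV - {i}. \<beta> j)"
    by (intro sum.cong) auto
  then show ?thesis unfolding mi_order_def by (simp add: sum.remove[of UNIV i])
qed

lemma mi_order_count_list: "mi_order (count_list is) = length is"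
  by (induction "is") (simp add: mi_order_def, simp only: count_list_Cons_upd mi_order_upd length_Cons)

text \<open>\<open>has_weak_deriv\<close> tests with all lists of directions that have the
  prescribed counts; this lemma shows that the condition is never vacuous.\<close>

lemma ex_count_list: "\<exists>is. count_list is = (\<alpha> :: 'd::finite \<Rightarrow> nat)"
proof (induction "mi_order \<alpha>" arbitrary: \<alpha>)
  case 0
  then have "\<alpha> = (\<lambda>_. 0)" by (auto simp: mi_order_def)
  then show ?case by (intro exI[of _ "[]"]) auto
next
  case (Suc n)
  then obtain i where i: "\<alpha> i \<noteq> 0" unfolding mi_order_def by (metis sum.neutral nat.distinct(1))
  define \<beta> where "\<beta> = \<alpha>(i := \<alpha> i - 1)"
  have \<alpha>: "\<alpha> = \<beta>(i := Suc (\<beta> i))" using i by (auto simp: \<beta>_def)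
  with Suc(2) have "n = mi_order \<beta>" by (metis mi_order_upd nat.inject)
  from Suc(1)[OF this] obtain "is" where "count_list is = \<beta>" by auto
  then have "count_list (i # is) = \<alpha>" using \<alpha> by (simp only: count_list_Cons_upd)
  then show ?case by blast
qed

section \<open>Integration by parts against test functions\<close>

lemma smooth_partials_has_derivative:
  assumes "smooth \<phi>"
  shows "(partials is \<phi> has_derivative frechet_derivative (partials is \<phi>) (at x)) (at x)"
  using assms unfolding smooth_def by (simp add: frechet_derivative_works)

lemma continuous_partials: "smooth \<phi> \<Longrightarrow> continuous_on S (partials is \<phi>)"
  by (intro continuous_at_imp_continuous_on ballI has_derivative_continuous[OF smooth_partials_has_derivative])

lemma frechet_derivative_outside:
  assumes "open A" "x \<in> A" "\<And>y. y \<in> A \<Longrightarrow> f y = 0"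
  shows "(f has_derivative (\<lambda>_. 0)) (at x)"
  by (rule has_derivative_transform_within_open[OF has_derivative_const[of 0] assms(1,2)])
    (simp add: assms(3))

lemma partials_outside_support:
  assumes "x \<notin> closure {x. \<phi> x \<noteq> 0}"
  shows "partials is \<phi> x = 0"
  using assms
proof (induction "is" arbitrary: x)
  case Nil
  then show ?case using closure_subset[of "{x. \<phi> x \<noteq> 0}"] by auto
next
  case (Cons i "is")
  have "(partials is \<phi> has_derivative (\<lambda>_. 0)) (at x)"
    by (rule frechet_derivative_outside[of "- closure {x. \<phi> x \<noteq> 0}"]) (use Cons in auto)
  then show ?case by (simp add: frechet_derivative_at[symmetric])
qed

text \<open>Translation invariance: the integrals of the difference quotients all vanish.\<close>

lemma integral_directional_derivative_eq_0:
  fixes f :: "real^'d::finite \<Rightarrow> real"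
  assumes f: "\<And>x. (f has_derivative f' x) (at x)"
    and g: "\<And>x. f' x e = g x" "continuous_on UNIV g"
    and C: "compact C" "\<And>x. x \<notin> C \<Longrightarrow> f x = 0"
  shows "(LINT x|lborel. g x) = 0"
proof -
  obtain R where R: "\<And>x. x \<in> C \<Longrightarrow> norm x \<le> R" using C(1) compact_imp_bounded bounded_iff by metis
  have g0: "g x = 0" if "x \<notin> C" for x
  proof -
    have "(f has_derivative (\<lambda>_. 0)) (at x)"
      by (rule frechet_derivative_outside[of "- C"]) (use C that in \<open>auto simp: compact_imp_closed\<close>)
    then show ?thesis using has_derivative_unique[OF f[of x]] g(1) by metis
  qed
  obtain B where B: "\<And>x. \<bar>g x\<bar> \<le> B" "B \<ge> 0"
  proof -
    have "compact (g ` C)" using C(1) g(2) by (meson compact_continuous_image continuous_on_subset subset_UNIV)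
    then obtain b where b: "\<And>y. y \<in> g ` C \<Longrightarrow> norm y \<le> b" using compact_imp_bounded bounded_iff by metis
    have "\<bar>g x\<bar> \<le> \<bar>b\<bar>" for x using b[of "g x"] g0[of x] by (cases "x \<in> C") force+
    then show ?thesis using that[of "\<bar>b\<bar>"] by auto
  qed
  have [measurable]: "f \<in> borel_measurable borel"
    by (intro borel_measurable_continuous_onI continuous_at_imp_continuous_on ballI has_derivative_continuous[OF f])
  have [measurable]: "g \<in> borel_measurable borel" using g(2) by (rule borel_measurable_continuous_onI)
  have fint: "integrable lborel f"
  proof -
    have "compact (f ` C)" by (intro compact_continuous_image continuous_at_imp_continuous_on ballI has_derivative_continuous[OF f] C(1))
    then obtain b where b: "\<And>y. y \<in> f ` C \<Longrightarrow> norm y \<le> b" using compact_imp_bounded bounded_iff by metis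
    have "integrable lborel (\<lambda>x::real^'d. \<bar>b\<bar> * indicator (cball 0 R) x :: real)"
      by (intro integrable_mult_right integrable_real_indicator) (use emeasure_bounded_finite[of "cball 0 R :: (real^'d) set"] emeasure_bounded_finite[of "cball 0 (R + norm e) :: (real^'d) set"] in auto)
    then show ?thesis
    proof (rule Bochner_Integration.integrable_bound)
      show "AE x in lborel. norm (f x) \<le> norm (\<bar>b\<bar> * indicator (cball 0 R) x :: real)"
      proof (rule AE_I2)
        fix x show "norm (f x) \<le> norm (\<bar>b\<bar> * indicator (cball 0 R) x :: real)"
          using R[of x] b[of "f x"] C(2)[of x] by (cases "x \<in> C") (force simp: indicator_def)+
      qed
    qed simp
  qed
  define t where "t n = inverse (real (Suc n))" for n
  have t: "t n > 0" "t n \<le> 1" for n by (auto simp: t_def inverse_le_1_iff)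
  have t0: "t \<longlonglongrightarrow> 0" unfolding t_def by (rule LIMSEQ_inverse_real_of_nat)
  define q where "q n x = (f (t n *\<^sub>R e + x) - f x) / t n" for n x
  have line: "((\<lambda>s. f (s *\<^sub>R e + x)) has_real_derivative g (s *\<^sub>R e + x)) (at s)" for s x
  proof -
    have "((\<lambda>s. s *\<^sub>R e + x) has_derivative (\<lambda>s. s *\<^sub>R e)) (at s)"
      by (auto intro!: derivative_eq_intros)
    from has_derivative_compose[OF this f]
    have "((\<lambda>s. f (s *\<^sub>R e + x)) has_derivative (\<lambda>r. f' (s *\<^sub>R e + x) (r *\<^sub>R e))) (at s)" .
    moreover have "(\<lambda>r. f' (s *\<^sub>R e + x) (r *\<^sub>R e)) = (*) (g (s *\<^sub>R e + x))"
      using linear_cmul[OF has_derivative_linear[OF f]] g(1) by (auto simp: mult.commute)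
    ultimately show ?thesis by (simp add: has_field_derivative_def)
  qed
  \<comment> \<open>Domination: the mean value theorem bounds every quotient by \<open>B\<close>,
    and a step of length at most \<open>norm e\<close> moves the support by no more than
    that.\<close>
  have "(\<lambda>n. LINT x|lborel. q n x) \<longlonglongrightarrow> (LINT x|lborel. g x)"
  proof (rule integral_dominated_convergence[where w="\<lambda>x. B * indicator (cball 0 (R + norm e)) x"])
    show "g \<in> borel_measurable lborel" "\<And>n. q n \<in> borel_measurable lborel"
      unfolding q_def by measurable
    show "integrable lborel (\<lambda>x::real^'d. B * indicator (cball 0 (R + norm e)) x :: real)"
      by (intro integrable_mult_right integrable_real_indicator) (use emeasure_bounded_finite[of "cball 0 R :: (real^'d) set"] emeasure_bounded_finite[of "cball 0 (R + norm e) :: (real^'d) set"] in auto)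
    show "AE x in lborel. (\<lambda>n. q n x) \<longlonglongrightarrow> g x"
    proof (rule AE_I2)
      fix x
      have "((\<lambda>h. (f (h *\<^sub>R e + x) - f x) / h) \<longlongrightarrow> g x) (at 0)"
        using line[of x 0] by (simp add: DERIV_def)
      then show "(\<lambda>n. q n x) \<longlonglongrightarrow> g x"
        unfolding q_def by (rule filterlim_compose) (use t t0 in \<open>auto simp: filterlim_at less_le intro!: eventuallyI\<close>)
    qed
    show "AE x in lborel. norm (q n x) \<le> B * indicator (cball 0 (R + norm e)) x" for n
    proof (rule AE_I2)
      fix x
      show "norm (q n x) \<le> B * indicator (cball 0 (R + norm e)) x"
      proof (cases "x \<in> cball 0 (R + norm e)")
        case True
        obtain z where "f (t n *\<^sub>R e + x) - f (0 *\<^sub>R e + x) = (t n - 0) * g (z *\<^sub>R e + x)"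
          using MVT2[of 0 "t n" "\<lambda>s. f (s *\<^sub>R e + x)" "\<lambda>s. g (s *\<^sub>R e + x)"] line t by blast
        then have "q n x = g (z *\<^sub>R e + x)" using t[of n] by (simp add: q_def)
        then show ?thesis using B True by simp
      next
        case False
        have "x \<notin> C" using False R[of x] norm_ge_zero[of e] by force
        moreover have "t n *\<^sub>R e + x \<notin> C"
        proof
          assume "t n *\<^sub>R e + x \<in> C"
          from R[OF this] have "norm x \<le> R + norm (t n *\<^sub>R e)"
            using norm_triangle_ineq4[of "t n *\<^sub>R e + x" "t n *\<^sub>R e"] by simp
          also have "\<dots> \<le> R + norm e" using t[of n] by (simp add: mult_left_le_one_le)
          finally show False using False by simp
        qed
        ultimately show ?thesis using C(2) False by (simp add: q_def)
      qed
    qed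
  qed
  moreover have "(LINT x|lborel. q n x) = 0" for n
  proof -
    have "integrable (distr lborel borel ((+) (t n *\<^sub>R e))) f"
      using fint by (simp add: lborel_distr_plus)
    then have "integrable lborel (\<lambda>x. f (t n *\<^sub>R e + x))" by (simp add: integrable_distr_eq)
    moreover have "(LINT x|distr lborel borel ((+) (t n *\<^sub>R e)). f x) = (LINT x|lborel. f (t n *\<^sub>R e + x))"
      by (rule integral_distr) auto
    then have "(LINT x|lborel. f (t n *\<^sub>R e + x)) = (LINT x|lborel. f x)" by (simp add: lborel_distr_plus)
    ultimately show ?thesis using fint unfolding q_def by simp
  qed
  ultimately show ?thesis using LIMSEQ_unique[OF _ tendsto_const[of 0]] by simp
qed

lemma integral_lebesgue_on_open:
  fixes f :: "real^'d::finite \<Rightarrow> real"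
  assumes "open U" "\<And>x. x \<notin> U \<Longrightarrow> f x = 0" "f \<in> borel_measurable borel"
  shows "(LINT x|lebesgue_on U. f x) = (LINT x|lborel. f x)"
proof -
  have "U \<in> sets lebesgue" using assms(1) borel_open by auto
  then have "(LINT x|lebesgue_on U. f x) = (LINT x|lebesgue. indicator U x *\<^sub>R f x)"
    by (subst integral_restrict_space) auto
  also have "(\<lambda>x. indicator U x *\<^sub>R f x) = f" using assms(2) by (force simp: indicator_def)
  also have "(LINT x|lebesgue. f x) = (LINT x|lborel. f x)"
    using assms(3) by (subst integral_completion) auto
  finally show ?thesis .
qed

lemma test_functionD:
  assumes "test_function U \<phi>"
  shows "smooth \<phi>" "compact (closure {x. \<phi> x \<noteq> 0})" "closure {x. \<phi> x \<noteq> 0} \<subseteq> U"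
  using assms by (auto simp: test_function_def)

lemma integrable_continuous_times_partials:
  fixes f :: "real^'d::finite \<Rightarrow> real"
  assumes f: "continuous_on UNIV f" and \<phi>: "test_function U \<phi>"
  shows "integrable lborel (\<lambda>x. f x * partials is \<phi> x)"
proof -
  have "continuous_on UNIV (\<lambda>x. f x * partials is \<phi> x)"
    by (intro continuous_on_mult f continuous_partials test_functionD(1)[OF \<phi>])
  then have "set_integrable lborel (closure {x. \<phi> x \<noteq> 0}) (\<lambda>x. f x * partials is \<phi> x)"
    unfolding set_integrable_def
    by (intro borel_integrable_compact test_functionD(2)[OF \<phi>]) (rule continuous_on_subset, auto)
  then show ?thesis unfolding set_integrable_def
    by (rule back_subst[where P="integrable lborel"])
      (use partials_outside_support in \<open>fastforce simp: indicator_def\<close>)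
qed

text \<open>The product of a monomial derivative and a test function derivative has compact support,
  so the integral of its partial derivative vanishes. This moves one direction at a time onto the
  monomial, which is why \<open>\<beta>\<close> varies in the induction.\<close>

lemma integral_by_parts_dmono:
  assumes \<phi>: "test_function U \<phi>"
  shows "(LINT x|lborel. dmono \<alpha> \<beta> x * partials is \<phi> x)
     = (- 1) ^ length is * (LINT x|lborel. dmono \<alpha> (\<lambda>i. \<beta> i + count_list is i) x * \<phi> x)"
proof (induction "is" arbitrary: \<beta>)
  case (Cons i "is")
  note sm = test_functionD(1)[OF \<phi>] and cp = test_functionD(2)[OF \<phi>]
  note int = integrable_continuous_times_partials[OF continuous_dmono \<phi>]
  let ?\<beta> = "\<beta>(i := Suc (\<beta> i))"
  have "(LINT x|lborel. dmono \<alpha> \<beta> x * partials (i # is) \<phi> x + dmono \<alpha> ?\<beta> x * partials is \<phi> x) = 0"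
  proof (rule integral_directional_derivative_eq_0)
    show "((\<lambda>x. dmono \<alpha> \<beta> x * partials is \<phi> x) has_derivative
        (\<lambda>y. dmono \<alpha> \<beta> x * frechet_derivative (partials is \<phi>) (at x) y
             + (\<Sum>i\<in>UNIV. y $ i * dmono \<alpha> (\<beta>(i := Suc (\<beta> i))) x) * partials is \<phi> x)) (at x)" for x
      by (intro has_derivative_mult dmono_has_derivative smooth_partials_has_derivative sm)
    show "dmono \<alpha> \<beta> x * frechet_derivative (partials is \<phi>) (at x) (axis i 1)
             + (\<Sum>j\<in>UNIV. axis i 1 $ j * dmono \<alpha> (\<beta>(j := Suc (\<beta> j))) x) * partials is \<phi> x
        = dmono \<alpha> \<beta> x * partials (i # is) \<phi> x + dmono \<alpha> ?\<beta> x * partials is \<phi> x" for x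
      by (simp add: sum_axis_mult)
    show "continuous_on UNIV (\<lambda>x. dmono \<alpha> \<beta> x * partials (i # is) \<phi> x + dmono \<alpha> ?\<beta> x * partials is \<phi> x)"
      by (intro continuous_intros continuous_dmono continuous_partials sm)
    show "compact (closure {x. \<phi> x \<noteq> 0})" by fact
    show "\<And>x. x \<notin> closure {x. \<phi> x \<noteq> 0} \<Longrightarrow> dmono \<alpha> \<beta> x * partials is \<phi> x = 0"
      by (simp add: partials_outside_support)
  qed
  then have "(LINT x|lborel. dmono \<alpha> \<beta> x * partials (i # is) \<phi> x) = - (LINT x|lborel. dmono \<alpha> ?\<beta> x * partials is \<phi> x)"
    by (subst (asm) Bochner_Integration.integral_add) (auto intro: int simp del: partials.simps)
  also have "(\<lambda>j. ?\<beta> j + count_list is j) = (\<lambda>j. \<beta> j + count_list (i # is) j)" by auto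
  then have "- (LINT x|lborel. dmono \<alpha> ?\<beta> x * partials is \<phi> x)
      = (- 1) ^ length (i # is) * (LINT x|lborel. dmono \<alpha> (\<lambda>j. \<beta> j + count_list (i # is) j) x * \<phi> x)"
    unfolding Cons.IH by simp
  finally show ?case .
qed simp

section \<open>Mollification\<close>

lemma nn_integral_lborel_affine:
  fixes f :: "real^'d::finite \<Rightarrow> ennreal"
  assumes [measurable]: "f \<in> borel_measurable borel" and "c \<noteq> 0"
  shows "(\<integral>\<^sup>+x. f x \<partial>lborel) = ennreal (\<bar>c\<bar> ^ CARD('d)) * (\<integral>\<^sup>+x. f (t + c *\<^sub>R x) \<partial>lborel)"
  by (subst lborel_affine[OF assms(2), of t]) (simp add: nn_integral_density nn_integral_distr nn_integral_cmult)

lemma nn_integral_lborel_reflect: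
  fixes f :: "real^'d::finite \<Rightarrow> ennreal"
  assumes [measurable]: "f \<in> borel_measurable borel"
  shows "(\<integral>\<^sup>+x. f (t - x) \<partial>lborel) = (\<integral>\<^sup>+x. f x \<partial>lborel)"
  using nn_integral_lborel_affine[OF assms, of "-1" t] by simp

lemma nn_integral_lborel_translate:
  fixes f :: "real^'d::finite \<Rightarrow> ennreal"
  assumes [measurable]: "f \<in> borel_measurable borel"
  shows "(\<integral>\<^sup>+x. f (x - t) \<partial>lborel) = (\<integral>\<^sup>+x. f x \<partial>lborel)"
  using nn_integral_lborel_affine[OF assms, of 1 "-t"] by simp

section \<open>Construction of mollifiers\<close>

text \<open>The whole derivative family \<open>F\<close> is kept, so that derivatives of a
  convolution are convolutions with other members \<open>tensor F n\<close>, all with the same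
  support bound.\<close>

definition mollifier :: "real \<Rightarrow> ('d::finite \<Rightarrow> nat \<Rightarrow> real \<Rightarrow> real) \<Rightarrow> bool" where
  "mollifier e F \<longleftrightarrow> e > 0 \<and> (\<forall>i. deriv_seq (F i)) \<and>
     (\<forall>n x. norm x \<ge> e \<longrightarrow> tensor F n (x::real^'d) = 0) \<and>
     (\<forall>x::real^'d. tensor F (\<lambda>_. 0) x \<ge> 0) \<and> (\<integral>\<^sup>+x. tensor F (\<lambda>_. 0) (x::real^'d) \<partial>lborel) = 1"

lemma compact_support_bounded:
  fixes f :: "real^'d::finite \<Rightarrow> real"
  assumes "continuous_on UNIV f" "\<And>x. norm x \<ge> e \<Longrightarrow> f x = 0"
  obtains B where "B \<ge> 0" "\<And>x. \<bar>f x\<bar> \<le> B"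
proof -
  have "compact (f ` cball 0 e)"
    using assms(1) by (meson compact_continuous_image continuous_on_subset subset_UNIV compact_cball)
  then obtain b where b: "\<And>y. y \<in> f ` cball 0 e \<Longrightarrow> norm y \<le> b" using compact_imp_bounded bounded_iff by metis
  have "\<bar>f x\<bar> \<le> \<bar>b\<bar>" for x using b[of "f x"] assms(2)[of x] by (cases "norm x \<le> e") force+
  then show ?thesis using that[of "\<bar>b\<bar>"] by auto
qed

lemma mollifier_exists:
  assumes "e > 0"
  obtains F :: "'d::finite \<Rightarrow> nat \<Rightarrow> real \<Rightarrow> real" where "mollifier e F"
proof -
  \<comment> \<open>If all coordinates are at most \<open>a\<close> in absolute value, the sum of
    their absolute values, and with it the norm, is at most e/2 < e.\<close>
  define a where "a = e / (2 * real CARD('d))"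
  have a: "a > 0" using assms by (simp add: a_def)
  obtain H where H: "deriv_seq H" "\<And>t. H 0 t \<ge> 0" "H 0 0 > 0" "\<And>n t. \<bar>t\<bar> > a \<Longrightarrow> H n t = 0"
    using bump_sequence[OF a] by metis
  define T :: "('d \<Rightarrow> nat) \<Rightarrow> real^'d \<Rightarrow> real" where "T = tensor (\<lambda>i. H)"
  have T0: "T n x = 0" if "norm x \<ge> e" for n x
  proof (rule ccontr)
    assume "T n x \<noteq> 0"
    then have "\<forall>i. H (n i) (x $ i) \<noteq> 0" unfolding T_def tensor_def by simp
    then have "\<bar>x $ i\<bar> \<le> a" for i using H(4)[where n="n i" and t="x $ i"] by (metis not_le)
    then have "(\<Sum>i\<in>UNIV. \<bar>x $ i\<bar>) \<le> (\<Sum>i\<in>(UNIV::'d set). a)" by (intro sum_mono)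
    then have "norm x \<le> e / 2" using norm_le_l1_cart[of x] by (simp add: a_def)
    with that assms show False by simp
  qed
  have Tpos: "T (\<lambda>_. 0) x \<ge> 0" for x using H(2) by (auto simp: T_def tensor_def intro!: prod_nonneg)
  have cont: "continuous_on UNIV (T n)" for n unfolding T_def by (intro continuous_tensor H)
  have [measurable]: "T n \<in> borel_measurable borel" for n by (intro borel_measurable_continuous_onI cont)
  obtain B where B: "B \<ge> 0" "\<And>x. \<bar>T (\<lambda>_. 0) x\<bar> \<le> B" using compact_support_bounded[OF cont T0] by metis
  define c where "c = (\<integral>\<^sup>+x. T (\<lambda>_. 0) x \<partial>lborel)"
  have "c \<le> (\<integral>\<^sup>+x. ennreal B * indicator (cball 0 e :: (real^'d) set) x \<partial>lborel)"
    unfolding c_def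
  proof (intro nn_integral_mono)
    fix x :: "real^'d"
    show "ennreal (T (\<lambda>_. 0) x) \<le> ennreal B * indicator (cball 0 e) x"
      using T0[of x] B(2)[of x] by (cases "norm x \<le> e") (auto simp: ennreal_leI abs_le_iff)
  qed
  also have "\<dots> = ennreal B * emeasure lborel (cball 0 e :: (real^'d) set)"
    by (subst nn_integral_cmult_indicator) auto
  also have "\<dots> < \<infinity>"
    using emeasure_bounded_finite[OF bounded_cball, of "0 :: real^'d" e] by (simp add: ennreal_mult_less_top)
  finally have cfin: "c < \<infinity>" .
  have "c > 0"
  proof -
    have T00: "T (\<lambda>_. 0) 0 > 0" using H(3) by (auto simp: T_def tensor_def intro!: prod_pos)
    have "open {y. T (\<lambda>_. 0) 0 / 2 < T (\<lambda>_. 0) y}"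
      by (intro open_Collect_less continuous_intros cont)
    then obtain d where d: "d > 0" "ball 0 d \<subseteq> {y. T (\<lambda>_. 0) 0 / 2 < T (\<lambda>_. 0) y}"
      using T00 by (metis (mono_tags, lifting) mem_Collect_eq open_contains_ball half_gt_zero field_sum_of_halves less_add_same_cancel1)
    have "measure lborel (ball 0 d :: (real^'d) set) > 0" by (rule content_ball_pos[OF d(1)])
    then have "emeasure lborel (ball 0 d :: (real^'d) set) \<noteq> 0" by (auto simp: measure_def)
    then have "0 < ennreal (T (\<lambda>_. 0) 0 / 2) * emeasure lborel (ball 0 d :: (real^'d) set)"
      using T00 by (simp add: ennreal_zero_less_mult_iff zero_less_iff_neq_zero)
    also have "\<dots> = (\<integral>\<^sup>+x. ennreal (T (\<lambda>_. 0) 0 / 2) * indicator (ball 0 d :: (real^'d) set) x \<partial>lborel)"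
      by (subst nn_integral_cmult_indicator) auto
    also have "\<dots> \<le> c"
      unfolding c_def
    proof (intro nn_integral_mono)
      fix x :: "real^'d"
      show "ennreal (T (\<lambda>_. 0) 0 / 2) * indicator (ball 0 d) x \<le> ennreal (T (\<lambda>_. 0) x)"
      proof (cases "x \<in> ball 0 d")
        case True
        then have "T (\<lambda>_. 0) 0 / 2 < T (\<lambda>_. 0) x" using d(2) by blast
        then show ?thesis using True by (simp add: ennreal_leI)
      qed simp
    qed
    finally show ?thesis .
  qed
  define r where "r = enn2real c"
  have r: "c = ennreal r" "r > 0" using cfin \<open>c > 0\<close> by (auto simp: r_def enn2real_positive_iff)
  \<comment> \<open>Each of the d factors is scaled by \<open>s\<close>, so the tensor and all its
    derivatives are multiplied by \<open>s\<close> to the power d, that is, by 1/r.\<close>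
  define s where "s = root CARD('d) (1 / r)"
  have s: "s ^ CARD('d) = 1 / r" "s > 0" using r by (auto simp: s_def)
  define F where "F = (\<lambda>(i::'d) n t. s * H n t)"
  have F: "tensor F n x = (1/r) * T n x" for n x
    by (simp add: F_def T_def tensor_def prod.distrib s)
  have "mollifier e F" unfolding mollifier_def
  proof (intro conjI allI impI)
    show "deriv_seq (F i)" for i using H(1) by (auto simp: F_def deriv_seq_def intro!: DERIV_cmult)
    show "(\<integral>\<^sup>+x. tensor F (\<lambda>_. 0) (x::real^'d) \<partial>lborel) = 1"
    proof -
      have "(\<integral>\<^sup>+x. tensor F (\<lambda>_. 0) (x::real^'d) \<partial>lborel) = (\<integral>\<^sup>+x. ennreal (1/r) * ennreal (T (\<lambda>_. 0) x) \<partial>lborel)"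
        using r(2) Tpos by (intro nn_integral_cong) (simp add: F ennreal_mult[symmetric] del: times_divide_eq_left)
      also have "\<dots> = ennreal (1/r) * c" unfolding c_def by (rule nn_integral_cmult) simp
      also have "\<dots> = 1" using r by (simp add: ennreal_mult[symmetric])
      finally show ?thesis .
    qed
  qed (use assms T0 Tpos r in \<open>auto simp: F\<close>)
  then show ?thesis by (rule that)
qed

lemma mollifierD:
  fixes F :: "'d::finite \<Rightarrow> nat \<Rightarrow> real \<Rightarrow> real"
  assumes "mollifier e F"
  shows "e > 0" "\<And>i. deriv_seq (F i)" "\<And>n x. norm x \<ge> e \<Longrightarrow> tensor F n (x::real^'d) = 0"
    "\<And>x::real^'d. tensor F (\<lambda>_. 0) x \<ge> 0" "(\<integral>\<^sup>+x. tensor F (\<lambda>_. 0) (x::real^'d) \<partial>lborel) = 1"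
    "\<And>n S. continuous_on S (tensor F n)" "\<And>n. tensor F n \<in> borel_measurable borel"
  using assms unfolding mollifier_def
  by (auto intro: continuous_tensor borel_measurable_continuous_onI)

lemma mollifier_bounded:
  fixes F :: "'d::finite \<Rightarrow> nat \<Rightarrow> real \<Rightarrow> real"
  assumes "mollifier e F"
  obtains B where "B \<ge> 0" "\<And>x::real^'d. \<bar>tensor F n x\<bar> \<le> B"
  using compact_support_bounded[OF mollifierD(6,3)[OF assms]] by metis

section \<open>Convolutions and their derivatives\<close>

definition conv :: "(real^'d::finite \<Rightarrow> real) \<Rightarrow> (real^'d \<Rightarrow> real) \<Rightarrow> real^'d \<Rightarrow> real" where
  "conv u \<eta> x = (LINT z|lborel. u z * \<eta> (x - z))"

lemma integrable_mult_bounded: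
  fixes u \<eta> :: "'a \<Rightarrow> real"
  assumes "integrable M u" "\<eta> \<in> borel_measurable M" "\<And>x. \<bar>\<eta> x\<bar> \<le> B"
  shows "integrable M (\<lambda>x. u x * \<eta> x)"
proof (rule Bochner_Integration.integrable_bound[of _ "\<lambda>x. B * u x"])
  have "B \<ge> 0" using assms(3)[of undefined] by simp
  then show "AE x in M. norm (u x * \<eta> x) \<le> norm (B * u x)"
    using assms(3) by (auto simp: abs_mult mult.commute[of B] intro!: mult_left_mono)
qed (use assms in auto)

lemma integrable_conv:
  fixes u :: "real^'d::finite \<Rightarrow> real"
  assumes "integrable lborel u" "\<eta> \<in> borel_measurable borel" "\<And>x. \<bar>\<eta> x\<bar> \<le> B"
  shows "integrable lborel (\<lambda>z. u z * \<eta> (x - z))"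
  by (rule integrable_mult_bounded[where B=B]) (use assms in auto)

text \<open>Dominated convergence: the bound on \<open>\<Psi>\<close> is also a bound on the
  difference quotients of \<open>\<Phi>\<close>, by the mean value inequality.\<close>

lemma DERIV_integral_bounded:
  fixes u :: "'a \<Rightarrow> real" and \<Phi> \<Psi> :: "real \<Rightarrow> 'a \<Rightarrow> real"
  assumes u: "integrable M u"
    and m: "\<And>t. \<Phi> t \<in> borel_measurable M" "\<And>t. \<Psi> t \<in> borel_measurable M"
    and bd: "\<And>t z. \<bar>\<Phi> t z\<bar> \<le> A" "\<And>t z. \<bar>\<Psi> t z\<bar> \<le> B"
    and D: "\<And>t z. ((\<lambda>t. \<Phi> t z) has_real_derivative \<Psi> t z) (at t)"
  shows "((\<lambda>t. LINT z|M. u z * \<Phi> t z) has_real_derivative (LINT z|M. u z * \<Psi> t z)) (at t)"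
proof -
  have int: "integrable M (\<lambda>z. u z * \<Phi> t z)" for t by (rule integrable_mult_bounded[OF u m(1) bd(1)])
  have "((\<lambda>h. LINT z|M. u z * ((\<Phi> (t + h) z - \<Phi> t z) / h)) \<longlongrightarrow> (LINT z|M. u z * \<Psi> t z)) (at 0)"
    unfolding tendsto_at_iff_sequentially comp_def
  proof safe
    fix X :: "nat \<Rightarrow> real" assume X: "\<forall>i. X i \<in> UNIV - {0}" "X \<longlonglongrightarrow> 0"
    show "(\<lambda>n. LINT z|M. u z * ((\<Phi> (t + X n) z - \<Phi> t z) / X n)) \<longlonglongrightarrow> (LINT z|M. u z * \<Psi> t z)"
    proof (rule integral_dominated_convergence[where w="\<lambda>z. B * \<bar>u z\<bar>"])
      show "integrable M (\<lambda>z. B * \<bar>u z\<bar>)" using u by auto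
      show "(\<lambda>z. u z * \<Psi> t z) \<in> borel_measurable M"
        "\<And>n. (\<lambda>z. u z * ((\<Phi> (t + X n) z - \<Phi> t z) / X n)) \<in> borel_measurable M"
        using u m by (auto intro!: borel_measurable_times borel_measurable_divide borel_measurable_diff)
      show "AE z in M. (\<lambda>n. u z * ((\<Phi> (t + X n) z - \<Phi> t z) / X n)) \<longlonglongrightarrow> u z * \<Psi> t z"
      proof (intro AE_I2 tendsto_mult_left)
        fix z
        have "((\<lambda>h. (\<Phi> (t + h) z - \<Phi> t z) / h) \<longlongrightarrow> \<Psi> t z) (at 0)"
          using D[of z t] by (simp add: DERIV_def)
        then show "(\<lambda>n. (\<Phi> (t + X n) z - \<Phi> t z) / X n) \<longlonglongrightarrow> \<Psi> t z"
          using X unfolding tendsto_at_iff_sequentially comp_def by blast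
      qed
      show "AE z in M. norm (u z * ((\<Phi> (t + X n) z - \<Phi> t z) / X n)) \<le> B * \<bar>u z\<bar>" for n
      proof (rule AE_I2)
        fix z
        have x0: "X n \<noteq> 0" using X by auto
        have "\<bar>\<Phi> (t + X n) z - \<Phi> t z\<bar> \<le> B * \<bar>X n\<bar>"
          using field_differentiable_bound[of UNIV "\<lambda>t. \<Phi> t z" "\<lambda>t. \<Psi> t z" B "t + X n" t] D bd(2)
          by auto
        then have "\<bar>(\<Phi> (t + X n) z - \<Phi> t z) / X n\<bar> \<le> B"
          using x0 by (simp add: field_simps)
        then have "\<bar>u z\<bar> * \<bar>(\<Phi> (t + X n) z - \<Phi> t z) / X n\<bar> \<le> \<bar>u z\<bar> * B"
          by (rule mult_left_mono) simp
        then show "norm (u z * ((\<Phi> (t + X n) z - \<Phi> t z) / X n)) \<le> B * \<bar>u z\<bar>"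
          by (simp add: abs_mult mult.commute)
      qed
    qed
  qed
  moreover have "(LINT z|M. u z * ((\<Phi> (t + h) z - \<Phi> t z) / h))
      = ((LINT z|M. u z * \<Phi> (t + h) z) - (LINT z|M. u z * \<Phi> t z)) / h" for h
    using int by (simp add: right_diff_distrib diff_divide_distrib)
  ultimately show ?thesis unfolding DERIV_def by (simp only:)
qed

text \<open>All derivatives fall on the kernel, so \<open>u\<close> enters only through its
  integrability. Derivatives along lines are what the segment arguments for the Poincare and Sobolev
  inequalities consume.\<close>

lemma conv_line_derivative:
  fixes u :: "real^'d::finite \<Rightarrow> real"
  assumes F: "mollifier e F" and u: "integrable lborel u"
  shows "((\<lambda>t. conv u (tensor F n) (y + t *\<^sub>R w)) has_real_derivative
     (\<Sum>i\<in>UNIV. w $ i * conv u (tensor F (n(i := Suc (n i)))) (y + t *\<^sub>R w))) (at t)"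
proof -
  let ?n = "\<lambda>i. n(i := Suc (n i))"
  have meas[measurable]: "tensor F n \<in> borel_measurable borel" for n by (rule mollifierD(7)[OF F])
  obtain A where A: "\<And>x. \<bar>tensor F n x\<bar> \<le> A" using mollifier_bounded[OF F, of n] by metis
  have "\<forall>i. \<exists>B. \<forall>x. \<bar>tensor F (?n i) x\<bar> \<le> B" using mollifier_bounded[OF F] by metis
  then obtain B where B: "\<And>i x. \<bar>tensor F (?n i) x\<bar> \<le> B i" by metis
  define \<Psi> where "\<Psi> t z = (\<Sum>i\<in>UNIV. w $ i * tensor F (?n i) (y + t *\<^sub>R w - z))" for t z
  have "((\<lambda>t. LINT z|lborel. u z * tensor F n (y + t *\<^sub>R w - z)) has_real_derivative
     (LINT z|lborel. u z * \<Psi> t z)) (at t)"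
  proof (rule DERIV_integral_bounded[OF u])
    show "\<bar>tensor F n (y + t *\<^sub>R w - z)\<bar> \<le> A" for t z by (rule A)
    show "\<bar>\<Psi> t z\<bar> \<le> (\<Sum>i\<in>UNIV. \<bar>w $ i\<bar> * B i)" for t z
      unfolding \<Psi>_def by (intro order.trans[OF sum_abs] sum_mono) (auto simp: abs_mult intro!: mult_left_mono B)
    show "((\<lambda>t. tensor F n (y + t *\<^sub>R w - z)) has_real_derivative \<Psi> t z) (at t)" for t z
    proof -
      have "((\<lambda>t. y + t *\<^sub>R w - z) has_derivative (\<lambda>s. s *\<^sub>R w)) (at t)"
        by (auto intro!: derivative_eq_intros)
      from has_derivative_compose[OF this tensor_has_derivative[OF mollifierD(2)[OF F]]]
      have "((\<lambda>t. tensor F n (y + t *\<^sub>R w - z)) has_derivative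
        (\<lambda>s. \<Sum>i\<in>UNIV. (s *\<^sub>R w) $ i * tensor F (?n i) (y + t *\<^sub>R w - z))) (at t)" .
      moreover have "(\<lambda>s. \<Sum>i\<in>UNIV. (s *\<^sub>R w) $ i * tensor F (?n i) (y + t *\<^sub>R w - z)) = (*) (\<Psi> t z)"
        by (auto simp: \<Psi>_def sum_distrib_left sum_distrib_right mult_ac)
      ultimately show ?thesis by (simp add: has_field_derivative_def)
    qed
  qed (simp_all add: \<Psi>_def)
  moreover have "(LINT z|lborel. u z * \<Psi> t z) = (\<Sum>i\<in>UNIV. w $ i * conv u (tensor F (?n i)) (y + t *\<^sub>R w))"
  proof -
    have "(LINT z|lborel. u z * \<Psi> t z)
        = (LINT z|lborel. (\<Sum>i\<in>UNIV. w $ i * (u z * tensor F (?n i) (y + t *\<^sub>R w - z))))"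
      by (simp add: \<Psi>_def sum_distrib_left mult_ac)
    also have "\<dots> = (\<Sum>i\<in>UNIV. w $ i * conv u (tensor F (?n i)) (y + t *\<^sub>R w))"
      unfolding conv_def by (subst Bochner_Integration.integral_sum) (auto intro!: integrable_conv[OF u _ B])
    finally show ?thesis .
  qed
  ultimately show ?thesis by (simp add: conv_def)
qed

lemma continuous_conv:
  fixes u :: "real^'d::finite \<Rightarrow> real"
  assumes F: "mollifier e F" and u: "integrable lborel u"
  shows "continuous_on S (conv u (tensor F n))"
proof -
  have [measurable]: "tensor F n \<in> borel_measurable borel" by (rule mollifierD(7)[OF F])
  have [measurable]: "u \<in> borel_measurable borel" using u by auto
  obtain B where B: "\<And>x. \<bar>tensor F n x\<bar> \<le> B" using mollifier_bounded[OF F, of n] by metis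
  have cont: "isCont (tensor F n) x" for x
    using mollifierD(6)[OF F, of UNIV n] by (simp add: continuous_on_eq_continuous_at)
  have "isCont (conv u (tensor F n)) x" for x
    unfolding continuous_at_sequentially comp_def conv_def
  proof safe
    fix X :: "nat \<Rightarrow> real^'d" assume X: "X \<longlonglongrightarrow> x"
    show "(\<lambda>k. LINT z|lborel. u z * tensor F n (X k - z)) \<longlonglongrightarrow> (LINT z|lborel. u z * tensor F n (x - z))"
    proof (rule integral_dominated_convergence[where w="\<lambda>z. B * \<bar>u z\<bar>"])
      show "AE z in lborel. (\<lambda>k. u z * tensor F n (X k - z)) \<longlonglongrightarrow> u z * tensor F n (x - z)"
        by (intro AE_I2 tendsto_mult_left isCont_tendsto_compose[OF cont] tendsto_intros X)
      show "AE z in lborel. norm (u z * tensor F n (X k - z)) \<le> B * \<bar>u z\<bar>" for k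
        using B by (auto simp: abs_mult mult.commute[of B] intro!: mult_left_mono)
    qed (use u in auto)
  qed
  then show ?thesis by (simp add: continuous_at_imp_continuous_on)
qed

section \<open>Borel representatives\<close>

text \<open>Sobolev functions are only Lebesgue measurable, and only on \<open>T\<close>.
  Convolution, Fubini and substitution take place on \<open>lborel\<close>, so they are applied to a
  Borel version extended by zero.\<close>

definition borel_rep :: "(real^'d::finite) set \<Rightarrow> (real^'d \<Rightarrow> real) \<Rightarrow> (real^'d \<Rightarrow> real) \<Rightarrow> bool" where
  "borel_rep T u u0 \<longleftrightarrow> u \<in> borel_measurable (lebesgue_on T) \<and> u0 \<in> borel_measurable borel \<and>
     (\<forall>x. x \<notin> T \<longrightarrow> u0 x = 0) \<and> (AE x in lborel. x \<in> T \<longrightarrow> u x = u0 x)"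

lemma borel_rep_exists:
  fixes u :: "real^'d::finite \<Rightarrow> real"
  assumes "open T" "u \<in> borel_measurable (lebesgue_on T)"
  obtains u0 where "borel_rep T u u0"
proof -
  have T[measurable]: "T \<in> sets borel" "T \<in> sets lebesgue" using assms(1) borel_open by auto
  have "(\<lambda>x. indicator T x *\<^sub>R u x) \<in> borel_measurable lebesgue"
    using assms(2) T by (subst (asm) borel_measurable_restrict_space_iff) auto
  then obtain w where w: "w \<in> borel_measurable lborel" "AE x in lborel. indicator T x *\<^sub>R u x = w x"
    using completion_ex_borel_measurable_real by blast
  have "borel_rep T u (\<lambda>x. indicator T x * w x)"
    unfolding borel_rep_def using w assms(2) by (auto elim!: eventually_mono)
  then show ?thesis by (rule that)
qed

lemma borel_rep_integral:
  fixes u :: "real^'d::finite \<Rightarrow> real"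
  assumes "open T" and rep: "borel_rep T u u0" and \<psi>: "\<psi> \<in> borel_measurable borel"
  shows "(LINT x|lebesgue_on T. u x * \<psi> x) = (LINT x|lborel. u0 x * \<psi> x)"
proof -
  have T: "T \<in> sets lebesgue" using assms(1) borel_open by auto
  have u: "(\<lambda>x. indicator T x *\<^sub>R u x) \<in> borel_measurable lebesgue"
    using rep T by (subst (asm) borel_rep_def, subst (asm) borel_measurable_restrict_space_iff) auto
  have u0: "u0 \<in> borel_measurable lborel" using rep by (simp add: borel_rep_def)
  have "(LINT x|lebesgue_on T. u x * \<psi> x) = (LINT x|lebesgue. indicator T x *\<^sub>R (u x * \<psi> x))"
    using T by (subst integral_restrict_space) auto
  also have "\<dots> = (LINT x|lebesgue. u0 x * \<psi> x)"
  proof (rule integral_cong_AE)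
    have \<psi>': "\<psi> \<in> borel_measurable lebesgue" using \<psi> by (simp add: measurable_completion)
    show "(\<lambda>x. indicator T x *\<^sub>R (u x * \<psi> x)) \<in> borel_measurable lebesgue"
      using borel_measurable_times[OF u \<psi>'] by (simp add: mult.assoc)
    show "(\<lambda>x. u0 x * \<psi> x) \<in> borel_measurable lebesgue"
      using borel_measurable_times[OF measurable_completion[OF u0] \<psi>'] .
    have "AE x in lborel. x \<in> T \<longrightarrow> u x = u0 x" using rep by (simp add: borel_rep_def)
    then have "AE x in lebesgue. x \<in> T \<longrightarrow> u x = u0 x" by (rule AE_completion)
    then show "AE x in lebesgue. indicator T x *\<^sub>R (u x * \<psi> x) = u0 x * \<psi> x"
      by eventually_elim (use rep in \<open>auto simp: borel_rep_def indicator_def\<close>)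
  qed
  also have "\<dots> = (LINT x|lborel. u0 x * \<psi> x)"
    using u0 \<psi> by (intro integral_completion borel_measurable_times) auto
  finally show ?thesis .
qed

lemma borel_rep_nn_integral:
  fixes u :: "real^'d::finite \<Rightarrow> real"
  assumes "open T" and rep: "borel_rep T u u0" and "f 0 = 0"
  shows "(\<integral>\<^sup>+x. f (u x) \<partial>lebesgue_on T) = (\<integral>\<^sup>+x. f (u0 x) \<partial>lborel)"
proof -
  have T: "T \<in> sets lebesgue" using assms(1) borel_open by auto
  have "(\<integral>\<^sup>+x. f (u x) \<partial>lebesgue_on T) = (\<integral>\<^sup>+x. f (u x) * indicator T x \<partial>lborel)"
    using T by (subst nn_integral_restrict_space) (auto simp: nn_integral_completion)
  also have "AE x in lborel. x \<in> T \<longrightarrow> u x = u0 x" using rep by (simp add: borel_rep_def)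
  then have "(\<integral>\<^sup>+x. f (u x) * indicator T x \<partial>lborel) = (\<integral>\<^sup>+x. f (u0 x) \<partial>lborel)"
    by (intro nn_integral_cong_AE, eventually_elim)
      (use rep assms(3) in \<open>auto simp: borel_rep_def indicator_def\<close>)
  finally show ?thesis .
qed

section \<open>Mollification of weak derivatives\<close>

text \<open>The reflected and translated kernel is again a tensor: the family \<open>F'\<close>
  absorbs the factor -1 that every derivative in \<open>z\<close> produces.\<close>

lemma mollifier_test_function:
  fixes F :: "'d::finite \<Rightarrow> nat \<Rightarrow> real \<Rightarrow> real"
  assumes F: "mollifier e F" and sub: "cball x e \<subseteq> T"
  shows "test_function T (\<lambda>z. tensor F (\<lambda>_. 0) (x - z))"
    and "partials is (\<lambda>z. tensor F (\<lambda>_. 0) (x - z)) = (\<lambda>z. (- 1) ^ length is * tensor F (count_list is) (x - z))"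
proof -
  define F' where "F' i n t = (- 1) ^ n * F i n (x $ i - t)" for i n t
  have eq: "tensor F' n z = (- 1) ^ mi_order n * tensor F n (x - z)" for n z
    by (simp add: tensor_def F'_def prod.distrib mi_order_def power_sum)
  have F': "deriv_seq (F' i)" for i
    unfolding deriv_seq_def
  proof (intro allI)
    fix n t
    have "((\<lambda>t. x $ i - t) has_real_derivative -1) (at t)" by (auto intro!: derivative_eq_intros)
    from DERIV_chain'[OF this mollifierD(2)[OF F, of i, unfolded deriv_seq_def, rule_format, of n]]
    have "((\<lambda>t. F i n (x $ i - t)) has_real_derivative F i (Suc n) (x $ i - t) * -1) (at t)" .
    from DERIV_cmult[OF this, of "(-1)^n"]
    show "(F' i n has_real_derivative F' i (Suc n) t) (at t)" by (simp add: F'_def[abs_def])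
  qed
  have \<phi>: "(\<lambda>z. tensor F (\<lambda>_. 0) (x - z)) = tensor F' (\<lambda>_. 0)"
    by (simp add: eq fun_eq_iff mi_order_def)
  show "partials is (\<lambda>z. tensor F (\<lambda>_. 0) (x - z)) = (\<lambda>z. (- 1) ^ length is * tensor F (count_list is) (x - z))"
    unfolding \<phi> partials_tensor[OF F'] by (simp add: eq fun_eq_iff mi_order_count_list)
  have "{z. tensor F (\<lambda>_. 0) (x - z) \<noteq> 0} \<subseteq> cball x e"
    using mollifierD(3)[OF F] by (force simp: dist_norm not_le)
  then have "closure {z. tensor F (\<lambda>_. 0) (x - z) \<noteq> 0} \<subseteq> cball x e" by (simp add: closure_minimal)
  then show "test_function T (\<lambda>z. tensor F (\<lambda>_. 0) (x - z))"
    unfolding test_function_def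
    using smooth_tensor[where F=F', OF F'] sub \<phi> bounded_subset[OF bounded_cball \<open>{z. tensor F (\<lambda>_. 0) (x - z) \<noteq> 0} \<subseteq> cball x e\<close>]
    by (simp add: subset_trans)
qed

text \<open>Mollifying commutes with weak differentiation wherever the kernel centred at
  \<open>x\<close> is an admissible test function. The sign in the definition of the weak derivative
  cancels against the sign from reflecting the kernel.\<close>

lemma conv_weak_deriv:
  assumes "open T" and wd: "has_weak_deriv T \<alpha> u g" and u: "borel_rep T u u0" and g: "borel_rep T g g0"
    and F: "mollifier e F" and sub: "cball x e \<subseteq> T"
  shows "conv u0 (tensor F \<alpha>) x = conv g0 (tensor F (\<lambda>_. 0)) x"
proof -
  obtain "is" where cl: "count_list is = \<alpha>" using ex_count_list by blast
  then have len: "mi_order \<alpha> = length is" using mi_order_count_list by blast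
  have [measurable]: "tensor F n \<in> borel_measurable borel" for n by (rule mollifierD(7)[OF F])
  have "(LINT z|lebesgue_on T. u z * ((- 1) ^ length is * tensor F \<alpha> (x - z)))
      = (- 1) ^ length is * (LINT z|lebesgue_on T. g z * tensor F (\<lambda>_. 0) (x - z))"
    using wd[unfolded has_weak_deriv_def, THEN conjunct2, THEN conjunct2, rule_format, OF conjI, OF mollifier_test_function(1)[OF F sub] cl]
    unfolding mollifier_test_function(2)[OF F sub] cl len .
  moreover have "(LINT z|lebesgue_on T. u z * ((- 1) ^ length is * tensor F \<alpha> (x - z)))
      = (LINT z|lborel. u0 z * ((- 1) ^ length is * tensor F \<alpha> (x - z)))"
    by (rule borel_rep_integral[OF assms(1) u]) simp
  moreover have "\<dots> = (LINT z|lborel. (- 1) ^ length is * (u0 z * tensor F \<alpha> (x - z)))"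
    by (simp add: mult_ac)
  moreover have "(LINT z|lebesgue_on T. g z * tensor F (\<lambda>_. 0) (x - z)) = (LINT z|lborel. g0 z * tensor F (\<lambda>_. 0) (x - z))"
    by (rule borel_rep_integral[OF assms(1) g]) simp
  ultimately show ?thesis unfolding conv_def by simp
qed

section \<open>Norm bounds for convolutions\<close>

text \<open>This holds for arbitrary functions, since the Bochner integral of a non-integrable
  product defaults to 0.\<close>

lemma conv_abs_le:
  "ennreal \<bar>conv f \<eta> x\<bar> \<le> (\<integral>\<^sup>+z. ennreal \<bar>f z\<bar> * ennreal \<bar>\<eta> (x - z)\<bar> \<partial>lborel)"
proof (cases "integrable lborel (\<lambda>z. f z * \<eta> (x - z))")
  case True
  then show ?thesis using integral_norm_bound_ennreal[OF True]
    by (simp add: conv_def abs_mult ennreal_mult)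
qed (simp add: conv_def not_integrable_integral_eq)

lemma nn_integral_conv_kernel:
  fixes h :: "real^'d::finite \<Rightarrow> ennreal"
  assumes F: "mollifier e F" and [measurable]: "h \<in> borel_measurable borel"
  shows "(\<integral>\<^sup>+x. (\<integral>\<^sup>+z. h z * ennreal \<bar>tensor F (\<lambda>_. 0) (x - z)\<bar> \<partial>lborel) \<partial>lborel) = (\<integral>\<^sup>+z. h z \<partial>lborel)"
    and "(\<integral>\<^sup>+z. ennreal \<bar>tensor F (\<lambda>_. 0) ((x::real^'d) - z)\<bar> \<partial>lborel) = 1"
proof -
  have [measurable]: "tensor F n \<in> borel_measurable borel" for n by (rule mollifierD(7)[OF F])
  have one: "(\<integral>\<^sup>+x. ennreal \<bar>tensor F (\<lambda>_. 0) (x::real^'d)\<bar> \<partial>lborel) = 1"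
    using mollifierD(5)[OF F] mollifierD(4)[OF F] by simp
  show "(\<integral>\<^sup>+z. ennreal \<bar>tensor F (\<lambda>_. 0) (x - z)\<bar> \<partial>lborel) = 1"
    using nn_integral_lborel_reflect[where f="\<lambda>z. ennreal \<bar>tensor F (\<lambda>_. 0) z\<bar>" and t=x] one by simp
  have "(\<integral>\<^sup>+x. (\<integral>\<^sup>+z. h z * ennreal \<bar>tensor F (\<lambda>_. 0) (x - z)\<bar> \<partial>lborel) \<partial>lborel)
      = (\<integral>\<^sup>+z. (\<integral>\<^sup>+x. h z * ennreal \<bar>tensor F (\<lambda>_. 0) (x - z)\<bar> \<partial>lborel) \<partial>lborel)"
    by (rule lborel_pair.Fubini') measurable
  also have "\<dots> = (\<integral>\<^sup>+z. h z \<partial>lborel)"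
    using nn_integral_lborel_translate[where f="\<lambda>z. ennreal \<bar>tensor F (\<lambda>_. 0) z\<bar>"] one
    by (intro nn_integral_cong) (simp add: nn_integral_cmult)
  finally show "(\<integral>\<^sup>+x. (\<integral>\<^sup>+z. h z * ennreal \<bar>tensor F (\<lambda>_. 0) (x - z)\<bar> \<partial>lborel) \<partial>lborel) = (\<integral>\<^sup>+z. h z \<partial>lborel)" .
qed

lemma conv_L1_bound:
  fixes f :: "real^'d::finite \<Rightarrow> real"
  assumes F: "mollifier e F" and "f \<in> borel_measurable borel"
  shows "(\<integral>\<^sup>+x. \<bar>conv f (tensor F (\<lambda>_. 0)) x\<bar> \<partial>lborel) \<le> (\<integral>\<^sup>+x. \<bar>f x\<bar> \<partial>lborel)"
proof -
  have "(\<integral>\<^sup>+x. \<bar>conv f (tensor F (\<lambda>_. 0)) x\<bar> \<partial>lborel)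
      \<le> (\<integral>\<^sup>+x. (\<integral>\<^sup>+z. ennreal \<bar>f z\<bar> * ennreal \<bar>tensor F (\<lambda>_. 0) (x - z)\<bar> \<partial>lborel) \<partial>lborel)"
    by (intro nn_integral_mono conv_abs_le)
  also have "\<dots> = (\<integral>\<^sup>+x. \<bar>f x\<bar> \<partial>lborel)" by (rule nn_integral_conv_kernel[OF F]) (use assms in simp)
  finally show ?thesis .
qed

text \<open>Split the kernel into two square roots and apply Cauchy-Schwarz; the factor without
  \<open>f\<close> integrates to 1 because the kernel has unit mass. Tonelli then integrates the
  other factor over \<open>x\<close>.\<close>

lemma conv_L2_bound:
  fixes f :: "real^'d::finite \<Rightarrow> real"
  assumes F: "mollifier e F" and [measurable]: "f \<in> borel_measurable borel"
  shows "(\<integral>\<^sup>+x. ennreal ((conv f (tensor F (\<lambda>_. 0)) x)\<^sup>2) \<partial>lborel) \<le> (\<integral>\<^sup>+x. ennreal ((f x)\<^sup>2) \<partial>lborel)"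
proof -
  let ?\<eta> = "tensor F (\<lambda>_. 0)"
  have [measurable]: "tensor F n \<in> borel_measurable borel" for n by (rule mollifierD(7)[OF F])
  have "ennreal ((conv f ?\<eta> x)\<^sup>2) \<le> (\<integral>\<^sup>+z. ennreal ((f z)\<^sup>2) * ennreal \<bar>?\<eta> (x - z)\<bar> \<partial>lborel)" for x
  proof -
    have "ennreal ((conv f ?\<eta> x)\<^sup>2) = (ennreal \<bar>conv f ?\<eta> x\<bar>)\<^sup>2" by (simp add: ennreal_power)
    also have "\<dots> \<le> (\<integral>\<^sup>+z. ennreal \<bar>f z\<bar> * ennreal \<bar>?\<eta> (x - z)\<bar> \<partial>lborel)\<^sup>2"
      by (intro power_mono conv_abs_le) auto
    also have "\<dots> = (\<integral>\<^sup>+z. ennreal (\<bar>f z\<bar> * sqrt \<bar>?\<eta> (x - z)\<bar>) * ennreal (sqrt \<bar>?\<eta> (x - z)\<bar>) \<partial>lborel)\<^sup>2"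
      by (simp add: ennreal_mult[symmetric] mult.assoc)
    also have "\<dots> \<le> (\<integral>\<^sup>+z. (ennreal (\<bar>f z\<bar> * sqrt \<bar>?\<eta> (x - z)\<bar>))\<^sup>2 \<partial>lborel) * (\<integral>\<^sup>+z. (ennreal (sqrt \<bar>?\<eta> (x - z)\<bar>))\<^sup>2 \<partial>lborel)"
      by (rule Cauchy_Schwarz_nn_integral) measurable
    also have "(\<integral>\<^sup>+z. (ennreal (sqrt \<bar>?\<eta> (x - z)\<bar>))\<^sup>2 \<partial>lborel) = 1"
      using nn_integral_conv_kernel(2)[OF F measurable_const[of 0], where x=x] by (simp add: ennreal_power)
    also have "(\<integral>\<^sup>+z. (ennreal (\<bar>f z\<bar> * sqrt \<bar>?\<eta> (x - z)\<bar>))\<^sup>2 \<partial>lborel)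
       = (\<integral>\<^sup>+z. ennreal ((f z)\<^sup>2) * ennreal \<bar>?\<eta> (x - z)\<bar> \<partial>lborel)"
      by (simp add: ennreal_power power_mult_distrib ennreal_mult[symmetric])
    finally show ?thesis by simp
  qed
  then have "(\<integral>\<^sup>+x. ennreal ((conv f ?\<eta> x)\<^sup>2) \<partial>lborel)
      \<le> (\<integral>\<^sup>+x. (\<integral>\<^sup>+z. ennreal ((f z)\<^sup>2) * ennreal \<bar>?\<eta> (x - z)\<bar> \<partial>lborel) \<partial>lborel)"
    by (rule nn_integral_mono)
  also have "\<dots> = (\<integral>\<^sup>+x. ennreal ((f x)\<^sup>2) \<partial>lborel)" by (rule nn_integral_conv_kernel[OF F]) simp
  finally show ?thesis .
qed

section \<open>Convergence of mollifications\<close>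

text \<open>A measurable function is an almost everywhere limit of continuous ones. Truncating in
  height and cutting off in space makes these limits dominated, so that they become limits in
  L^1.\<close>

lemma L1_approx_continuous:
  fixes f :: "real^'d::finite \<Rightarrow> real"
  assumes f: "integrable lborel f" "\<And>x. norm x \<ge> R \<Longrightarrow> f x = 0" and "\<epsilon> > 0"
  obtains g where "continuous_on UNIV g" "\<And>x. norm x \<ge> R + 1 \<Longrightarrow> g x = 0"
    "integrable lborel g" "(LINT x|lborel. \<bar>f x - g x\<bar>) < \<epsilon>"
proof -
  have fm[measurable]: "f \<in> borel_measurable borel" using f(1) by auto
  \<comment> \<open>Truncation at height \<open>k\<close> is continuous, hence it can be applied to
    \<open>f\<close> and to its continuous approximants alike.\<close>
  define c where "c k y = max (- real k) (min (real k) y)" for k y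
  have c_cont: "continuous_on S (c k)" for S k unfolding c_def by (intro continuous_intros)
  have [measurable]: "c k \<in> borel_measurable borel" for k by (intro borel_measurable_continuous_onI c_cont)
  have c_le: "\<bar>c k y\<bar> \<le> \<bar>y\<bar>" "\<bar>c k y\<bar> \<le> real k" for k y by (auto simp: c_def)
  have "(\<lambda>k. LINT x|lborel. \<bar>f x - c k (f x)\<bar>) \<longlonglongrightarrow> (LINT x::real^'d|lborel. (0::real))"
  proof (rule integral_dominated_convergence[where w="\<lambda>x. 2 * \<bar>f x\<bar>"])
    show "AE x in lborel. (\<lambda>k. \<bar>f x - c k (f x)\<bar>) \<longlonglongrightarrow> 0"
    proof (rule AE_I2, rule tendsto_eventually)
      fix x
      obtain N where "\<bar>f x\<bar> \<le> real N" using real_arch_simple by blast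
      then show "\<forall>\<^sub>F k in sequentially. \<bar>f x - c k (f x)\<bar> = 0"
        by (auto simp: eventually_sequentially c_def intro!: exI[of _ N])
    qed
    show "AE x in lborel. norm \<bar>f x - c k (f x)\<bar> \<le> 2 * \<bar>f x\<bar>" for k
    proof (rule AE_I2)
      fix x show "norm \<bar>f x - c k (f x)\<bar> \<le> 2 * \<bar>f x\<bar>" using c_le(1)[of k "f x"] by simp
    qed
  qed (use f(1) in auto)
  then have "(\<lambda>k. LINT x|lborel. \<bar>f x - c k (f x)\<bar>) \<longlonglongrightarrow> 0" by (simp only: Bochner_Integration.integral_zero)
  then have "\<forall>\<^sub>F k in sequentially. (LINT x|lborel. \<bar>f x - c k (f x)\<bar>) < \<epsilon> / 2"
    by (rule order_tendstoD(2)) (use assms(3) in simp)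
  from eventually_happens'[OF sequentially_bot this]
  obtain k where k: "(LINT x|lborel. \<bar>f x - c k (f x)\<bar>) < \<epsilon> / 2" by (elim exE)
  have "f measurable_on UNIV"
    by (rule lebesgue_measurable_imp_measurable_on) (auto intro: measurable_completion)
  then obtain N h where N: "negligible N" and h: "\<And>n. continuous_on UNIV (h n)"
    and lim: "\<And>x. x \<notin> N \<Longrightarrow> (\<lambda>n. h n x) \<longlonglongrightarrow> f x"
    unfolding measurable_on_def by auto
  define cut :: "real^'d \<Rightarrow> real" where "cut x = max 0 (min 1 (R + 1 - norm x))" for x
  have cut: "continuous_on UNIV cut" "0 \<le> cut x" "cut x \<le> 1" "norm x \<ge> R + 1 \<Longrightarrow> cut x = 0" "norm x \<le> R \<Longrightarrow> cut x = 1" for x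
    unfolding cut_def by (auto intro!: continuous_intros)
  define g where "g n x = cut x * c k (h n x)" for n x
  have g_cont: "continuous_on UNIV (g n)" for n
    unfolding g_def by (intro continuous_intros cut continuous_on_compose2[OF c_cont h]) auto
  have [measurable]: "g n \<in> borel_measurable borel" for n by (intro borel_measurable_continuous_onI g_cont)
  have bnd: "\<bar>g n x\<bar> \<le> real k * indicator (cball 0 (R+1)) x" for n x
  proof (cases "norm x \<le> R + 1")
    case True
    have "\<bar>cut x\<bar> * \<bar>c k (h n x)\<bar> \<le> 1 * real k" by (intro mult_mono) (use cut c_le in auto)
    then show ?thesis using True by (simp add: g_def abs_mult)
  qed (use cut(4) in \<open>auto simp: g_def\<close>)
  have bnd2: "\<bar>c k (f x)\<bar> \<le> real k * indicator (cball 0 (R+1)) x" for x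
  proof (cases "norm x \<le> R + 1")
    case False
    then have "f x = 0" using f(2)[of x] by auto
    then show ?thesis by (simp add: c_def)
  qed (use c_le in auto)
  have ind: "integrable lborel (\<lambda>x::real^'d. real k * indicator (cball 0 (R+1)) x)"
    using emeasure_bounded_finite[OF bounded_cball, of "0::real^'d" "R+1"]
    by (intro integrable_mult_right integrable_real_indicator) auto
  have gint: "integrable lborel (g n)" for n
    by (rule Bochner_Integration.integrable_bound[OF ind]) (use bnd[of n] in auto)
  have "(\<lambda>n. LINT x|lborel. \<bar>c k (f x) - g n x\<bar>) \<longlonglongrightarrow> (LINT x::real^'d|lborel. (0::real))"
  proof (rule integral_dominated_convergence[where w="\<lambda>x::real^'d. 2 * (real k * indicator (cball 0 (R+1)) x)"])
    have "AE x in lebesgue. x \<notin> N" using N by (simp add: negligible_iff_null_sets AE_not_in)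
    then have "AE x in lborel. x \<notin> N" by (simp add: AE_completion_iff)
    then show "AE x in lborel. (\<lambda>n. \<bar>c k (f x) - g n x\<bar>) \<longlonglongrightarrow> 0"
    proof eventually_elim
      case (elim x)
      have "isCont (c k) y" for y using c_cont[of UNIV k] by (simp add: continuous_on_eq_continuous_at)
      from isCont_tendsto_compose[OF this lim[OF elim]]
      have "(\<lambda>n. g n x) \<longlonglongrightarrow> cut x * c k (f x)" unfolding g_def by (rule tendsto_mult_left)
      moreover have "cut x * c k (f x) = c k (f x)"
        using cut(5)[of x] f(2)[of x] by (cases "norm x \<le> R") (auto simp: c_def)
      ultimately have "(\<lambda>n. c k (f x) - g n x) \<longlonglongrightarrow> c k (f x) - c k (f x)" by (intro tendsto_intros) simp
      then show ?case by (simp add: tendsto_rabs_zero)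
    qed
    show "AE x in lborel. norm \<bar>c k (f x) - g n x\<bar> \<le> 2 * (real k * indicator (cball 0 (R+1)) x)" for n
    proof (rule AE_I2)
      fix x show "norm \<bar>c k (f x) - g n x\<bar> \<le> 2 * (real k * indicator (cball 0 (R+1)) x)"
        using bnd[of n x] bnd2[of x] by simp
    qed
  qed (use ind in auto)
  then have "(\<lambda>n. LINT x|lborel. \<bar>c k (f x) - g n x\<bar>) \<longlonglongrightarrow> 0" by (simp only: Bochner_Integration.integral_zero)
  then have "\<forall>\<^sub>F n in sequentially. (LINT x|lborel. \<bar>c k (f x) - g n x\<bar>) < \<epsilon> / 2"
    by (rule order_tendstoD(2)) (use assms(3) in simp)
  from eventually_happens'[OF sequentially_bot this]
  obtain n where n: "(LINT x|lborel. \<bar>c k (f x) - g n x\<bar>) < \<epsilon> / 2" by (elim exE)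
  have cint: "integrable lborel (\<lambda>x. c k (f x))"
    by (rule Bochner_Integration.integrable_bound[OF ind]) (use bnd2 in auto)
  have "(LINT x|lborel. \<bar>f x - g n x\<bar>) \<le> (LINT x|lborel. \<bar>f x - c k (f x)\<bar> + \<bar>c k (f x) - g n x\<bar>)"
    by (intro integral_mono) (use f(1) cint gint in auto)
  also have "\<dots> = (LINT x|lborel. \<bar>f x - c k (f x)\<bar>) + (LINT x|lborel. \<bar>c k (f x) - g n x\<bar>)"
    by (intro Bochner_Integration.integral_add) (use f(1) cint gint in auto)
  also have "\<dots> < \<epsilon>" using k n by simp
  finally have "(LINT x|lborel. \<bar>f x - g n x\<bar>) < \<epsilon>" .
  then show ?thesis using that[of "g n"] g_cont gint cut(4) by (simp add: g_def)
qed

lemma nn_eq_lint: "integrable M f \<Longrightarrow> (\<integral>\<^sup>+x. ennreal \<bar>f x\<bar> \<partial>M) = ennreal (LINT x|M. \<bar>f x\<bar>)" for f :: "'a \<Rightarrow> real"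
  by (rule nn_integral_eq_integral) auto

lemma integrable_conv_mollifier:
  fixes f :: "real^'d::finite \<Rightarrow> real"
  assumes F: "mollifier e F" and f: "integrable lborel f"
  shows "integrable lborel (conv f (tensor F (\<lambda>_. 0)))"
proof (rule integrableI_bounded)
  show "conv f (tensor F (\<lambda>_. 0)) \<in> borel_measurable lborel"
    using continuous_conv[OF F f] by (auto intro: borel_measurable_continuous_onI)
  have "f \<in> borel_measurable borel" using f by auto
  from conv_L1_bound[OF F this] show "(\<integral>\<^sup>+x. ennreal (norm (conv f (tensor F (\<lambda>_. 0)) x)) \<partial>lborel) < \<infinity>"
    using f by (auto simp: integrable_iff_bounded intro: le_less_trans)
qed

text \<open>The kernel is a probability density supported in the ball of radius \<open>e\<close>, so
  the difference is an average of \<open>g z - g x\<close> over nearby \<open>z\<close>.\<close>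

lemma conv_close:
  fixes g :: "real^'d::finite \<Rightarrow> real"
  assumes F: "mollifier e F" and g: "integrable lborel g"
    and osc: "\<And>z. dist z x < e \<Longrightarrow> \<bar>g z - g x\<bar> \<le> \<omega>"
  shows "\<bar>conv g (tensor F (\<lambda>_. 0)) x - g x\<bar> \<le> \<omega>"
proof -
  let ?\<eta> = "tensor F (\<lambda>_. 0) :: real^'d \<Rightarrow> real"
  have [measurable]: "tensor F n \<in> borel_measurable borel" for n by (rule mollifierD(7)[OF F])
  obtain B where B: "\<And>x. \<bar>?\<eta> x\<bar> \<le> B" using mollifier_bounded[OF F] by metis
  have nn: "(\<integral>\<^sup>+z. ennreal (?\<eta> (x - z)) \<partial>lborel) = 1"
    using nn_integral_conv_kernel(2)[OF F measurable_const[of 0], where x=x] mollifierD(4)[OF F] by simp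
  have "integrable lborel (\<lambda>z. ?\<eta> (x - z))"
    by (rule integrableI_nonneg) (use mollifierD(4)[OF F] nn in auto)
  have I1: "integrable lborel (\<lambda>z. ?\<eta> (x - z))" by fact
  have I2: "integrable lborel (\<lambda>z. g z * ?\<eta> (x - z))" by (rule integrable_conv[OF g _ B]) simp
  have one: "(LINT z|lborel. ?\<eta> (x - z)) = 1"
    using nn_integral_eq_integral[OF I1] mollifierD(4)[OF F] nn by (simp add: integral_nonneg)
  have "conv g ?\<eta> x - g x = (LINT z|lborel. g z * ?\<eta> (x - z)) - (LINT z|lborel. g x * ?\<eta> (x - z))"
    using one by (simp add: conv_def)
  also have "\<dots> = (LINT z|lborel. (g z - g x) * ?\<eta> (x - z))"
    unfolding left_diff_distrib
    by (rule Bochner_Integration.integral_diff[symmetric]) (intro I2 integrable_mult_right I1)+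
  also have "\<bar>\<dots>\<bar> \<le> (LINT z|lborel. \<omega> * ?\<eta> (x - z))"
  proof (rule order.trans[OF integral_abs_bound integral_mono])
    show "integrable lborel (\<lambda>z. \<bar>(g z - g x) * ?\<eta> (x - z)\<bar>)"
      unfolding left_diff_distrib
      by (intro integrable_abs Bochner_Integration.integrable_diff I2 integrable_mult_right I1)
    show "\<bar>(g z - g x) * ?\<eta> (x - z)\<bar> \<le> \<omega> * ?\<eta> (x - z)" for z
    proof (cases "dist z x < e")
      case True
      then show ?thesis using osc[OF True] mollifierD(4)[OF F, of "x - z"] by (auto simp: abs_mult intro!: mult_right_mono)
    next
      case False
      then have "?\<eta> (x - z) = 0" by (intro mollifierD(3)[OF F]) (simp add: dist_norm norm_minus_commute)
      then show ?thesis by simp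
    qed
  qed (use I1 in auto)
  also have "\<dots> = \<omega>" using one by simp
  finally show ?thesis .
qed

text \<open>An \<epsilon>/3 argument with a continuous \<open>g\<close>: convolution does not
  increase the L^1 norm of \<open>f - g\<close>, and mollifying \<open>g\<close> converges uniformly
  on a bounded set.\<close>

lemma conv_L1_tendsto:
  fixes f :: "real^'d::finite \<Rightarrow> real"
  assumes f: "integrable lborel f" "\<And>x. norm x \<ge> R \<Longrightarrow> f x = 0"
    and F: "\<And>n. mollifier (e n) (F n)" and e: "e \<longlonglongrightarrow> 0"
  shows "(\<lambda>n. LINT x|lborel. \<bar>conv f (tensor (F n) (\<lambda>_. 0)) x - f x\<bar>) \<longlonglongrightarrow> 0"
proof (rule LIMSEQ_I)
  fix \<epsilon> :: real assume \<epsilon>: "\<epsilon> > 0"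
  let ?c = "\<lambda>g n. conv g (tensor (F n) (\<lambda>_. 0)) :: real^'d \<Rightarrow> real"
  obtain g where g: "continuous_on UNIV g" "\<And>x. norm x \<ge> R + 1 \<Longrightarrow> g x = 0"
    "integrable lborel g" "(LINT x|lborel. \<bar>f x - g x\<bar>) < \<epsilon> / 3"
    using L1_approx_continuous[OF f, where \<epsilon>="\<epsilon>/3"] \<epsilon> by auto
  define V where "V = measure lborel (cball 0 (R + 2) :: (real^'d) set)"
  \<comment> \<open>An error \<open>\<omega>\<close> on a ball of volume \<open>V\<close> must
    integrate to less than \<epsilon>/3; the summand 1 keeps the quotient meaningful for
    \<open>V = 0\<close>.\<close>
  define \<omega> where "\<omega> = \<epsilon> / (3 * (V + 1))"
  have V: "V \<ge> 0" by (simp add: V_def)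
  then have \<omega>: "\<omega> > 0" "\<omega> * V < \<epsilon> / 3" using \<epsilon> by (auto simp: \<omega>_def field_simps)
  have "uniformly_continuous_on (cball 0 (R + 3)) g"
    by (intro compact_uniformly_continuous) (use g(1) continuous_on_subset in auto)
  then obtain d where d: "d > 0" "\<And>x y. x \<in> cball 0 (R+3) \<Longrightarrow> y \<in> cball 0 (R+3) \<Longrightarrow> dist y x < d \<Longrightarrow> dist (g y) (g x) < \<omega>"
    unfolding uniformly_continuous_on_def using \<omega>(1) by metis
  obtain N where N: "\<And>n. n \<ge> N \<Longrightarrow> e n < min d 1"
    using order_tendstoD(2)[OF e, of "min d 1"] d(1) eventually_sequentially by auto
  have "norm ((LINT x|lborel. \<bar>?c f n x - f x\<bar>) - 0) < \<epsilon>" if "n \<ge> N" for n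
  proof -
    have en: "e n < d" "e n < 1" using N[OF that] by auto
    have pt: "\<bar>?c g n x - g x\<bar> \<le> \<omega> * indicator (cball 0 (R+2)) x" for x
    proof (cases "norm x \<le> R + 2")
      case True
      have "\<bar>?c g n x - g x\<bar> \<le> \<omega>"
      proof (rule conv_close[OF F g(3)])
        fix z assume z: "dist z x < e n"
        have "norm z \<le> norm x + dist z x" by (metis dist_norm norm_triangle_sub add.commute)
        with z en True have "z \<in> cball 0 (R+3)" by simp
        then have "dist (g z) (g x) < \<omega>" using True z en by (intro d(2)) auto
        then show "\<bar>g z - g x\<bar> \<le> \<omega>" by (simp add: dist_real_def)
      qed
      then show ?thesis using True by simp
    next
      case False
      \<comment> \<open>Since \<open>e n < 1\<close>, every point seen by the kernel has norm at
        least R + 1, where \<open>g\<close> vanishes.\<close>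
      have "\<bar>?c g n x - g x\<bar> \<le> 0"
      proof (rule conv_close[OF F g(3)])
        fix z assume z: "dist z x < e n"
        have "norm x \<le> norm z + dist z x" by (metis dist_norm norm_triangle_sub norm_minus_commute add.commute)
        with z en False have "norm z \<ge> R + 1" by simp
        then show "\<bar>g z - g x\<bar> \<le> 0" using g(2)[of z] g(2)[of x] False by simp
      qed
      then show ?thesis using False by simp
    qed
    have ind: "integrable lborel (\<lambda>x::real^'d. \<omega> * indicator (cball 0 (R+2)) x)"
      using emeasure_bounded_finite[OF bounded_cball, of "0::real^'d" "R+2"]
      by (intro integrable_mult_right integrable_real_indicator) auto
    have ci: "integrable lborel (?c h n)" if "integrable lborel h" for h
      by (rule integrable_conv_mollifier[OF F that])
    have "(LINT x|lborel. \<bar>?c g n x - g x\<bar>) \<le> (LINT x|lborel. \<omega> * indicator (cball 0 (R+2)) (x::real^'d))"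
      by (intro integral_mono ind pt) (use ci[OF g(3)] g(3) in auto)
    also have "\<dots> = \<omega> * V" by (simp add: V_def)
    also have "\<dots> < \<epsilon> / 3" by (rule \<omega>(2))
    finally have 1: "(LINT x|lborel. \<bar>?c g n x - g x\<bar>) < \<epsilon> / 3" .
    define h where "h x = f x - g x" for x
    have h: "integrable lborel h" using f(1) g(3) by (simp add: h_def[abs_def])
    then have "h \<in> borel_measurable borel" by auto
    from conv_L1_bound[OF F this, of n]
    have "ennreal (LINT x|lborel. \<bar>?c h n x\<bar>) \<le> ennreal (LINT x|lborel. \<bar>h x\<bar>)"
      by (simp add: nn_eq_lint[OF ci[OF h]] nn_eq_lint[OF h])
    then have 2: "(LINT x|lborel. \<bar>?c h n x\<bar>) < \<epsilon> / 3"
      using g(4) by (simp add: h_def ennreal_le_iff integral_nonneg_AE)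
    have hc: "?c h n x = ?c f n x - ?c g n x" for x
    proof -
      obtain B where B: "\<And>x. \<bar>tensor (F n) (\<lambda>_. 0) (x::real^'d)\<bar> \<le> B" using mollifier_bounded[OF F] by metis
      have "tensor (F n) (\<lambda>_. 0) \<in> borel_measurable borel" by (rule mollifierD(7)[OF F])
      from integrable_conv[OF f(1) this B] integrable_conv[OF g(3) this B]
      show ?thesis unfolding conv_def h_def left_diff_distrib by (rule Bochner_Integration.integral_diff)
    qed
    have "(LINT x|lborel. \<bar>?c f n x - f x\<bar>) \<le> (LINT x|lborel. \<bar>?c h n x\<bar> + \<bar>?c g n x - g x\<bar> + \<bar>h x\<bar>)"
    proof (rule integral_mono)
      show "\<bar>?c f n x - f x\<bar> \<le> \<bar>?c h n x\<bar> + \<bar>?c g n x - g x\<bar> + \<bar>h x\<bar>" for x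
        unfolding hc by (simp add: h_def)
    qed (use ci[OF h] ci[OF g(3)] ci[OF f(1)] f(1) g(3) h in auto)
    also have "\<dots> = (LINT x|lborel. \<bar>?c h n x\<bar>) + (LINT x|lborel. \<bar>?c g n x - g x\<bar>) + (LINT x|lborel. \<bar>h x\<bar>)"
    proof -
      have i: "integrable lborel (\<lambda>x. \<bar>?c h n x\<bar>)" "integrable lborel (\<lambda>x. \<bar>?c g n x - g x\<bar>)" "integrable lborel (\<lambda>x. \<bar>h x\<bar>)"
        using ci[OF h] ci[OF g(3)] g(3) h by auto
      show ?thesis by (simp only: Bochner_Integration.integral_add[OF Bochner_Integration.integrable_add[OF i(1,2)] i(3)]
          Bochner_Integration.integral_add[OF i(1,2)])
    qed
    also have "\<dots> < \<epsilon>" using 1 2 g(4) by (simp add: h_def)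
    finally show ?thesis by (simp add: integral_nonneg_AE)
  qed
  then show "\<exists>no. \<forall>n\<ge>no. norm ((LINT x|lborel. \<bar>?c f n x - f x\<bar>) - 0) < \<epsilon>" by blast
qed

text \<open>Convergence in L^1 gives almost everywhere convergence only along a subsequence. The
  scales \<open>e\<close> and kernels \<open>F\<close> are therefore supplied by the lemma and
  depend on \<open>f\<close>.\<close>

lemma mollify_AE:
  fixes f :: "real^'d::finite \<Rightarrow> real"
  assumes f: "integrable lborel f" "\<And>x. norm x \<ge> R \<Longrightarrow> f x = 0"
  obtains e F where "\<And>n. mollifier (e n) (F n)" "e \<longlonglongrightarrow> 0"
    "AE x in lborel. (\<lambda>n. conv f (tensor (F n) (\<lambda>_. 0)) x) \<longlonglongrightarrow> f x"
proof -
  define e where "e n = inverse (real (Suc n))" for n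
  have e: "e n > 0" "e \<longlonglongrightarrow> 0" for n using LIMSEQ_inverse_real_of_nat by (auto simp: e_def[abs_def])
  have "\<exists>F::'d \<Rightarrow> nat \<Rightarrow> real \<Rightarrow> real. mollifier (e n) F" for n using mollifier_exists[OF e(1)] by metis
  then obtain F :: "nat \<Rightarrow> 'd \<Rightarrow> nat \<Rightarrow> real \<Rightarrow> real" where F: "\<And>n. mollifier (e n) (F n)" by metis
  let ?g = "\<lambda>n x. conv f (tensor (F n) (\<lambda>_. 0)) x - f x"
  have "\<exists>r::nat\<Rightarrow>nat. strict_mono r \<and> (AE x in lborel. (\<lambda>n. ?g (r n) x) \<longlonglongrightarrow> 0)"
  proof (rule tendsto_L1_AE_subseq)
    show "integrable lborel (?g n)" for n using integrable_conv_mollifier[OF F f(1)] f(1) by auto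
    show "(\<lambda>n. LINT x|lborel. norm (?g n x)) \<longlonglongrightarrow> 0" using conv_L1_tendsto[OF f F e(2)] by simp
  qed
  then obtain r where r: "strict_mono r" "AE x in lborel. (\<lambda>n. ?g (r n) x) \<longlonglongrightarrow> 0" by blast
  show ?thesis
  proof (rule that[of "e \<circ> r" "F \<circ> r"])
    show "(e \<circ> r) \<longlonglongrightarrow> 0" by (rule LIMSEQ_subseq_LIMSEQ[OF e(2) r(1)])
    show "AE x in lborel. (\<lambda>n. conv f (tensor ((F \<circ> r) n) (\<lambda>_. 0)) x) \<longlonglongrightarrow> f x"
      using r(2) by eventually_elim (simp add: LIM_zero_iff)
  qed (use F in simp)
qed

section \<open>Calculus of weak derivatives\<close>

lemma integral_lebesgue_on_subset:
  fixes f :: "real^'d::finite \<Rightarrow> real"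
  assumes "U \<in> sets lebesgue" "V \<in> sets lebesgue" "V \<subseteq> U" "\<And>x. x \<in> U - V \<Longrightarrow> f x = 0"
  shows "(LINT x|lebesgue_on U. f x) = (LINT x|lebesgue_on V. f x)"
    and "integrable (lebesgue_on U) f \<longleftrightarrow> integrable (lebesgue_on V) f"
proof -
  have "(\<lambda>x. indicator U x *\<^sub>R f x) = (\<lambda>x. indicator V x *\<^sub>R f x)"
    using assms(3,4) by (auto simp: indicator_def fun_eq_iff)
  then show "(LINT x|lebesgue_on U. f x) = (LINT x|lebesgue_on V. f x)"
    "integrable (lebesgue_on U) f \<longleftrightarrow> integrable (lebesgue_on V) f"
    using assms(1,2) by (simp_all add: integral_restrict_space integrable_restrict_space)
qed

lemma borel_measurable_lebesgue_onI: "f \<in> borel_measurable borel \<Longrightarrow> f \<in> borel_measurable (lebesgue_on U)"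
  by (intro measurable_restrict_space1 measurable_completion) simp

lemma integrable_times_test:
  fixes u \<psi> :: "real^'d::finite \<Rightarrow> real"
  assumes "open U" "locally_integrable U u" "continuous_on UNIV \<psi>" "compact C" "C \<subseteq> U" "\<And>x. x \<notin> C \<Longrightarrow> \<psi> x = 0"
  shows "integrable (lebesgue_on U) (\<lambda>x. u x * \<psi> x)"
proof -
  have "compact (\<psi> ` C)" using assms(3,4) by (meson compact_continuous_image continuous_on_subset subset_UNIV)
  then obtain b where b: "\<And>y. y \<in> \<psi> ` C \<Longrightarrow> norm y \<le> b" using compact_imp_bounded bounded_iff by metis
  have B: "\<bar>\<psi> x\<bar> \<le> \<bar>b\<bar>" for x using b[of "\<psi> x"] assms(6)[of x] by (cases "x \<in> C") force+
  have "integrable (lebesgue_on C) u" using assms by (auto simp: locally_integrable_def)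
  then have "integrable (lebesgue_on C) (\<lambda>x. u x * \<psi> x)"
    by (rule integrable_mult_bounded) (use assms(3) B in \<open>auto intro: borel_measurable_lebesgue_onI borel_measurable_continuous_onI\<close>)
  moreover have "U \<in> sets lebesgue" "C \<in> sets lebesgue"
    using assms(1,4) by (auto intro: borel_open fmeasurableD lmeasurable_compact)
  ultimately show ?thesis
    by (subst integral_lebesgue_on_subset(2)[where V=C]) (use assms in auto)
qed

lemma integrable_times_partials:
  fixes u :: "real^'d::finite \<Rightarrow> real"
  assumes "open U" "locally_integrable U u" "test_function U \<phi>"
  shows "integrable (lebesgue_on U) (\<lambda>x. u x * partials is \<phi> x)"
  by (rule integrable_times_test[OF assms(1,2) continuous_partials test_functionD(2,3)])
    (use assms(3) partials_outside_support in \<open>auto dest: test_functionD\<close>)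

lemma has_weak_derivD:
  assumes "has_weak_deriv U \<alpha> v g"
  shows "locally_integrable U v" "locally_integrable U g"
    "\<And>\<phi> is. test_function U \<phi> \<Longrightarrow> count_list is = \<alpha> \<Longrightarrow>
       (LINT x|lebesgue_on U. v x * partials is \<phi> x) = (- 1) ^ mi_order \<alpha> * (LINT x|lebesgue_on U. g x * \<phi> x)"
  using assms unfolding has_weak_deriv_def by blast+

lemma has_weak_deriv_diff:
  assumes "open U" and a: "has_weak_deriv U \<alpha> v g" and b: "has_weak_deriv U \<alpha> v' g'"
  shows "has_weak_deriv U \<alpha> (\<lambda>x. v x - v' x) (\<lambda>x. g x - g' x)"
  unfolding has_weak_deriv_def
proof (intro conjI allI impI)
  show "locally_integrable U (\<lambda>x. v x - v' x)" "locally_integrable U (\<lambda>x. g x - g' x)"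
    using has_weak_derivD(1,2)[OF a] has_weak_derivD(1,2)[OF b] by (auto simp: locally_integrable_def)
  fix \<phi> "is" assume \<phi>: "test_function U \<phi> \<and> count_list is = \<alpha>"
  have i: "integrable (lebesgue_on U) (\<lambda>x. w x * partials js \<phi> x)" if "locally_integrable U w" for w js
    using integrable_times_partials[OF assms(1) that] \<phi> by blast
  have "(LINT x|lebesgue_on U. (v x - v' x) * partials is \<phi> x)
      = (LINT x|lebesgue_on U. v x * partials is \<phi> x) - (LINT x|lebesgue_on U. v' x * partials is \<phi> x)"
    unfolding left_diff_distrib by (intro Bochner_Integration.integral_diff i has_weak_derivD(1)[OF a] has_weak_derivD(1)[OF b])
  also have "\<dots> = (- 1) ^ mi_order \<alpha> * ((LINT x|lebesgue_on U. g x * \<phi> x) - (LINT x|lebesgue_on U. g' x * \<phi> x))"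
    using has_weak_derivD(3)[OF a] has_weak_derivD(3)[OF b] \<phi> by (simp add: right_diff_distrib)
  also have "(LINT x|lebesgue_on U. g x * \<phi> x) - (LINT x|lebesgue_on U. g' x * \<phi> x) = (LINT x|lebesgue_on U. (g x - g' x) * \<phi> x)"
    unfolding left_diff_distrib
    by (intro Bochner_Integration.integral_diff[symmetric] i[where js="[]", simplified] has_weak_derivD(2)[OF a] has_weak_derivD(2)[OF b])
  finally show "(LINT x|lebesgue_on U. (v x - v' x) * partials is \<phi> x) = (- 1) ^ mi_order \<alpha> * (LINT x|lebesgue_on U. (g x - g' x) * \<phi> x)" .
qed

lemma has_weak_deriv_subset:
  assumes "open U" "open V" "V \<subseteq> U" and a: "has_weak_deriv U \<alpha> v g"
  shows "has_weak_deriv V \<alpha> v g"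
  unfolding has_weak_deriv_def
proof (intro conjI allI impI)
  show "locally_integrable V v" "locally_integrable V g"
    using has_weak_derivD(1,2)[OF a] assms(3) by (auto simp: locally_integrable_def)
  fix \<phi> "is" assume \<phi>: "test_function V \<phi> \<and> count_list is = \<alpha>"
  then have \<phi>': "test_function U \<phi>" using assms(3) by (auto simp: test_function_def)
  have l: "U \<in> sets lebesgue" "V \<in> sets lebesgue" using assms by (auto intro: borel_open)
  have z: "partials js \<phi> x = 0" if "x \<in> U - V" for js x
    using \<phi> that test_functionD(3)[of V \<phi>] by (intro partials_outside_support) auto
  have "(LINT x|lebesgue_on V. w x * partials js \<phi> x) = (LINT x|lebesgue_on U. w x * partials js \<phi> x)" for w js
    using z[of _ js] by (intro integral_lebesgue_on_subset(1)[symmetric] l assms) auto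
  from this[of v "is"] this[of g "[]"]
  show "(LINT x|lebesgue_on V. v x * partials is \<phi> x) = (- 1) ^ mi_order \<alpha> * (LINT x|lebesgue_on V. g x * \<phi> x)"
    using has_weak_derivD(3)[OF a \<phi>'] \<phi> by simp
qed

lemma partials_append: "partials (is @ js) \<phi> = partials is (partials js \<phi>)"
  by (induction "is") auto

lemma test_function_partials:
  assumes "test_function U \<phi>"
  shows "test_function U (partials js \<phi>)"
proof -
  have "{x. partials js \<phi> x \<noteq> 0} \<subseteq> closure {x. \<phi> x \<noteq> 0}" using partials_outside_support by blast
  then have sub: "closure {x. partials js \<phi> x \<noteq> 0} \<subseteq> closure {x. \<phi> x \<noteq> 0}" by (simp add: closure_minimal)
  have "smooth (partials js \<phi>)"
    using test_functionD(1)[OF assms] unfolding smooth_def by (simp flip: partials_append)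
  moreover have "compact (closure {x. partials js \<phi> x \<noteq> 0})"
    using compact_Int_closed[OF test_functionD(2)[OF assms] closed_closure[of "{x. partials js \<phi> x \<noteq> 0}"]] sub
    by (simp add: Int_absorb1)
  ultimately show ?thesis using sub test_functionD(3)[OF assms] by (auto simp: test_function_def)
qed

text \<open>Weak derivatives of higher order are defined by duality in one go. Testing order
  \<alpha> with the partial derivative of a test function recovers the first-order relation between
  consecutive orders, which lets the Poincare inequality act on each derivative in turn.\<close>

lemma has_weak_deriv_step:
  assumes a: "has_weak_deriv U \<alpha> v g" and b: "has_weak_deriv U (\<alpha>(i := Suc (\<alpha> i))) v g'"
  shows "has_weak_deriv U ((\<lambda>_. 0)(i := Suc 0)) g g'"
  unfolding has_weak_deriv_def
proof (intro conjI allI impI)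
  show "locally_integrable U g" "locally_integrable U g'"
    using has_weak_derivD(2)[OF a] has_weak_derivD(2)[OF b] by auto
  fix \<phi> "is" assume \<phi>: "test_function U \<phi> \<and> count_list is = (\<lambda>_. 0)(i := Suc 0)"
  have one: "mi_order ((\<lambda>_. 0)(i := Suc 0)) = 1" using mi_order_upd[of "\<lambda>_. 0" i] by (simp add: mi_order_def)
  then have "length is = 1" using \<phi> mi_order_count_list[of "is"] by simp
  then obtain j where j: "is = [j]" by (cases "is") auto
  with \<phi> have "count_list [j] i = Suc 0" by simp
  then have ji: "is = [i]" using j by (auto split: if_splits)
  obtain js where js: "count_list js = \<alpha>" using ex_count_list by blast
  have js': "count_list (js @ [i]) = \<alpha>(i := Suc (\<alpha> i))" using js by (auto simp: fun_eq_iff)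
  have "(LINT x|lebesgue_on U. v x * partials (js @ [i]) \<phi> x) = (- 1) ^ mi_order \<alpha> * (LINT x|lebesgue_on U. g x * partials [i] \<phi> x)"
    unfolding partials_append by (rule has_weak_derivD(3)[OF a test_function_partials js]) (use \<phi> in blast)
  moreover have "(LINT x|lebesgue_on U. v x * partials (js @ [i]) \<phi> x) = (- 1) ^ mi_order (\<alpha>(i := Suc (\<alpha> i))) * (LINT x|lebesgue_on U. g' x * \<phi> x)"
    by (rule has_weak_derivD(3)[OF b _ js']) (use \<phi> in blast)
  ultimately have "(- 1) ^ mi_order \<alpha> * (LINT x|lebesgue_on U. g x * partials [i] \<phi> x)
      = (- 1) ^ mi_order \<alpha> * (- (LINT x|lebesgue_on U. g' x * \<phi> x))"
    by (simp add: mi_order_upd)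
  then have "(LINT x|lebesgue_on U. g x * partials [i] \<phi> x) = - (LINT x|lebesgue_on U. g' x * \<phi> x)"
    by (subst (asm) mult_cancel_left) simp
  then show "(LINT x|lebesgue_on U. g x * partials is \<phi> x) = (- 1) ^ mi_order ((\<lambda>_. 0)(i := Suc 0)) * (LINT x|lebesgue_on U. g' x * \<phi> x)"
    unfolding one ji by simp
qed

section \<open>Uniqueness of weak derivatives\<close>

text \<open>For scales below \<open>r\<close>, a kernel centred in the smaller ball is a test
  function on the larger one, so the mollified difference of two weak derivatives is exactly 0
  there. Its almost everywhere limit is the difference itself.\<close>

lemma weak_deriv_unique_ball:
  fixes g g' :: "real^'d::finite \<Rightarrow> real"
  assumes U: "open U" and a: "has_weak_deriv U \<alpha> v g" and b: "has_weak_deriv U \<alpha> v g'"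
    and r: "r > 0" "cball x (2 * r) \<subseteq> U"
  shows "AE y in lborel. y \<in> ball x r \<longrightarrow> g y = g' y"
proof -
  define w where "w y = g y - g' y" for y
  define V where "V = ball x (2 * r)"
  have V: "open V" "V \<subseteq> U" "V \<subseteq> cball x (2 * r)" using r(2) by (auto simp: V_def)
  have l: "U \<in> sets lebesgue" "V \<in> sets lebesgue" "cball x (2 * r) \<in> sets lebesgue" using U V(1) by (auto intro: borel_open)
  have "locally_integrable U w"
    using has_weak_derivD(2)[OF a] has_weak_derivD(2)[OF b] unfolding w_def by (auto simp: locally_integrable_def)
  then have "integrable (lebesgue_on (cball x (2 * r))) w" using r(2) by (auto simp: locally_integrable_def)
  then have "set_integrable lebesgue (cball x (2 * r)) w"
    using l by (simp add: set_integrable_def integrable_restrict_space)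
  then have "set_integrable lebesgue V w" by (rule set_integrable_subset) (use l V in auto)
  then have wV: "integrable (lebesgue_on V) w" using l by (simp add: set_integrable_def integrable_restrict_space)
  then obtain w0 where w0: "borel_rep V w w0" using borel_rep_exists[OF V(1)] by blast
  have w0i: "integrable lborel w0"
  proof (rule integrableI_bounded)
    show "(\<integral>\<^sup>+x. ennreal (norm (w0 x)) \<partial>lborel) < \<infinity>"
      using wV borel_rep_nn_integral[OF V(1) w0, of "\<lambda>t. ennreal (norm t)"] by (simp add: integrable_iff_bounded)
  qed (use w0 in \<open>simp add: borel_rep_def\<close>)
  have w0z: "w0 y = 0" if "norm y \<ge> norm x + 2 * r" for y
  proof -
    have "norm y \<le> norm x + dist x y"
      using dist_triangle[of 0 y x] by simp
    then have "y \<notin> V" using that by (auto simp: V_def)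
    then show ?thesis using w0 by (simp add: borel_rep_def)
  qed
  obtain e F where F: "\<And>n. mollifier (e n) (F n)" and e: "e \<longlonglongrightarrow> 0"
    and lim: "AE y in lborel. (\<lambda>n. conv w0 (tensor (F n) (\<lambda>_. 0)) y) \<longlonglongrightarrow> w0 y"
    by (rule mollify_AE[OF w0i w0z]) blast+
  have zero: "conv w0 (tensor (F n) (\<lambda>_. 0)) y = 0" if y: "y \<in> ball x r" and n: "e n < r" for y n
  proof -
    have "cball y (e n) \<subseteq> V"
    proof
      fix z assume "z \<in> cball y (e n)"
      then show "z \<in> V" using y n dist_triangle[of x z y] by (simp add: V_def)
    qed
    note \<phi>V = mollifier_test_function(1)[OF F this]
    let ?\<phi> = "\<lambda>z. tensor (F n) (\<lambda>_. 0) (y - z)"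
    have \<phi>U: "test_function U ?\<phi>" using \<phi>V V(2) by (auto simp: test_function_def)
    obtain "is" where cl: "count_list is = \<alpha>" using ex_count_list by blast
    have "(LINT z|lebesgue_on U. g z * ?\<phi> z) = (LINT z|lebesgue_on U. g' z * ?\<phi> z)"
      using has_weak_derivD(3)[OF a \<phi>U cl] has_weak_derivD(3)[OF b \<phi>U cl] by simp
    moreover have "(LINT z|lebesgue_on U. w z * ?\<phi> z) = (LINT z|lebesgue_on U. g z * ?\<phi> z) - (LINT z|lebesgue_on U. g' z * ?\<phi> z)"
      unfolding w_def left_diff_distrib
      by (intro Bochner_Integration.integral_diff integrable_times_partials[OF U _ \<phi>U, of _ "[]", simplified]
          has_weak_derivD(2)[OF a] has_weak_derivD(2)[OF b])
    moreover have "(LINT z|lebesgue_on U. w z * ?\<phi> z) = (LINT z|lebesgue_on V. w z * ?\<phi> z)"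
    proof (rule integral_lebesgue_on_subset(1)[OF l(1,2) V(2)])
      fix z assume "z \<in> U - V"
      then have "?\<phi> z = 0" using test_functionD(3)[OF \<phi>V] closure_subset[of "{z. ?\<phi> z \<noteq> 0}"] by blast
      then show "w z * ?\<phi> z = 0" by simp
    qed
    moreover have "(LINT z|lebesgue_on V. w z * ?\<phi> z) = (LINT z|lborel. w0 z * ?\<phi> z)"
      by (rule borel_rep_integral[OF V(1) w0]) (use mollifierD(7)[OF F] in measurable)
    ultimately show ?thesis by (simp add: conv_def)
  qed
  have ev: "\<forall>\<^sub>F n in sequentially. e n < r" using order_tendstoD(2)[OF e r(1)] .
  have "AE y in lborel. y \<in> V \<longrightarrow> w y = w0 y" using w0 by (simp add: borel_rep_def)
  with lim show ?thesis
  proof eventually_elim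
    case (elim y)
    show ?case
    proof
      assume y: "y \<in> ball x r"
      have "(\<lambda>n. conv w0 (tensor (F n) (\<lambda>_. 0)) y) \<longlonglongrightarrow> 0"
        using ev by (intro tendsto_eventually) (auto elim!: eventually_mono simp: zero[OF y])
      then have "w0 y = 0" using elim(1) LIMSEQ_unique by blast
      moreover have "y \<in> V" using y r(1) by (simp add: V_def)
      ultimately show "g y = g' y" using elim(2) by (simp add: w_def)
    qed
  qed
qed

text \<open>A set that is negligible near each of its points is negligible, so uniqueness on small
  balls suffices. It makes seminorms computable from any known representative.\<close>

lemma weak_deriv_unique:
  fixes g g' :: "real^'d::finite \<Rightarrow> real"
  assumes U: "open U" and a: "has_weak_deriv U \<alpha> v g" and b: "has_weak_deriv U \<alpha> v g'"
  shows "AE x in lebesgue_on U. g x = g' x"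
proof -
  have "negligible {y \<in> U. g y \<noteq> g' y}" (is "negligible ?S")
    unfolding locally_negligible_alt[of ?S]
  proof
    fix x assume "x \<in> ?S"
    then obtain s where s: "s > 0" "cball x s \<subseteq> U" using U open_contains_cball by blast
    have "AE y in lborel. y \<in> ball x (s/2) \<longrightarrow> g y = g' y"
      by (rule weak_deriv_unique_ball[OF U a b]) (use s in auto)
    then have "AE y in lebesgue. y \<notin> ?S \<inter> ball x (s/2)"
      by (intro AE_completion) (auto elim!: eventually_mono)
    then have "?S \<inter> ball x (s/2) \<in> null_sets lebesgue"
      by (simp add: completion.null_sets_iff_AE)
    then have "negligible (?S \<inter> ball x (s/2))" by (simp add: negligible_iff_null_sets)
    then show "\<exists>U. openin (top_of_set ?S) U \<and> x \<in> U \<and> negligible U"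
      using \<open>x \<in> ?S\<close> s(1) by (intro exI[of _ "?S \<inter> ball x (s/2)"]) (auto simp: openin_open)
  qed
  then have "AE x in lebesgue. x \<notin> ?S" by (intro AE_not_in) (simp add: negligible_iff_null_sets)
  then have "AE x in lebesgue. x \<in> U \<longrightarrow> g x = g' x" by (rule eventually_mono) blast
  moreover have "U \<inter> space lebesgue \<in> sets lebesgue" using U by (auto intro: borel_open)
  ultimately show ?thesis by (simp add: AE_restrict_space_iff)
qed

section \<open>Poincare and Sobolev inequalities on convex sets\<close>

text \<open>Fundamental theorem of calculus, then Cauchy-Schwarz against the indicator of the unit
  interval.\<close>

lemma square_diff_le_nn_integral:
  fixes f f' :: "real \<Rightarrow> real"
  assumes f: "\<And>t. (f has_real_derivative f' t) (at t)" and c: "continuous_on UNIV f'"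
  shows "ennreal ((f 1 - f 0)\<^sup>2) \<le> (\<integral>\<^sup>+t\<in>{0..1}. ennreal ((f' t)\<^sup>2) \<partial>lborel)"
proof -
  have [measurable]: "f' \<in> borel_measurable borel" by (intro borel_measurable_continuous_onI c)
  have eq: "(LBINT t. f' t * indicator {0..1} t) = f 1 - f 0"
    by (rule integral_FTC_Icc_real) (use f c in \<open>auto simp: continuous_on_eq_continuous_at\<close>)
  have "integrable lborel (\<lambda>t. f' t * indicator {0..1} t)"
    using borel_integrable_atLeastAtMost[of 0 1 f'] c
    by (simp add: continuous_on_eq_continuous_at mult.commute cong: if_cong)
  from integral_norm_bound_ennreal[OF this] eq
  have "ennreal \<bar>f 1 - f 0\<bar> \<le> (\<integral>\<^sup>+t. ennreal \<bar>f' t * indicator {0..1} t\<bar> \<partial>lborel)" by simp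
  then have "(ennreal \<bar>f 1 - f 0\<bar>)\<^sup>2 \<le> (\<integral>\<^sup>+t. ennreal \<bar>f' t * indicator {0..1} t\<bar> \<partial>lborel)\<^sup>2"
    by (intro power_mono) auto
  also have "\<dots> = (\<integral>\<^sup>+t. ennreal \<bar>f' t * indicator {0..1} t\<bar> * indicator {0..1} t \<partial>lborel)\<^sup>2"
    by (intro arg_cong[where f="\<lambda>z. z\<^sup>2"] nn_integral_cong) (auto simp: indicator_def)
  also have "\<dots> \<le> (\<integral>\<^sup>+t. (ennreal \<bar>f' t * indicator {0..1} t\<bar>)\<^sup>2 \<partial>lborel) * (\<integral>\<^sup>+t. (indicator {0..1::real} t)\<^sup>2 \<partial>lborel)"
    by (rule Cauchy_Schwarz_nn_integral) measurable
  also have "(\<integral>\<^sup>+t. (indicator {0..1::real} t :: ennreal)\<^sup>2 \<partial>lborel) = (\<integral>\<^sup>+t. indicator {0..1::real} t \<partial>lborel)"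
    by (intro nn_integral_cong) (auto simp: indicator_def)
  also have "\<dots> = 1" by simp
  also have "(\<integral>\<^sup>+t. (ennreal \<bar>f' t * indicator {0..1} t\<bar>)\<^sup>2 \<partial>lborel) = (\<integral>\<^sup>+t\<in>{0..1}. ennreal ((f' t)\<^sup>2) \<partial>lborel)"
    by (intro nn_integral_cong) (auto simp: indicator_def ennreal_power)
  finally show ?thesis by (simp add: ennreal_power)
qed

text \<open>The Jacobian of the substitution is at least (1/2)^d; this is the origin of the factor
  2^d in the Poincare inequality.\<close>

lemma nn_integral_affine_le:
  fixes H :: "real^'d::finite \<Rightarrow> ennreal"
  assumes [measurable]: "H \<in> borel_measurable borel" and t: "t \<ge> 1/2"
  shows "(\<integral>\<^sup>+x. H (c + t *\<^sub>R x) \<partial>lborel) \<le> ennreal (2 ^ CARD('d)) * (\<integral>\<^sup>+x. H x \<partial>lborel)"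
proof -
  have "ennreal (2 ^ CARD('d)) * (\<integral>\<^sup>+x. H x \<partial>lborel)
      = ennreal (2 ^ CARD('d)) * (ennreal (\<bar>t\<bar> ^ CARD('d)) * (\<integral>\<^sup>+x. H (c + t *\<^sub>R x) \<partial>lborel))"
    using nn_integral_lborel_affine[OF assms(1), of t c] t by simp
  also have "\<dots> = ennreal ((2 * t) ^ CARD('d)) * (\<integral>\<^sup>+x. H (c + t *\<^sub>R x) \<partial>lborel)"
    using t by (simp add: mult.assoc[symmetric] ennreal_mult[symmetric] power_mult_distrib del: mult.assoc)
  also have "\<dots> \<ge> ennreal 1 * (\<integral>\<^sup>+x. H (c + t *\<^sub>R x) \<partial>lborel)"
    using t by (intro mult_right_mono ennreal_leI one_le_power) auto
  finally show ?thesis by simp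
qed

text \<open>One of \<open>t\<close> and \<open>1 - t\<close> is at least \<open>1/2\<close>, and the corresponding variable is substituted.\<close>

lemma nn_integral_segment_le:
  fixes H :: "real^'d::finite \<Rightarrow> ennreal"
  assumes [measurable]: "H \<in> borel_measurable borel" "T \<in> sets borel"
  shows "(\<integral>\<^sup>+x. (\<integral>\<^sup>+y. indicator T x * indicator T y * H (y + t *\<^sub>R (x - y)) \<partial>lborel) \<partial>lborel)
     \<le> ennreal (2 ^ CARD('d)) * emeasure lborel T * (\<integral>\<^sup>+x. H x \<partial>lborel)"
proof -
  define I where "I = (\<integral>\<^sup>+x. H x \<partial>lborel)"
  have "(\<integral>\<^sup>+x. (\<integral>\<^sup>+y. indicator T x * indicator T y * H (y + t *\<^sub>R (x - y)) \<partial>lborel) \<partial>lborel)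
     \<le> (\<integral>\<^sup>+x. indicator T x * (ennreal (2 ^ CARD('d)) * I) \<partial>lborel)"
  proof (cases "t \<le> 1/2")
    case True
    have "(\<integral>\<^sup>+y. indicator T x * indicator T y * H (y + t *\<^sub>R (x - y)) \<partial>lborel)
        \<le> indicator T x * (ennreal (2 ^ CARD('d)) * I)" for x
    proof -
      have "(\<integral>\<^sup>+y. indicator T x * indicator T y * H (y + t *\<^sub>R (x - y)) \<partial>lborel)
          \<le> (\<integral>\<^sup>+y. indicator T x * H (t *\<^sub>R x + (1 - t) *\<^sub>R y) \<partial>lborel)"
        by (intro nn_integral_mono) (auto simp: indicator_def algebra_simps)
      also have "\<dots> = indicator T x * (\<integral>\<^sup>+y. H (t *\<^sub>R x + (1 - t) *\<^sub>R y) \<partial>lborel)"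
        by (rule nn_integral_cmult) simp
      also have "\<dots> \<le> indicator T x * (ennreal (2 ^ CARD('d)) * I)"
        unfolding I_def by (intro mult_left_mono nn_integral_affine_le) (use True in auto)
      finally show ?thesis .
    qed
    then show ?thesis by (rule nn_integral_mono)
  next
    case False
    have "(\<integral>\<^sup>+x. (\<integral>\<^sup>+y. indicator T x * indicator T y * H (y + t *\<^sub>R (x - y)) \<partial>lborel) \<partial>lborel)
        = (\<integral>\<^sup>+y. (\<integral>\<^sup>+x. indicator T x * indicator T y * H (y + t *\<^sub>R (x - y)) \<partial>lborel) \<partial>lborel)"
      by (rule lborel_pair.Fubini') measurable
    also have "\<dots> \<le> (\<integral>\<^sup>+y. indicator T y * (ennreal (2 ^ CARD('d)) * I) \<partial>lborel)"
    proof (rule nn_integral_mono)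
      fix y
      have "(\<integral>\<^sup>+x. indicator T x * indicator T y * H (y + t *\<^sub>R (x - y)) \<partial>lborel)
          \<le> (\<integral>\<^sup>+x. indicator T y * H ((1 - t) *\<^sub>R y + t *\<^sub>R x) \<partial>lborel)"
        by (intro nn_integral_mono) (auto simp: indicator_def algebra_simps)
      also have "\<dots> = indicator T y * (\<integral>\<^sup>+x. H ((1 - t) *\<^sub>R y + t *\<^sub>R x) \<partial>lborel)"
        by (rule nn_integral_cmult) simp
      also have "\<dots> \<le> indicator T y * (ennreal (2 ^ CARD('d)) * I)"
        unfolding I_def by (intro mult_left_mono nn_integral_affine_le) (use False in auto)
      finally show "(\<integral>\<^sup>+x. indicator T x * indicator T y * H (y + t *\<^sub>R (x - y)) \<partial>lborel)
        \<le> indicator T y * (ennreal (2 ^ CARD('d)) * I)" .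
    qed
    finally show ?thesis .
  qed
  also have "\<dots> = emeasure lborel T * (ennreal (2 ^ CARD('d)) * I)"
    by (subst nn_integral_multc) auto
  finally show ?thesis by (simp add: I_def mult_ac)
qed

lemma sum_mult_square_le:
  fixes w a :: "'i \<Rightarrow> real"
  shows "(\<Sum>i\<in>I. w i * a i)\<^sup>2 \<le> (\<Sum>i\<in>I. (w i)\<^sup>2) * (\<Sum>i\<in>I. (a i)\<^sup>2)"
  by (rule Cauchy_Schwarz_ineq_sum)

lemma sum_square_norm: "(\<Sum>i\<in>UNIV. (w $ i)\<^sup>2) = (norm (w :: real^'d::finite))\<^sup>2"
  by (simp add: norm_vec_def L2_set_def sum_nonneg)

lemma sum_ennreal_square: "(\<Sum>i\<in>I. ennreal ((f i)\<^sup>2)) = ennreal (\<Sum>i\<in>I. (f i)\<^sup>2)"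
  by (rule sum_ennreal) simp

section \<open>The Poincare inequality as a double integral\<close>

text \<open>Here a mollification of radius \<open>e\<close> sees only \<open>T\<close>. Using
  \<open>infdist\<close> makes the set open, hence Borel. Since the distance to the empty set is 0
  by convention, boundedness of \<open>T\<close> is invoked later to know that the complement is
  nonempty.\<close>

definition inner_part :: "(real^'d::finite) set \<Rightarrow> real \<Rightarrow> (real^'d) set" where
  "inner_part T e = {x. infdist x (- T) > e}"

lemma inner_part_borel[measurable]: "inner_part T e \<in> sets borel"
  unfolding inner_part_def by (intro borel_open open_Collect_less continuous_intros)

lemma inner_part_cball: "x \<in> inner_part T e \<Longrightarrow> cball x e \<subseteq> T"
  unfolding inner_part_def using infdist_le[of _ "- T" x] by (force simp: not_less)

lemma inner_part_eventually:
  fixes T :: "(real^'d::finite) set"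
  assumes "open T" "bounded T" "x \<in> T" "e \<longlonglongrightarrow> 0"
  shows "\<forall>\<^sub>F n in sequentially. x \<in> inner_part T (e n)"
proof -
  have "- T \<noteq> {}" using assms(2) not_bounded_UNIV[where 'a="real^'d"] by (metis Compl_UNIV_eq double_complement)
  then have "infdist x (- T) > 0"
    using assms(1,3) by (metis ComplD closed_Compl in_closed_iff_infdist_zero infdist_nonneg less_le)
  from order_tendstoD(2)[OF assms(4) this] show ?thesis by (simp add: inner_part_def)
qed

text \<open>Shifting both endpoints by the same small vector keeps them in \<open>T\<close>, and the
  shifted segment follows by convexity.\<close>

lemma segment_cball:
  fixes T :: "'a::real_normed_vector set"
  assumes "convex T" "cball x e \<subseteq> T" "cball y e \<subseteq> T" "0 \<le> t" "t \<le> 1"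
  shows "cball (y + t *\<^sub>R (x - y)) e \<subseteq> T"
proof
  fix z assume z: "z \<in> cball (y + t *\<^sub>R (x - y)) e"
  define w where "w = z - (y + t *\<^sub>R (x - y))"
  have "norm w \<le> e" using z by (simp add: w_def dist_norm norm_minus_commute)
  then have "y + w \<in> T" "x + w \<in> T" using assms(2,3) by (auto simp: subset_iff dist_norm)
  then have "(1 - t) *\<^sub>R (y + w) + t *\<^sub>R (x + w) \<in> T" using assms by (intro convexD) auto
  also have "(1 - t) *\<^sub>R (y + w) + t *\<^sub>R (x + w) = z" by (simp add: w_def algebra_simps)
  finally show "z \<in> T" .
qed

abbreviation unit_mi :: "'d \<Rightarrow> 'd \<Rightarrow> nat" where
  "unit_mi i \<equiv> (\<lambda>_. 0)(i := Suc 0)"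

lemma conv_square_diff_le:
  fixes u0 :: "real^'d::finite \<Rightarrow> real" and g0 :: "'d \<Rightarrow> real^'d \<Rightarrow> real"
  assumes T: "open T" "convex T"
    and wd: "\<And>i. has_weak_deriv T (unit_mi i) u (g i)" and u: "borel_rep T u u0" and g: "\<And>i. borel_rep T (g i) (g0 i)"
    and i0: "integrable lborel u0" "\<And>i. integrable lborel (g0 i)"
    and F: "mollifier e F" and xy: "cball x e \<subseteq> T" "cball y e \<subseteq> T" "dist x y \<le> h"
  shows "ennreal ((conv u0 (tensor F (\<lambda>_. 0)) x - conv u0 (tensor F (\<lambda>_. 0)) y)\<^sup>2)
    \<le> (\<integral>\<^sup>+t\<in>{0..1}. ennreal (h\<^sup>2) * (\<Sum>i\<in>UNIV. ennreal ((conv (g0 i) (tensor F (\<lambda>_. 0)) (y + t *\<^sub>R (x - y)))\<^sup>2)) \<partial>lborel)"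
proof -
  let ?D = "\<lambda>t. \<Sum>i\<in>UNIV. (x - y) $ i * conv u0 (tensor F (unit_mi i)) (y + t *\<^sub>R (x - y))"
  have "ennreal ((conv u0 (tensor F (\<lambda>_. 0)) (y + 1 *\<^sub>R (x - y)) - conv u0 (tensor F (\<lambda>_. 0)) (y + 0 *\<^sub>R (x - y)))\<^sup>2)
     \<le> (\<integral>\<^sup>+t\<in>{0..1}. ennreal ((?D t)\<^sup>2) \<partial>lborel)"
  proof (rule square_diff_le_nn_integral)
    show "((\<lambda>t. conv u0 (tensor F (\<lambda>_. 0)) (y + t *\<^sub>R (x - y))) has_real_derivative ?D t) (at t)" for t
      by (rule conv_line_derivative[OF F i0(1)])
    show "continuous_on UNIV ?D"
      by (intro continuous_intros continuous_on_compose2[OF continuous_conv[OF F i0(1), of UNIV]]) auto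
  qed
  also have "\<dots> \<le> (\<integral>\<^sup>+t\<in>{0..1}. ennreal (h\<^sup>2) * (\<Sum>i\<in>UNIV. ennreal ((conv (g0 i) (tensor F (\<lambda>_. 0)) (y + t *\<^sub>R (x - y)))\<^sup>2)) \<partial>lborel)"
  proof (rule nn_integral_mono)
    fix t
    let ?V = "\<lambda>i. conv (g0 i) (tensor F (\<lambda>_. 0)) (y + t *\<^sub>R (x - y))"
    show "ennreal ((?D t)\<^sup>2) * indicator {0..1} t \<le> ennreal (h\<^sup>2) * (\<Sum>i\<in>UNIV. ennreal ((?V i)\<^sup>2)) * indicator {0..1} t"
    proof (cases "t \<in> {0..1}")
      case True
      then have "conv u0 (tensor F (unit_mi i)) (y + t *\<^sub>R (x - y)) = ?V i" for i
        by (intro conv_weak_deriv[OF T(1) wd u g F] segment_cball T xy) auto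
      then have "(?D t)\<^sup>2 = (\<Sum>i\<in>UNIV. (x - y) $ i * ?V i)\<^sup>2" by simp
      also have "\<dots> \<le> (\<Sum>i\<in>UNIV. ((x - y) $ i)\<^sup>2) * (\<Sum>i\<in>UNIV. (?V i)\<^sup>2)" by (rule sum_mult_square_le)
      also have "\<dots> \<le> h\<^sup>2 * (\<Sum>i\<in>UNIV. (?V i)\<^sup>2)"
        unfolding sum_square_norm using xy(3) by (intro mult_right_mono power_mono sum_nonneg) (auto simp: dist_norm)
      finally have "ennreal ((?D t)\<^sup>2) \<le> ennreal (h\<^sup>2) * (\<Sum>i\<in>UNIV. ennreal ((?V i)\<^sup>2))"
        unfolding sum_ennreal_square by (simp add: ennreal_mult[symmetric] sum_nonneg ennreal_leI)
      then show ?thesis using True by simp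
    qed simp
  qed
  finally show ?thesis by simp
qed

text \<open>In this form the inequality involves no mean value and survives mollification. The
  squared difference is bounded by an integral over the segment, Fubini makes the segment parameter
  outermost, and for each parameter value a linear substitution removes the segment.\<close>

lemma poincare_double_integral:
  fixes u0 :: "real^'d::finite \<Rightarrow> real" and g0 :: "'d \<Rightarrow> real^'d \<Rightarrow> real"
  assumes T: "open T" "convex T" "bounded T"
    and wd: "\<And>i. has_weak_deriv T (unit_mi i) u (g i)" and u: "borel_rep T u u0" and g: "\<And>i. borel_rep T (g i) (g0 i)"
    and i0: "integrable lborel u0" "\<And>i. integrable lborel (g0 i)"
    and h: "\<And>x y. x \<in> T \<Longrightarrow> y \<in> T \<Longrightarrow> dist x y \<le> h"
  shows "(\<integral>\<^sup>+x. (\<integral>\<^sup>+y. indicator T x * indicator T y * ennreal ((u0 x - u0 y)\<^sup>2) \<partial>lborel) \<partial>lborel)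
     \<le> ennreal (2 ^ CARD('d) * h\<^sup>2) * emeasure lborel T * (\<Sum>i\<in>UNIV. \<integral>\<^sup>+x. ennreal ((g0 i x)\<^sup>2) \<partial>lborel)"
proof -
  have Tm[measurable]: "T \<in> sets borel" using T(1) by simp
  have [measurable]: "u0 \<in> borel_measurable borel" "g0 i \<in> borel_measurable borel" for i
    using u g by (auto simp: borel_rep_def)
  obtain R where R: "\<And>x. x \<in> T \<Longrightarrow> norm x < R" using T(3) bounded_pos_less by metis
  have z: "u0 x = 0" if "norm x \<ge> R" for x using R[of x] that u by (auto simp: borel_rep_def)
  obtain e F where F: "\<And>n. mollifier (e n) (F n)" and e: "e \<longlonglongrightarrow> 0"
    and lim: "AE y in lborel. (\<lambda>n. conv u0 (tensor (F n) (\<lambda>_. 0)) y) \<longlonglongrightarrow> u0 y"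
    by (rule mollify_AE[OF i0(1) z]) blast+
  define U where "U n = conv u0 (tensor (F n) (\<lambda>_. 0))" for n
  define V where "V n i = conv (g0 i) (tensor (F n) (\<lambda>_. 0))" for n i
  have [measurable]: "U n \<in> borel_measurable borel" "V n i \<in> borel_measurable borel" for n i
    unfolding U_def V_def by (intro borel_measurable_continuous_onI continuous_conv[OF F] i0)+
  define H where "H n x = ennreal (h\<^sup>2) * (\<Sum>i\<in>UNIV. ennreal ((V n i x)\<^sup>2))" for n x
  have [measurable]: "H n \<in> borel_measurable borel" for n unfolding H_def by measurable
  define S where "S n = inner_part T (e n)" for n
  have [measurable]: "S n \<in> sets borel" for n by (simp add: S_def)
  have ST: "S n \<subseteq> T" for n
  proof
    fix x assume "x \<in> S n"
    then have "cball x (e n) \<subseteq> T" unfolding S_def by (rule inner_part_cball)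
    then show "x \<in> T" using mollifierD(1)[OF F, of n] by (auto simp: subset_iff)
  qed
  \<comment> \<open>The indicators restrict to points where the mollified inequality is valid; for
    fixed points of \<open>T\<close> they are eventually 1.\<close>
  define f where "f n x y = indicator (S n) x * indicator (S n) y * ennreal ((U n x - U n y)\<^sup>2)" for n x y
  define B where "B = ennreal (2 ^ CARD('d) * h\<^sup>2) * emeasure lborel T * (\<Sum>i\<in>UNIV. \<integral>\<^sup>+x. ennreal ((g0 i x)\<^sup>2) \<partial>lborel)"
  have bound: "(\<integral>\<^sup>+x. (\<integral>\<^sup>+y. f n x y \<partial>lborel) \<partial>lborel) \<le> B" for n
  proof -
    have "(\<integral>\<^sup>+x. (\<integral>\<^sup>+y. f n x y \<partial>lborel) \<partial>lborel)
       \<le> (\<integral>\<^sup>+x. (\<integral>\<^sup>+y. (\<integral>\<^sup>+t. indicator T x * indicator T y * H n (y + t *\<^sub>R (x - y)) * indicator {0..1::real} t \<partial>lborel) \<partial>lborel) \<partial>lborel)"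
    proof (intro nn_integral_mono)
      fix x y
      show "f n x y \<le> (\<integral>\<^sup>+t. indicator T x * indicator T y * H n (y + t *\<^sub>R (x - y)) * indicator {0..1::real} t \<partial>lborel)"
      proof (cases "x \<in> S n \<and> y \<in> S n")
        case True
        then have xy: "x \<in> T" "y \<in> T" "cball x (e n) \<subseteq> T" "cball y (e n) \<subseteq> T"
          using ST inner_part_cball[of x T "e n"] inner_part_cball[of y T "e n"] unfolding S_def by blast+
        have "f n x y = ennreal ((U n x - U n y)\<^sup>2)" using True by (simp add: f_def)
        also have "\<dots> \<le> (\<integral>\<^sup>+t\<in>{0..1}. H n (y + t *\<^sub>R (x - y)) \<partial>lborel)"
          unfolding U_def H_def V_def
          by (rule conv_square_diff_le[OF T(1,2) wd u g i0 F xy(3,4) h[OF xy(1,2)]])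
        finally show ?thesis using xy by simp
      qed (auto simp: f_def)
    qed
    also have "\<dots> = (\<integral>\<^sup>+x. (\<integral>\<^sup>+t. (\<integral>\<^sup>+y. indicator T x * indicator T y * H n (y + t *\<^sub>R (x - y)) * indicator {0..1::real} t \<partial>lborel) \<partial>lborel) \<partial>lborel)"
      by (intro nn_integral_cong lborel_pair.Fubini') measurable
    also have "\<dots> = (\<integral>\<^sup>+t. (\<integral>\<^sup>+x. (\<integral>\<^sup>+y. indicator T x * indicator T y * H n (y + t *\<^sub>R (x - y)) * indicator {0..1::real} t \<partial>lborel) \<partial>lborel) \<partial>lborel)"
      by (rule lborel_pair.Fubini') measurable
    also have "\<dots> = (\<integral>\<^sup>+t. (\<integral>\<^sup>+x. (\<integral>\<^sup>+y. indicator T x * indicator T y * H n (y + t *\<^sub>R (x - y)) \<partial>lborel) \<partial>lborel) * indicator {0..1::real} t \<partial>lborel)"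
      by (simp add: nn_integral_multc)
    also have "\<dots> \<le> (\<integral>\<^sup>+t. ennreal (2 ^ CARD('d)) * emeasure lborel T * (\<integral>\<^sup>+x. H n x \<partial>lborel) * indicator {0..1::real} t \<partial>lborel)"
      by (intro nn_integral_mono mult_right_mono nn_integral_segment_le) auto
    also have "\<dots> = ennreal (2 ^ CARD('d)) * emeasure lborel T * (\<integral>\<^sup>+x. H n x \<partial>lborel)"
      by (subst nn_integral_cmult_indicator) auto
    also have "(\<integral>\<^sup>+x. H n x \<partial>lborel) = ennreal (h\<^sup>2) * (\<Sum>i\<in>UNIV. \<integral>\<^sup>+x. ennreal ((V n i x)\<^sup>2) \<partial>lborel)"
      unfolding H_def by (simp add: nn_integral_cmult nn_integral_sum del: sum_ennreal)
    also have "(\<Sum>i\<in>UNIV. \<integral>\<^sup>+x. ennreal ((V n i x)\<^sup>2) \<partial>lborel) \<le> (\<Sum>i\<in>UNIV. \<integral>\<^sup>+x. ennreal ((g0 i x)\<^sup>2) \<partial>lborel)"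
      unfolding V_def by (intro sum_mono conv_L2_bound[OF F]) simp
    also have "ennreal (2 ^ CARD('d)) * emeasure lborel T * (ennreal (h\<^sup>2) * (\<Sum>i\<in>UNIV. \<integral>\<^sup>+x. ennreal ((g0 i x)\<^sup>2) \<partial>lborel)) = B"
      unfolding B_def by (simp add: ennreal_mult' mult_ac)
    finally show ?thesis by (simp add: mult_left_mono)
  qed
  \<comment> \<open>Fatou's lemma is applied twice, in \<open>y\<close> for almost every fixed
    \<open>x\<close> and then in \<open>x\<close>, because the convergence is only almost everywhere
    in each variable.\<close>
  have "(\<integral>\<^sup>+x. (\<integral>\<^sup>+y. indicator T x * indicator T y * ennreal ((u0 x - u0 y)\<^sup>2) \<partial>lborel) \<partial>lborel)
     \<le> (\<integral>\<^sup>+x. liminf (\<lambda>n. \<integral>\<^sup>+y. f n x y \<partial>lborel) \<partial>lborel)"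
  proof (rule nn_integral_mono_AE)
    show "AE x in lborel. (\<integral>\<^sup>+y. indicator T x * indicator T y * ennreal ((u0 x - u0 y)\<^sup>2) \<partial>lborel)
       \<le> liminf (\<lambda>n. \<integral>\<^sup>+y. f n x y \<partial>lborel)"
      using lim
    proof eventually_elim
      case (elim x)
      have "(\<integral>\<^sup>+y. indicator T x * indicator T y * ennreal ((u0 x - u0 y)\<^sup>2) \<partial>lborel)
         \<le> (\<integral>\<^sup>+y. liminf (\<lambda>n. f n x y) \<partial>lborel)"
      proof (rule nn_integral_mono_AE)
        show "AE y in lborel. indicator T x * indicator T y * ennreal ((u0 x - u0 y)\<^sup>2) \<le> liminf (\<lambda>n. f n x y)"
          using lim
        proof eventually_elim
          case y: (elim y)
          show ?case
          proof (cases "x \<in> T \<and> y \<in> T")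
            case True
            have "(\<lambda>n. ennreal ((U n x - U n y)\<^sup>2)) \<longlonglongrightarrow> ennreal ((u0 x - u0 y)\<^sup>2)"
              unfolding U_def by (intro tendsto_intros elim y)
            moreover have "\<forall>\<^sub>F n in sequentially. ennreal ((U n x - U n y)\<^sup>2) = f n x y"
              using inner_part_eventually[OF T(1,3) _ e, of x] inner_part_eventually[OF T(1,3) _ e, of y] True
              unfolding f_def S_def by (auto elim: eventually_elim2)
            ultimately have "(\<lambda>n. f n x y) \<longlonglongrightarrow> ennreal ((u0 x - u0 y)\<^sup>2)"
              by (rule Lim_transform_eventually)
            then have "liminf (\<lambda>n. f n x y) = ennreal ((u0 x - u0 y)\<^sup>2)"
              by (rule lim_imp_Liminf[OF sequentially_bot])
            then show ?thesis using True by simp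
          qed auto
        qed
      qed
      also have "\<dots> \<le> liminf (\<lambda>n. \<integral>\<^sup>+y. f n x y \<partial>lborel)"
        by (rule nn_integral_liminf) (simp add: f_def)
      finally show ?case .
    qed
  qed
  also have "\<dots> \<le> liminf (\<lambda>n. \<integral>\<^sup>+x. (\<integral>\<^sup>+y. f n x y \<partial>lborel) \<partial>lborel)"
    by (rule nn_integral_liminf) (simp add: f_def)
  also have "\<dots> \<le> B"
    using bound by (metis (mono_tags, lifting) Liminf_const Liminf_mono always_eventually sequentially_bot)
  finally show ?thesis unfolding B_def .
qed

section \<open>Pointwise bounds from second derivatives\<close>

abbreviation unit2_mi :: "'d \<Rightarrow> 'd \<Rightarrow> 'd \<Rightarrow> nat" where
  "unit2_mi i j \<equiv> (unit_mi i)(j := Suc (unit_mi i j))"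

text \<open>
  Apply the lemma \<open>square_diff_le_nn_integral\<close> to \<open>r \<mapsto> r\<^sup>2 f'(r\<^sup>2) - f(r\<^sup>2)\<close>; the substitution \<open>t = r\<^sup>2\<close>
  produces the weight \<open>r\<^sup>6\<close> that compensates the Jacobian \<open>r\<^bsup>-2d\<^esup>\<close> for \<open>d \<le> 3\<close>.
\<close>

lemma square_le_taylor2:
  fixes f f' f'' :: "real \<Rightarrow> real"
  assumes f: "\<And>t. (f has_real_derivative f' t) (at t)" and f': "\<And>t. (f' has_real_derivative f'' t) (at t)"
    and c: "continuous_on UNIV f''"
  shows "ennreal ((f 0)\<^sup>2) \<le> 3 * (ennreal ((f 1)\<^sup>2) + ennreal ((f' 1)\<^sup>2)
     + (\<integral>\<^sup>+r\<in>{0..1}. ennreal (4 * r ^ 6 * (f'' (r\<^sup>2))\<^sup>2) \<partial>lborel))"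
proof -
  \<comment> \<open>In the variable t, the function t f'(t) - f(t) has derivative t f''(t), the
    first-order terms cancelling. Its values at 1 and 0 are f'(1) - f(1) and -f(0).\<close>
  define G where "G r = r\<^sup>2 * f' (r\<^sup>2) - f (r\<^sup>2)" for r
  have G: "(G has_real_derivative 2 * r ^ 3 * f'' (r\<^sup>2)) (at r)" for r
  proof -
    have s: "((\<lambda>r. r\<^sup>2) has_real_derivative 2 * r) (at r)" by (auto intro!: derivative_eq_intros)
    note d = DERIV_chain'[OF s f[of "r\<^sup>2"]] DERIV_chain'[OF s f'[of "r\<^sup>2"]]
    have "(G has_real_derivative (2 * r * f' (r\<^sup>2) + (f'' (r\<^sup>2) * (2 * r)) * r\<^sup>2 - f' (r\<^sup>2) * (2 * r))) (at r)"
      unfolding G_def[abs_def] by (intro DERIV_diff DERIV_mult s d)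
    then show ?thesis by (simp add: power2_eq_square power3_eq_cube mult_ac)
  qed
  have "continuous_on UNIV (\<lambda>r. 2 * r ^ 3 * f'' (r\<^sup>2))"
    by (intro continuous_intros continuous_on_compose2[OF c]) auto
  from square_diff_le_nn_integral[OF G this]
  have 1: "ennreal ((G 1 - G 0)\<^sup>2) \<le> (\<integral>\<^sup>+r\<in>{0..1}. ennreal (4 * r ^ 6 * (f'' (r\<^sup>2))\<^sup>2) \<partial>lborel)"
    by (simp add: power_mult_distrib flip: power_mult)
  have sq: "(a + b + c)\<^sup>2 \<le> 3 * (a\<^sup>2 + b\<^sup>2 + c\<^sup>2)" for a b c :: real
    using sum_squares_ge_zero[of "a - b" "b - c"] zero_le_power2[of "a - c"]
    by (simp add: power2_eq_square algebra_simps)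
  have "f 0 = f 1 + (- f' 1) + (G 1 - G 0)" by (simp add: G_def)
  then have "(f 0)\<^sup>2 \<le> 3 * ((f 1)\<^sup>2 + (f' 1)\<^sup>2 + (G 1 - G 0)\<^sup>2)"
    using sq[of "f 1" "- f' 1" "G 1 - G 0"] by (simp only: power2_minus)
  then have "ennreal ((f 0)\<^sup>2) \<le> ennreal (3 * ((f 1)\<^sup>2 + (f' 1)\<^sup>2 + (G 1 - G 0)\<^sup>2))" by (rule ennreal_leI)
  also have "\<dots> = 3 * (ennreal ((f 1)\<^sup>2) + ennreal ((f' 1)\<^sup>2) + ennreal ((G 1 - G 0)\<^sup>2))"
    by (simp add: ennreal_mult ennreal_plus del: ennreal_plus[symmetric])
  also have "\<dots> \<le> 3 * (ennreal ((f 1)\<^sup>2) + ennreal ((f' 1)\<^sup>2)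
     + (\<integral>\<^sup>+r\<in>{0..1}. ennreal (4 * r ^ 6 * (f'' (r\<^sup>2))\<^sup>2) \<partial>lborel))"
    by (intro mult_left_mono add_left_mono 1) auto
  finally show ?thesis .
qed

lemma quadratic_form_square_le:
  fixes w :: "real^'d::finite"
  shows "(\<Sum>i\<in>UNIV. w $ i * (\<Sum>j\<in>UNIV. w $ j * a i j))\<^sup>2 \<le> (norm w) ^ 4 * (\<Sum>i\<in>UNIV. \<Sum>j\<in>UNIV. (a i j)\<^sup>2)"
proof -
  have "(\<Sum>i\<in>UNIV. w $ i * (\<Sum>j\<in>UNIV. w $ j * a i j))\<^sup>2
      \<le> (norm w)\<^sup>2 * (\<Sum>i\<in>UNIV. (\<Sum>j\<in>UNIV. w $ j * a i j)\<^sup>2)"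
    using sum_mult_square_le[of "\<lambda>i. w $ i" _ UNIV] by (simp only: sum_square_norm)
  also have "\<dots> \<le> (norm w)\<^sup>2 * (\<Sum>i\<in>UNIV. (norm w)\<^sup>2 * (\<Sum>j\<in>UNIV. (a i j)\<^sup>2))"
    using sum_mult_square_le[of "\<lambda>i. w $ i" _ UNIV]
    by (intro mult_left_mono sum_mono) (simp_all only: sum_square_norm zero_le_power2)
  also have "\<dots> = (norm w) ^ 4 * (\<Sum>i\<in>UNIV. \<Sum>j\<in>UNIV. (a i j)\<^sup>2)"
    by (simp add: sum_distrib_left[symmetric] mult.assoc[symmetric] flip: power_add)
  finally show ?thesis .
qed

text \<open>Taylor expansion about \<open>y\<close>, evaluated at \<open>x\<close>. The segment
  parameter starts at \<open>x\<close>, so that for fixed \<open>x\<close> the remainder points x +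
  r^2 (y - x) are a contraction in \<open>y\<close>, over which an average is taken next.\<close>

lemma conv_square_le:
  fixes u0 :: "real^'d::finite \<Rightarrow> real" and g0 :: "'d \<Rightarrow> real^'d \<Rightarrow> real" and k0 :: "'d \<Rightarrow> 'd \<Rightarrow> real^'d \<Rightarrow> real"
  assumes T: "open T" "convex T"
    and wd: "\<And>i. has_weak_deriv T (unit_mi i) u (g i)" "\<And>i j. has_weak_deriv T (unit2_mi i j) u (k i j)"
    and u: "borel_rep T u u0" and g: "\<And>i. borel_rep T (g i) (g0 i)" and k: "\<And>i j. borel_rep T (k i j) (k0 i j)"
    and i0: "integrable lborel u0"
    and F: "mollifier e F" and xy: "cball x e \<subseteq> T" "cball y e \<subseteq> T" "dist x y \<le> h"
  defines "C \<equiv> \<lambda>v. conv v (tensor F (\<lambda>_. 0))"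
  shows "ennreal ((C u0 x)\<^sup>2)
    \<le> 3 * (ennreal ((C u0 y)\<^sup>2) + ennreal (h\<^sup>2) * (\<Sum>i\<in>UNIV. ennreal ((C (g0 i) y)\<^sup>2))
      + (\<integral>\<^sup>+r\<in>{0..1}. ennreal (4 * h ^ 4 * r ^ 6) * (\<Sum>i\<in>UNIV. \<Sum>j\<in>UNIV. ennreal ((C (k0 i j) (x + r\<^sup>2 *\<^sub>R (y - x)))\<^sup>2)) \<partial>lborel))"
proof -
  define w where "w = y - x"
  have w: "norm w \<le> h" using xy(3) by (simp add: w_def dist_norm norm_minus_commute)
  then have h: "h \<ge> 0" using norm_ge_zero order_trans by blast
  let ?f = "\<lambda>t. C u0 (x + t *\<^sub>R w)"
  let ?f' = "\<lambda>t. \<Sum>i\<in>UNIV. w $ i * conv u0 (tensor F (unit_mi i)) (x + t *\<^sub>R w)"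
  let ?f'' = "\<lambda>t. \<Sum>i\<in>UNIV. w $ i * (\<Sum>j\<in>UNIV. w $ j * conv u0 (tensor F (unit2_mi i j)) (x + t *\<^sub>R w))"
  have main: "ennreal ((?f 0)\<^sup>2) \<le> 3 * (ennreal ((?f 1)\<^sup>2) + ennreal ((?f' 1)\<^sup>2)
     + (\<integral>\<^sup>+r\<in>{0..1}. ennreal (4 * r ^ 6 * (?f'' (r\<^sup>2))\<^sup>2) \<partial>lborel))"
  proof (rule square_le_taylor2)
    show "(?f has_real_derivative ?f' t) (at t)" for t
      unfolding C_def by (rule conv_line_derivative[OF F i0])
    show "(?f' has_real_derivative ?f'' t) (at t)" for t
      by (intro DERIV_sum DERIV_cmult conv_line_derivative[OF F i0])
    show "continuous_on UNIV ?f''"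
      by (intro continuous_intros continuous_on_compose2[OF continuous_conv[OF F i0, of UNIV]]) auto
  qed
  have 1: "ennreal ((?f' 1)\<^sup>2) \<le> ennreal (h\<^sup>2) * (\<Sum>i\<in>UNIV. ennreal ((C (g0 i) y)\<^sup>2))"
  proof -
    have "conv u0 (tensor F (unit_mi i)) (x + 1 *\<^sub>R w) = C (g0 i) y" for i
      unfolding C_def using conv_weak_deriv[OF T(1) wd(1) u g F xy(2)] by (simp add: w_def)
    then have "(?f' 1)\<^sup>2 = (\<Sum>i\<in>UNIV. w $ i * C (g0 i) y)\<^sup>2" by simp
    also have "\<dots> \<le> (norm w)\<^sup>2 * (\<Sum>i\<in>UNIV. (C (g0 i) y)\<^sup>2)"
      using sum_mult_square_le[of "\<lambda>i. w $ i" _ UNIV] by (simp only: sum_square_norm)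
    also have "\<dots> \<le> h\<^sup>2 * (\<Sum>i\<in>UNIV. (C (g0 i) y)\<^sup>2)"
      using w by (intro mult_right_mono power_mono sum_nonneg) auto
    finally show ?thesis unfolding sum_ennreal_square
      by (simp add: ennreal_mult[symmetric] sum_nonneg ennreal_leI)
  qed
  have 2: "(\<integral>\<^sup>+r\<in>{0..1}. ennreal (4 * r ^ 6 * (?f'' (r\<^sup>2))\<^sup>2) \<partial>lborel)
    \<le> (\<integral>\<^sup>+r\<in>{0..1}. ennreal (4 * h ^ 4 * r ^ 6) * (\<Sum>i\<in>UNIV. \<Sum>j\<in>UNIV. ennreal ((C (k0 i j) (x + r\<^sup>2 *\<^sub>R w))\<^sup>2)) \<partial>lborel)"
  proof (rule nn_integral_mono)
    fix r :: real
    let ?z = "x + r\<^sup>2 *\<^sub>R w"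
    show "ennreal (4 * r ^ 6 * (?f'' (r\<^sup>2))\<^sup>2) * indicator {0..1} r
      \<le> ennreal (4 * h ^ 4 * r ^ 6) * (\<Sum>i\<in>UNIV. \<Sum>j\<in>UNIV. ennreal ((C (k0 i j) ?z)\<^sup>2)) * indicator {0..1} r"
    proof (cases "r \<in> {0..1}")
      case True
      then have "cball ?z e \<subseteq> T"
        unfolding w_def by (intro segment_cball T xy) (auto simp: power_le_one)
      from conv_weak_deriv[OF T(1) wd(2) u k F this]
      have "conv u0 (tensor F (unit2_mi i j)) ?z = C (k0 i j) ?z" for i j unfolding C_def .
      then have "(?f'' (r\<^sup>2))\<^sup>2 = (\<Sum>i\<in>UNIV. w $ i * (\<Sum>j\<in>UNIV. w $ j * C (k0 i j) ?z))\<^sup>2" by simp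
      also have "\<dots> \<le> (norm w) ^ 4 * (\<Sum>i\<in>UNIV. \<Sum>j\<in>UNIV. (C (k0 i j) ?z)\<^sup>2)" by (rule quadratic_form_square_le)
      also have "\<dots> \<le> h ^ 4 * (\<Sum>i\<in>UNIV. \<Sum>j\<in>UNIV. (C (k0 i j) ?z)\<^sup>2)"
        using w by (intro mult_right_mono power_mono sum_nonneg) auto
      finally have "4 * r ^ 6 * (?f'' (r\<^sup>2))\<^sup>2 \<le> 4 * r ^ 6 * (h ^ 4 * (\<Sum>i\<in>UNIV. \<Sum>j\<in>UNIV. (C (k0 i j) ?z)\<^sup>2))"
        by (rule mult_left_mono) simp
      then have "4 * r ^ 6 * (?f'' (r\<^sup>2))\<^sup>2 \<le> (4 * h ^ 4 * r ^ 6) * (\<Sum>i\<in>UNIV. \<Sum>j\<in>UNIV. (C (k0 i j) ?z)\<^sup>2)"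
        by (simp only: mult_ac)
      then have "ennreal (4 * r ^ 6 * (?f'' (r\<^sup>2))\<^sup>2)
         \<le> ennreal (4 * h ^ 4 * r ^ 6) * ennreal (\<Sum>i\<in>UNIV. \<Sum>j\<in>UNIV. (C (k0 i j) ?z)\<^sup>2)"
        using h by (subst ennreal_mult[symmetric]) (auto intro!: sum_nonneg ennreal_leI)
      also have "ennreal (\<Sum>i\<in>UNIV. \<Sum>j\<in>UNIV. (C (k0 i j) ?z)\<^sup>2) = (\<Sum>i\<in>UNIV. \<Sum>j\<in>UNIV. ennreal ((C (k0 i j) ?z)\<^sup>2))"
        by (simp add: sum_ennreal sum_nonneg)
      moreover have "indicator {0..1} r = (1 :: ennreal)" using True by simp
      ultimately show ?thesis by (simp only: mult_1_right)
    qed simp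
  qed
  have "3 * (ennreal ((?f 1)\<^sup>2) + ennreal ((?f' 1)\<^sup>2) + (\<integral>\<^sup>+r\<in>{0..1}. ennreal (4 * r ^ 6 * (?f'' (r\<^sup>2))\<^sup>2) \<partial>lborel))
    \<le> 3 * (ennreal ((?f 1)\<^sup>2) + ennreal (h\<^sup>2) * (\<Sum>i\<in>UNIV. ennreal ((C (g0 i) y)\<^sup>2))
      + (\<integral>\<^sup>+r\<in>{0..1}. ennreal (4 * h ^ 4 * r ^ 6) * (\<Sum>i\<in>UNIV. \<Sum>j\<in>UNIV. ennreal ((C (k0 i j) (x + r\<^sup>2 *\<^sub>R w))\<^sup>2)) \<partial>lborel))"
    by (intro mult_left_mono add_mono 1 2) auto
  note le = order.trans[OF main this]
  have ends: "x + 0 *\<^sub>R w = x" "x + 1 *\<^sub>R w = y" by (simp_all add: w_def)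
  show ?thesis using le unfolding ends w_def[symmetric] .
qed

text \<open>Substitution costs r^(-2d), and for d \<le> 3 and r \<le> 1 the weight r^6 is at most
  r^(2d).\<close>

lemma nn_integral_contract_le:
  fixes H :: "real^'d::finite \<Rightarrow> ennreal"
  assumes [measurable]: "H \<in> borel_measurable borel" and r: "0 < r" "r \<le> 1" and d: "CARD('d) \<le> 3"
  shows "ennreal (r ^ 6) * (\<integral>\<^sup>+y. H (x + r\<^sup>2 *\<^sub>R (y - x)) \<partial>lborel) \<le> (\<integral>\<^sup>+y. H y \<partial>lborel)"
proof -
  have eq: "x + r\<^sup>2 *\<^sub>R (y - x) = (x - r\<^sup>2 *\<^sub>R x) + r\<^sup>2 *\<^sub>R y" for y by (simp add: algebra_simps)
  have "r ^ 6 \<le> r ^ (2 * CARD('d))" using r d by (intro power_decreasing) auto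
  then have "ennreal (r ^ 6) * (\<integral>\<^sup>+y. H (x + r\<^sup>2 *\<^sub>R (y - x)) \<partial>lborel)
      \<le> ennreal (\<bar>r\<^sup>2\<bar> ^ CARD('d)) * (\<integral>\<^sup>+y. H (x + r\<^sup>2 *\<^sub>R (y - x)) \<partial>lborel)"
    by (intro mult_right_mono ennreal_leI) (auto simp: power_mult)
  also have "\<dots> = (\<integral>\<^sup>+y. H y \<partial>lborel)"
    unfolding eq by (rule nn_integral_lborel_affine[symmetric]) (use r in auto)
  finally show ?thesis .
qed

text \<open>The squared Taylor estimate is integrated over \<open>y\<close> with \<open>x\<close>
  held fixed: the left side gains the volume of \<open>T\<close>, and the right side becomes L^2
  norms, which mollification does not increase.\<close>

lemma sobolev_sup_bound:
  fixes u0 :: "real^'d::finite \<Rightarrow> real" and g0 :: "'d \<Rightarrow> real^'d \<Rightarrow> real" and k0 :: "'d \<Rightarrow> 'd \<Rightarrow> real^'d \<Rightarrow> real"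
  assumes d: "CARD('d) \<le> 3" and T: "open T" "convex T" "bounded T"
    and wd: "\<And>i. has_weak_deriv T (unit_mi i) u (g i)" "\<And>i j. has_weak_deriv T (unit2_mi i j) u (k i j)"
    and u: "borel_rep T u u0" and g: "\<And>i. borel_rep T (g i) (g0 i)" and k: "\<And>i j. borel_rep T (k i j) (k0 i j)"
    and i0: "integrable lborel u0" "\<And>i. integrable lborel (g0 i)" "\<And>i j. integrable lborel (k0 i j)"
    and h: "\<And>x y. x \<in> T \<Longrightarrow> y \<in> T \<Longrightarrow> dist x y \<le> h"
  shows "AE x in lborel. x \<in> T \<longrightarrow> emeasure lborel T * ennreal ((u0 x)\<^sup>2) \<le>
     3 * ((\<integral>\<^sup>+x. ennreal ((u0 x)\<^sup>2) \<partial>lborel) + ennreal (h\<^sup>2) * (\<Sum>i\<in>UNIV. \<integral>\<^sup>+x. ennreal ((g0 i x)\<^sup>2) \<partial>lborel)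
      + ennreal (4 * h ^ 4) * (\<Sum>i\<in>UNIV. \<Sum>j\<in>UNIV. \<integral>\<^sup>+x. ennreal ((k0 i j x)\<^sup>2) \<partial>lborel))"
proof (cases "T = {}")
  case False
  then obtain a where "a \<in> T" by blast
  from h[OF this this] have h0: "h \<ge> 0" by simp
  have Tm[measurable]: "T \<in> sets borel" using T(1) by simp
  have [measurable]: "u0 \<in> borel_measurable borel" "g0 i \<in> borel_measurable borel" "k0 i j \<in> borel_measurable borel" for i j
    using u g k by (auto simp: borel_rep_def)
  obtain R where R: "\<And>x. x \<in> T \<Longrightarrow> norm x < R" using T(3) bounded_pos_less by metis
  have z: "u0 x = 0" if "norm x \<ge> R" for x using R[of x] that u by (auto simp: borel_rep_def)
  obtain e F where F: "\<And>n. mollifier (e n) (F n)" and e: "e \<longlonglongrightarrow> 0"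
    and lim: "AE y in lborel. (\<lambda>n. conv u0 (tensor (F n) (\<lambda>_. 0)) y) \<longlonglongrightarrow> u0 y"
    by (rule mollify_AE[OF i0(1) z]) blast+
  define C where "C n v = conv v (tensor (F n) (\<lambda>_. 0))" for n and v :: "real^'d \<Rightarrow> real"
  have Cm[measurable]: "C n u0 \<in> borel_measurable borel" "C n (g0 i) \<in> borel_measurable borel" "C n (k0 i j) \<in> borel_measurable borel" for n i j
    unfolding C_def by (intro borel_measurable_continuous_onI continuous_conv[OF F] i0)+
  define Q where "Q n x = (\<Sum>i\<in>UNIV. \<Sum>j\<in>UNIV. ennreal ((C n (k0 i j) x)\<^sup>2))" for n x
  have [measurable]: "Q n \<in> borel_measurable borel" for n unfolding Q_def by measurable
  define S where "S n = inner_part T (e n)" for n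
  have [measurable]: "S n \<in> sets borel" for n by (simp add: S_def)
  have Sc: "cball x (e n) \<subseteq> T" if "x \<in> S n" for x n
    using that unfolding S_def by (rule inner_part_cball)
  have ST: "x \<in> T" if "x \<in> S n" for x n
    using Sc[OF that] mollifierD(1)[OF F, of n] by (auto simp: subset_iff)
  define B where "B = 3 * ((\<integral>\<^sup>+x. ennreal ((u0 x)\<^sup>2) \<partial>lborel) + ennreal (h\<^sup>2) * (\<Sum>i\<in>UNIV. \<integral>\<^sup>+x. ennreal ((g0 i x)\<^sup>2) \<partial>lborel)
      + ennreal (4 * h ^ 4) * (\<Sum>i\<in>UNIV. \<Sum>j\<in>UNIV. \<integral>\<^sup>+x. ennreal ((k0 i j x)\<^sup>2) \<partial>lborel))"
  have bound: "(\<integral>\<^sup>+y. indicator (S n) y * ennreal ((C n u0 x)\<^sup>2) \<partial>lborel) \<le> B" if x: "x \<in> S n" for n x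
  proof -
    let ?W = "\<lambda>y r. ennreal (4 * h ^ 4 * r ^ 6) * Q n (x + r\<^sup>2 *\<^sub>R (y - x)) * indicator {0..1::real} r"
    have "(\<integral>\<^sup>+y. indicator (S n) y * ennreal ((C n u0 x)\<^sup>2) \<partial>lborel)
       \<le> (\<integral>\<^sup>+y. 3 * (ennreal ((C n u0 y)\<^sup>2) + ennreal (h\<^sup>2) * (\<Sum>i\<in>UNIV. ennreal ((C n (g0 i) y)\<^sup>2))
          + (\<integral>\<^sup>+r. ?W y r \<partial>lborel)) \<partial>lborel)"
    proof (rule nn_integral_mono)
      fix y
      show "indicator (S n) y * ennreal ((C n u0 x)\<^sup>2)
         \<le> 3 * (ennreal ((C n u0 y)\<^sup>2) + ennreal (h\<^sup>2) * (\<Sum>i\<in>UNIV. ennreal ((C n (g0 i) y)\<^sup>2)) + (\<integral>\<^sup>+r. ?W y r \<partial>lborel))"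
      proof (cases "y \<in> S n")
        case True
        have "ennreal ((C n u0 x)\<^sup>2)
         \<le> 3 * (ennreal ((C n u0 y)\<^sup>2) + ennreal (h\<^sup>2) * (\<Sum>i\<in>UNIV. ennreal ((C n (g0 i) y)\<^sup>2)) + (\<integral>\<^sup>+r. ?W y r \<partial>lborel))"
          unfolding C_def Q_def
          by (rule conv_square_le[OF T(1,2) wd u g k i0(1) F Sc[OF x] Sc[OF True] h[OF ST[OF x] ST[OF True]]])
        then show ?thesis using True by simp
      qed simp
    qed
    also have "\<dots> = 3 * ((\<integral>\<^sup>+y. ennreal ((C n u0 y)\<^sup>2) \<partial>lborel) + ennreal (h\<^sup>2) * (\<Sum>i\<in>UNIV. \<integral>\<^sup>+y. ennreal ((C n (g0 i) y)\<^sup>2) \<partial>lborel)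
          + (\<integral>\<^sup>+y. (\<integral>\<^sup>+r. ?W y r \<partial>lborel) \<partial>lborel))"
      by (simp add: nn_integral_cmult nn_integral_add nn_integral_sum del: sum_ennreal)
    also have "(\<integral>\<^sup>+y. (\<integral>\<^sup>+r. ?W y r \<partial>lborel) \<partial>lborel) \<le> ennreal (4 * h ^ 4) * (\<integral>\<^sup>+y. Q n y \<partial>lborel)"
    proof -
      have "(\<integral>\<^sup>+y. (\<integral>\<^sup>+r. ?W y r \<partial>lborel) \<partial>lborel) = (\<integral>\<^sup>+r. (\<integral>\<^sup>+y. ?W y r \<partial>lborel) \<partial>lborel)"
        by (rule lborel_pair.Fubini') measurable
      also have "\<dots> \<le> (\<integral>\<^sup>+r. ennreal (4 * h ^ 4) * (\<integral>\<^sup>+y. Q n y \<partial>lborel) * indicator {0..1::real} r \<partial>lborel)"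
      proof (rule nn_integral_mono)
        fix r :: real
        show "(\<integral>\<^sup>+y. ?W y r \<partial>lborel) \<le> ennreal (4 * h ^ 4) * (\<integral>\<^sup>+y. Q n y \<partial>lborel) * indicator {0..1::real} r"
        proof (cases "0 < r \<and> r \<le> 1")
          case True
          have "(\<integral>\<^sup>+y. ?W y r \<partial>lborel) = (\<integral>\<^sup>+y. ennreal (4 * h ^ 4 * r ^ 6) * Q n (x + r\<^sup>2 *\<^sub>R (y - x)) \<partial>lborel)"
            using True by simp
          also have "\<dots> = ennreal (4 * h ^ 4 * r ^ 6) * (\<integral>\<^sup>+y. Q n (x + r\<^sup>2 *\<^sub>R (y - x)) \<partial>lborel)"
            by (rule nn_integral_cmult) simp
          also have "\<dots> = ennreal (4 * h ^ 4) * (ennreal (r ^ 6) * (\<integral>\<^sup>+y. Q n (x + r\<^sup>2 *\<^sub>R (y - x)) \<partial>lborel))"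
            using h0 by (simp add: ennreal_mult mult.assoc)
          also have "\<dots> \<le> ennreal (4 * h ^ 4) * (\<integral>\<^sup>+y. Q n y \<partial>lborel)"
            using True d by (intro mult_left_mono nn_integral_contract_le) auto
          finally show ?thesis using True by simp
        next
          \<comment> \<open>At r = 0 the contraction collapses to the point \<open>x\<close> and
            admits no substitution, but the weight r^6 vanishes; outside the unit interval the
            indicator does.\<close>
          case False
          then have "(\<lambda>y. ?W y r) = (\<lambda>y. 0)" by (intro ext) (cases "r = 0"; auto)
          then show ?thesis by (simp only:) simp
        qed
      qed
      also have "\<dots> = ennreal (4 * h ^ 4) * (\<integral>\<^sup>+y. Q n y \<partial>lborel)"
        by (subst nn_integral_cmult_indicator) auto
      finally show ?thesis .
    qed
    also have "(\<integral>\<^sup>+y. Q n y \<partial>lborel) = (\<Sum>i\<in>UNIV. \<Sum>j\<in>UNIV. \<integral>\<^sup>+y. ennreal ((C n (k0 i j) y)\<^sup>2) \<partial>lborel)"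
      unfolding Q_def by (simp add: nn_integral_sum del: sum_ennreal)
    also have "3 * ((\<integral>\<^sup>+y. ennreal ((C n u0 y)\<^sup>2) \<partial>lborel) + ennreal (h\<^sup>2) * (\<Sum>i\<in>UNIV. \<integral>\<^sup>+y. ennreal ((C n (g0 i) y)\<^sup>2) \<partial>lborel)
          + ennreal (4 * h ^ 4) * (\<Sum>i\<in>UNIV. \<Sum>j\<in>UNIV. \<integral>\<^sup>+y. ennreal ((C n (k0 i j) y)\<^sup>2) \<partial>lborel)) \<le> B"
      unfolding B_def C_def by (intro mult_left_mono add_mono sum_mono conv_L2_bound[OF F]) auto
    finally show ?thesis by (simp add: mult_left_mono add_left_mono)
  qed
  show ?thesis
    unfolding B_def[symmetric] using lim
  proof eventually_elim
    case (elim x)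
    show ?case
    proof
      assume x: "x \<in> T"
      have "emeasure lborel T * ennreal ((u0 x)\<^sup>2) = (\<integral>\<^sup>+y. indicator T y * ennreal ((u0 x)\<^sup>2) \<partial>lborel)"
        by (subst nn_integral_multc) auto
      \<comment> \<open>Only \<open>y\<close> is integrated, so Fatou's lemma is needed once, for
        each \<open>x\<close> at which the mollifications converge.\<close>
      also have "\<dots> \<le> (\<integral>\<^sup>+y. liminf (\<lambda>n. indicator (S n) y * ennreal ((C n u0 x)\<^sup>2)) \<partial>lborel)"
      proof (rule nn_integral_mono)
        fix y
        show "indicator T y * ennreal ((u0 x)\<^sup>2) \<le> liminf (\<lambda>n. indicator (S n) y * ennreal ((C n u0 x)\<^sup>2))"
        proof (cases "y \<in> T")
          case True
          have "(\<lambda>n. ennreal ((C n u0 x)\<^sup>2)) \<longlonglongrightarrow> ennreal ((u0 x)\<^sup>2)"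
            unfolding C_def by (intro tendsto_intros elim)
          moreover have "\<forall>\<^sub>F n in sequentially. ennreal ((C n u0 x)\<^sup>2) = indicator (S n) y * ennreal ((C n u0 x)\<^sup>2)"
            using inner_part_eventually[OF T(1,3) True e] unfolding S_def by eventually_elim simp
          ultimately have "(\<lambda>n. indicator (S n) y * ennreal ((C n u0 x)\<^sup>2)) \<longlonglongrightarrow> ennreal ((u0 x)\<^sup>2)"
            by (rule Lim_transform_eventually)
          then have "liminf (\<lambda>n. indicator (S n) y * ennreal ((C n u0 x)\<^sup>2)) = ennreal ((u0 x)\<^sup>2)"
            by (rule lim_imp_Liminf[OF sequentially_bot])
          then show ?thesis using True by simp
        qed simp
      qed
      also have "\<dots> \<le> liminf (\<lambda>n. \<integral>\<^sup>+y. indicator (S n) y * ennreal ((C n u0 x)\<^sup>2) \<partial>lborel)"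
        by (rule nn_integral_liminf) measurable
      also have "\<dots> \<le> B"
      proof -
        have "\<forall>\<^sub>F n in sequentially. (\<integral>\<^sup>+y. indicator (S n) y * ennreal ((C n u0 x)\<^sup>2) \<partial>lborel) \<le> B"
          using inner_part_eventually[OF T(1,3) x e] by eventually_elim (rule bound, simp add: S_def)
        from Liminf_mono[OF this] show ?thesis by (simp add: Liminf_const)
      qed
      finally show "emeasure lborel T * ennreal ((u0 x)\<^sup>2) \<le> B" .
    qed
  qed
qed simp

section \<open>Polynomials: moments and inverse estimates\<close>

text \<open>Back substitution by order: an equation of top order contains only its diagonal unknown.
  Inserting these values changes the right-hand sides of lower order, hence the generalisation over
  \<open>m\<close>.\<close>

lemma triangular_system:
  fixes A :: "('d::finite \<Rightarrow> nat) \<Rightarrow> ('d \<Rightarrow> nat) \<Rightarrow> real"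
  assumes diag: "\<And>\<alpha>. A \<alpha> \<alpha> \<noteq> 0"
    and off: "\<And>\<alpha> \<beta>. mi_order \<alpha> \<le> mi_order \<beta> \<Longrightarrow> \<alpha> \<noteq> \<beta> \<Longrightarrow> A \<alpha> \<beta> = 0"
  shows "\<exists>c. \<forall>\<beta>. mi_order \<beta> \<le> k \<longrightarrow> (\<Sum>\<alpha> | mi_order \<alpha> \<le> k. c \<alpha> * A \<alpha> \<beta>) = m \<beta>"
proof (induction k arbitrary: m)
  case 0
  have "mi_order \<alpha> \<le> 0 \<longleftrightarrow> \<alpha> = (\<lambda>_. 0)" for \<alpha> :: "'d \<Rightarrow> nat"
    by (auto simp: mi_order_def fun_eq_iff)
  then show ?case using diag by (intro exI[of _ "\<lambda>\<alpha>. m \<alpha> / A \<alpha> \<alpha>"]) auto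
next
  case (Suc k)
  let ?E = "{\<alpha>::'d \<Rightarrow> nat. mi_order \<alpha> = Suc k}" and ?L = "{\<alpha>::'d \<Rightarrow> nat. mi_order \<alpha> \<le> k}"
  define a where "a \<alpha> = m \<alpha> / A \<alpha> \<alpha>" for \<alpha>
  obtain c where c: "\<And>\<beta>. mi_order \<beta> \<le> k \<Longrightarrow>
      (\<Sum>\<alpha>\<in>?L. c \<alpha> * A \<alpha> \<beta>) = m \<beta> - (\<Sum>\<alpha>\<in>?E. a \<alpha> * A \<alpha> \<beta>)"
    using Suc.IH[of "\<lambda>\<beta>. m \<beta> - (\<Sum>\<alpha>\<in>?E. a \<alpha> * A \<alpha> \<beta>)"] by blast
  define c' where "c' \<alpha> = (if mi_order \<alpha> = Suc k then a \<alpha> else c \<alpha>)" for \<alpha>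
  have U: "{\<alpha>::'d \<Rightarrow> nat. mi_order \<alpha> \<le> Suc k} = ?L \<union> ?E" by auto
  have split: "(\<Sum>\<alpha> | mi_order \<alpha> \<le> Suc k. c' \<alpha> * A \<alpha> \<beta>)
     = (\<Sum>\<alpha>\<in>?L. c \<alpha> * A \<alpha> \<beta>) + (\<Sum>\<alpha>\<in>?E. a \<alpha> * A \<alpha> \<beta>)" for \<beta>
  proof -
    have "(\<Sum>\<alpha> | mi_order \<alpha> \<le> Suc k. c' \<alpha> * A \<alpha> \<beta>) = (\<Sum>\<alpha>\<in>?L. c' \<alpha> * A \<alpha> \<beta>) + (\<Sum>\<alpha>\<in>?E. c' \<alpha> * A \<alpha> \<beta>)"
      unfolding U by (rule sum.union_disjoint) (auto simp: finite_mi_le finite_mi_eq)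
    also have "(\<Sum>\<alpha>\<in>?L. c' \<alpha> * A \<alpha> \<beta>) = (\<Sum>\<alpha>\<in>?L. c \<alpha> * A \<alpha> \<beta>)"
      by (intro sum.cong) (auto simp: c'_def)
    also have "(\<Sum>\<alpha>\<in>?E. c' \<alpha> * A \<alpha> \<beta>) = (\<Sum>\<alpha>\<in>?E. a \<alpha> * A \<alpha> \<beta>)"
      by (intro sum.cong) (auto simp: c'_def)
    finally show ?thesis .
  qed
  have "(\<Sum>\<alpha> | mi_order \<alpha> \<le> Suc k. c' \<alpha> * A \<alpha> \<beta>) = m \<beta>" if \<beta>: "mi_order \<beta> \<le> Suc k" for \<beta>
  proof (cases "mi_order \<beta> = Suc k")
    case False
    then show ?thesis using c[of \<beta>] \<beta> by (simp add: split)
  next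
    case True
    have "(\<Sum>\<alpha>\<in>?L. c \<alpha> * A \<alpha> \<beta>) = 0"
      using True by (intro sum.neutral ballI) (auto intro!: off)
    moreover have "(\<Sum>\<alpha>\<in>?E. a \<alpha> * A \<alpha> \<beta>) = (\<Sum>\<alpha>\<in>?E. if \<alpha> = \<beta> then m \<beta> else 0)"
      using True diag off by (intro sum.cong) (auto simp: a_def)
    moreover have "\<dots> = m \<beta>" using True by (simp add: finite_mi_eq)
    ultimately show ?thesis by (simp add: split)
  qed
  then show ?case by blast
qed

text \<open>The constant is the product of the factorials of the \<open>\<alpha> i\<close>.\<close>

lemma dmono_diag_pos: "dmono \<alpha> \<alpha> x = dmono \<alpha> \<alpha> 0" "dmono \<alpha> \<alpha> x > 0"
  by (auto simp: dmono_def tensor_def intro!: prod_pos)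

text \<open>Distinct multi-indices with this order relation must have a component with
  \<open>\<alpha> i < \<beta> i\<close>, and differentiating a power more often than its exponent
  gives 0.\<close>

lemma dmono_eq_0:
  assumes "mi_order \<alpha> \<le> mi_order \<beta>" "\<alpha> \<noteq> \<beta>"
  shows "dmono \<alpha> \<beta> x = 0"
proof -
  have "\<exists>i. \<alpha> i < \<beta> i"
  proof (rule ccontr)
    assume "\<nexists>i. \<alpha> i < \<beta> i"
    then have le: "\<beta> i \<le> \<alpha> i" for i by (simp add: not_less)
    obtain i where "\<alpha> i \<noteq> \<beta> i" using assms(2) by auto
    with le[of i] have "\<beta> i < \<alpha> i" by simp
    then have "(\<Sum>i\<in>UNIV. \<beta> i) < (\<Sum>i\<in>UNIV. \<alpha> i)" using le by (intro sum_strict_mono_ex1) auto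
    with assms(1) show False by (simp add: mi_order_def)
  qed
  then obtain i where i: "\<alpha> i < \<beta> i" by blast
  then have "(\<Prod>m<\<beta> i. \<alpha> i - m) = 0" by (auto intro!: bexI[of _ "\<alpha> i"])
  then show ?thesis unfolding dmono_def tensor_def by (intro prod_zero) (auto intro!: exI[of _ i])
qed

text \<open>One coefficient family \<open>c\<close> stands for a polynomial together with all its
  derivatives; the zero multi-index gives the polynomial itself.\<close>

definition dpoly :: "nat \<Rightarrow> (('d::finite \<Rightarrow> nat) \<Rightarrow> real) \<Rightarrow> ('d \<Rightarrow> nat) \<Rightarrow> real^'d \<Rightarrow> real" where
  "dpoly k c \<beta> x = (\<Sum>\<alpha> | mi_order \<alpha> \<le> k. c \<alpha> * dmono \<alpha> \<beta> x)"

lemma continuous_dpoly: "continuous_on S (dpoly k c \<beta>)"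
  unfolding dpoly_def[abs_def] by (intro continuous_intros continuous_dmono)

lemma dpoly_order_gt: "k < mi_order \<beta> \<Longrightarrow> dpoly k c \<beta> x = 0"
  unfolding dpoly_def by (intro sum.neutral ballI) (auto intro!: dmono_eq_0)

lemma dpoly_line_derivative:
  "((\<lambda>t. dpoly k c \<beta> (x + t *\<^sub>R axis i 1)) has_real_derivative
     dpoly k c (\<beta>(i := Suc (\<beta> i))) (x + t *\<^sub>R axis i 1)) (at t)"
proof -
  have "((\<lambda>t. dmono \<alpha> \<beta> (x + t *\<^sub>R axis i 1)) has_real_derivative
     dmono \<alpha> (\<beta>(i := Suc (\<beta> i))) (x + t *\<^sub>R axis i 1)) (at t)" for \<alpha>
  proof -
    have "((\<lambda>t. x + t *\<^sub>R axis i 1) has_derivative (\<lambda>s. s *\<^sub>R axis i 1)) (at t)"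
      by (auto intro!: derivative_eq_intros)
    from has_derivative_compose[OF this dmono_has_derivative]
    have "((\<lambda>t. dmono \<alpha> \<beta> (x + t *\<^sub>R axis i 1)) has_derivative
       (\<lambda>s. \<Sum>j\<in>UNIV. (s *\<^sub>R axis i 1) $ j * dmono \<alpha> (\<beta>(j := Suc (\<beta> j))) (x + t *\<^sub>R axis i 1))) (at t)" .
    moreover have "(\<Sum>j\<in>UNIV. (s *\<^sub>R axis i 1) $ j * dmono \<alpha> (\<beta>(j := Suc (\<beta> j))) y)
        = dmono \<alpha> (\<beta>(i := Suc (\<beta> i))) y * s" for s y
      by (simp add: mult.assoc sum_axis_mult flip: sum_distrib_left) 
    ultimately show ?thesis by (simp add: has_field_derivative_def)
  qed
  then show ?thesis unfolding dpoly_def by (intro DERIV_sum DERIV_cmult)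
qed

lemma dpoly_on_line:
  fixes x w :: "real^'d::finite"
  obtains p where "degree p \<le> k" "\<And>t. dpoly k c \<beta> (x + t *\<^sub>R w) = poly p t"
proof -
  define q where "q \<alpha> = (\<Prod>i\<in>UNIV. smult (real (\<Prod>m<\<beta> i. \<alpha> i - m)) ([:x $ i, w $ i:] ^ (\<alpha> i - \<beta> i)))" for \<alpha>
  define p where "p = (\<Sum>\<alpha> | mi_order \<alpha> \<le> k. smult (c \<alpha>) (q \<alpha>))"
  have "degree (q \<alpha>) \<le> k" if "mi_order \<alpha> \<le> k" for \<alpha>
  proof -
    have "degree (q \<alpha>) \<le> (\<Sum>i\<in>UNIV. \<alpha> i)"
      unfolding q_def
    proof (rule order.trans[OF degree_prod_sum_le sum_mono])
      fix i
      have "degree (smult (real (\<Prod>m<\<beta> i. \<alpha> i - m)) ([:x $ i, w $ i:] ^ (\<alpha> i - \<beta> i))) \<le> degree ([:x $ i, w $ i:] ^ (\<alpha> i - \<beta> i))"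
        by (rule degree_smult_le)
      also have "\<dots> \<le> degree [:x $ i, w $ i:] * (\<alpha> i - \<beta> i)" by (rule degree_power_le)
      also have "\<dots> \<le> 1 * (\<alpha> i - \<beta> i)" by (intro mult_right_mono) auto
      also have "\<dots> \<le> \<alpha> i" by simp
      finally show "(degree \<circ> (\<lambda>i. smult (real (\<Prod>m<\<beta> i. \<alpha> i - m)) ([:x $ i, w $ i:] ^ (\<alpha> i - \<beta> i)))) i \<le> \<alpha> i" by simp
    qed auto
    with that show ?thesis by (simp add: mi_order_def)
  qed
  then have "degree p \<le> k" unfolding p_def
    by (intro degree_sum_le finite_mi_le order.trans[OF degree_smult_le]) auto
  moreover have "poly (q \<alpha>) t = dmono \<alpha> \<beta> (x + t *\<^sub>R w)" for \<alpha> t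
    by (simp add: q_def poly_prod dmono_def tensor_def)
  then have "dpoly k c \<beta> (x + t *\<^sub>R w) = poly p t" for t by (simp add: dpoly_def p_def poly_sum)
  ultimately show ?thesis by (rule that)
qed

section \<open>Inverse estimates\<close>

lemma poly_eq_sum_coeff: "degree p \<le> n \<Longrightarrow> poly p t = (\<Sum>j\<le>n. coeff p j * t ^ j)" for p :: "real poly"
  unfolding poly_altdef by (intro sum.mono_neutral_left) (auto simp: coeff_eq_0)

text \<open>Passing to \<open>p(t) - 2\<^sup>k p(t/2)\<close> removes the leading coefficient.\<close>

lemma poly_coeff_bound:
  "\<exists>C\<ge>0. \<forall>p::real poly. \<forall>M. degree p \<le> k \<longrightarrow> (\<forall>t. \<bar>t\<bar> \<le> 1 \<longrightarrow> \<bar>poly p t\<bar> \<le> M) \<longrightarrow> (\<forall>j. \<bar>coeff p j\<bar> \<le> C * M)"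
proof (induction k)
  case 0
  have "\<bar>coeff p j\<bar> \<le> 1 * M" if "degree p \<le> 0" "\<forall>t. \<bar>t\<bar> \<le> 1 \<longrightarrow> \<bar>poly p t\<bar> \<le> M" for p :: "real poly" and M j
  proof -
    have p0: "\<bar>coeff p 0\<bar> \<le> M" using that(2)[rule_format, of 0] by (simp add: poly_0_coeff_0)
    then have "M \<ge> 0" using abs_ge_zero order_trans by blast
    with p0 show ?thesis using that(1) by (cases j) (auto simp: coeff_eq_0)
  qed
  then show ?case by (intro exI[of _ 1]) auto
next
  case (Suc k)
  then obtain C where C: "C \<ge> 0" "\<And>(p::real poly) M j. degree p \<le> k \<Longrightarrow> (\<forall>t. \<bar>t\<bar> \<le> 1 \<longrightarrow> \<bar>poly p t\<bar> \<le> M) \<Longrightarrow> \<bar>coeff p j\<bar> \<le> C * M"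
    by blast
  define D where "D = C * (1 + 2 ^ Suc k)"
  have D: "D \<ge> 0" using C(1) by (simp add: D_def)
  have low: "\<bar>coeff p j\<bar> \<le> D * M"
    if p: "degree p \<le> Suc k" and M: "\<forall>t. \<bar>t\<bar> \<le> 1 \<longrightarrow> \<bar>poly p t\<bar> \<le> M" and j: "j \<le> k" for p M j
  proof -
    \<comment> \<open>The coefficient of degree i is multiplied by 1 - 2^(k+1-i). This is 0 for i =
      k+1 and at least 1 in absolute value for i \<le> k, so lower coefficients of \<open>p\<close>
      are controlled by those of \<open>q\<close>.\<close>
    define q where "q = p - smult (2 ^ Suc k) (pcompose p [:0, 1/2:])"
    have cq: "coeff q i = (1 - 2 ^ Suc k * (1/2) ^ i) * coeff p i" for i
      by (simp add: q_def coeff_pcompose_linear algebra_simps)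
    have "coeff q i = 0" if "i > k" for i
    proof (cases "i = Suc k")
      case True
      then show ?thesis unfolding cq by (simp add: power_one_over)
    next
      case False
      then show ?thesis unfolding cq using that p by (simp add: coeff_eq_0)
    qed
    then have dq: "degree q \<le> k" by (intro degree_le) auto
    have "\<bar>poly q t\<bar> \<le> (1 + 2 ^ Suc k) * M" if "\<bar>t\<bar> \<le> 1" for t
    proof -
      have "poly q t = poly p t - 2 ^ Suc k * poly p (t / 2)" by (simp add: q_def poly_pcompose)
      also have "\<bar>\<dots>\<bar> \<le> \<bar>poly p t\<bar> + 2 ^ Suc k * \<bar>poly p (t / 2)\<bar>" by (simp add: abs_mult abs_triangle_ineq4[THEN order.trans])
      also have "\<dots> \<le> M + 2 ^ Suc k * M" using M that by (intro add_mono mult_left_mono) auto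
      finally show ?thesis by (simp add: algebra_simps)
    qed
    with C(2)[OF dq] have "\<bar>coeff q j\<bar> \<le> C * ((1 + 2 ^ Suc k) * M)" by blast
    moreover have "\<bar>coeff p j\<bar> \<le> \<bar>coeff q j\<bar>"
    proof -
      have "2 * 1 \<le> 2 ^ Suc k * (1/2 :: real) ^ j"
      proof -
        have "2 ^ Suc k * (1/2 :: real) ^ j = 2 * 2 ^ (k - j)"
          using j by (simp add: power_one_over power_diff)
        moreover have "(1::real) \<le> 2 ^ (k - j)" by (rule one_le_power) simp
        ultimately show ?thesis by linarith
      qed
      then have "1 \<le> \<bar>1 - 2 ^ Suc k * (1/2 :: real) ^ j\<bar>" by linarith
      then show ?thesis unfolding cq abs_mult by (simp add: mult_le_cancel_right1)
    qed
    ultimately show ?thesis by (simp add: D_def mult_ac)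
  qed
  have "\<bar>coeff p j\<bar> \<le> (1 + (D + real (Suc k) * D)) * M"
    if p: "degree p \<le> Suc k" and M: "\<forall>t. \<bar>t\<bar> \<le> 1 \<longrightarrow> \<bar>poly p t\<bar> \<le> M" for p M j
  proof -
    have M0: "M \<ge> 0" using M[rule_format, of 0] by auto
    have DM: "D * M \<ge> 0" "real (Suc k) * D * M \<ge> 0" using D M0 by auto
    consider "j \<le> k" | "j = Suc k" | "j > Suc k" by linarith
    then show ?thesis
    proof cases
      case 1
      then show ?thesis using low[OF p M 1] M0 DM by (simp add: algebra_simps)
    next
      case 2
      \<comment> \<open>The leading coefficient is recovered from the value at 1 once the lower ones
        are bounded.\<close>
      have "poly p 1 = (\<Sum>i\<le>Suc k. coeff p i * 1 ^ i)"
        by (rule poly_eq_sum_coeff[OF p])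
      then have "coeff p (Suc k) = poly p 1 - (\<Sum>i\<le>k. coeff p i)" by simp
      also have "\<bar>\<dots>\<bar> \<le> \<bar>poly p 1\<bar> + (\<Sum>i\<le>k. \<bar>coeff p i\<bar>)"
        by (rule order.trans[OF abs_triangle_ineq4 add_left_mono[OF sum_abs]])
      also have "\<dots> \<le> M + (\<Sum>i\<le>k. D * M)"
        using M low[OF p M] by (intro add_mono sum_mono) auto
      finally show ?thesis using 2 DM by (simp add: algebra_simps)
    next
      case 3
      then show ?thesis using p M0 D by (simp add: coeff_eq_0)
    qed
  qed
  then show ?case using D by (intro exI[of _ "1 + (D + real (Suc k) * D)"]) auto
qed

text \<open>On lines everything reduces to coefficients of one-variable polynomials. Rays from
  \<open>a\<close> carry the bound from the ball to a larger one; the partial derivative at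
  \<open>x\<close> is then a linear coefficient along the axis through \<open>x\<close>.\<close>

lemma inverse_estimate:
  fixes k :: nat and R :: real
  assumes R: "R \<ge> 1"
  shows "\<exists>C>0. \<forall>c \<beta> a r M x i. r > 0 \<longrightarrow> (\<forall>y\<in>ball (a::real^'d::finite) r. \<bar>dpoly k c \<beta> y\<bar> \<le> M) \<longrightarrow>
     x \<in> cball a (R * r) \<longrightarrow> \<bar>dpoly k c (\<beta>(i := Suc (\<beta> i))) x\<bar> \<le> C * M / r"
proof -
  obtain C where C: "C \<ge> 0" "\<And>p::real poly. \<And>M j. degree p \<le> k \<Longrightarrow> (\<And>t. \<bar>t\<bar> \<le> 1 \<Longrightarrow> \<bar>poly p t\<bar> \<le> M) \<Longrightarrow> \<bar>coeff p j\<bar> \<le> C * M"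
    using poly_coeff_bound[of k] by blast
  define L where "L = real (Suc k) * C * (2 * (R + 1)) ^ k"
  have "\<bar>dpoly k c (\<beta>(i := Suc (\<beta> i))) x\<bar> \<le> (C * L + 1) * M / r"
    if r: "r > 0" and M: "\<forall>y\<in>ball (a::real^'d) r. \<bar>dpoly k c \<beta> y\<bar> \<le> M" and x: "x \<in> cball a (R * r)"
    for c \<beta> a r M x i
  proof -
    have M0: "M \<ge> 0" using M[rule_format, of a] r by auto
    \<comment> \<open>The radius exceeds R r by r to leave room for a step of length
      \<open>r\<close> from \<open>x\<close>.\<close>
    have ext: "\<bar>dpoly k c \<beta> y\<bar> \<le> L * M" if y: "dist a y \<le> (R + 1) * r" for y
    proof -
      define n where "n = norm (y - a)"
      have n: "0 \<le> n" "n \<le> (R + 1) * r" using y by (auto simp: n_def dist_norm norm_minus_commute)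
      \<comment> \<open>Length r/2 keeps the points \<open>a + s w\<close> with
        \<open>\<bar>s\<bar> \<le> 1\<close> inside the open ball. For \<open>y = a\<close> the
        division by zero makes \<open>w\<close> and \<open>t\<close> zero, which is the right
        value.\<close>
      define w where "w = (r / 2) *\<^sub>R ((y - a) /\<^sub>R n)"
      define t where "t = 2 * n / r"
      have nw: "norm w \<le> r / 2" using r by (cases "y = a") (simp_all add: w_def n_def)
      have tw: "a + t *\<^sub>R w = y" using r by (cases "n = 0") (auto simp: t_def w_def n_def)
      have t: "0 \<le> t" "t \<le> 2 * (R + 1)" using n r by (auto simp: t_def field_simps)
      obtain p where p: "degree p \<le> k" "\<And>t. dpoly k c \<beta> (a + t *\<^sub>R w) = poly p t"
        using dpoly_on_line[of k c \<beta> a w] by blast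
      have "\<bar>poly p s\<bar> \<le> M" if "\<bar>s\<bar> \<le> 1" for s
      proof -
        have "norm (s *\<^sub>R w) \<le> 1 * (r / 2)" unfolding norm_scaleR using that nw by (intro mult_mono) auto
        then have "a + s *\<^sub>R w \<in> ball a r" using r by (simp add: dist_norm)
        then show ?thesis using M by (simp flip: p(2))
      qed
      then have cf: "\<bar>coeff p j\<bar> \<le> C * M" for j by (rule C(2)[OF p(1)])
      have "\<bar>poly p t\<bar> \<le> (\<Sum>j\<le>k. \<bar>coeff p j * t ^ j\<bar>)"
        unfolding poly_eq_sum_coeff[OF p(1)] by (rule sum_abs)
      also have "\<dots> \<le> (\<Sum>j\<le>k. C * M * (2 * (R + 1)) ^ k)"
      proof (rule sum_mono)
        fix j assume j: "j \<in> {..k}"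
        have "t ^ j \<le> (2 * (R + 1)) ^ j" using t by (intro power_mono) auto
        also have "\<dots> \<le> (2 * (R + 1)) ^ k" using j R by (intro power_increasing) auto
        finally show "\<bar>coeff p j * t ^ j\<bar> \<le> C * M * (2 * (R + 1)) ^ k"
          unfolding abs_mult using cf[of j] t(1) C(1) M0 by (intro mult_mono) auto
      qed
      also have "\<dots> = L * M" by (simp add: L_def)
      finally show ?thesis using p(2)[of t] tw by simp
    qed
    obtain p where p: "degree p \<le> k" "\<And>t. dpoly k c \<beta> (x + t *\<^sub>R (r *\<^sub>R axis i 1)) = poly p t"
      using dpoly_on_line[of k c \<beta> x "r *\<^sub>R axis i 1"] by blast
    have "\<bar>poly p s\<bar> \<le> L * M" if "\<bar>s\<bar> \<le> 1" for s
    proof -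
      have "norm (s *\<^sub>R (r *\<^sub>R axis i 1 :: real^'d)) \<le> 1 * r" unfolding norm_scaleR using that r by (intro mult_mono) auto
      moreover have "dist a (x + s *\<^sub>R (r *\<^sub>R axis i 1)) \<le> dist a x + norm (s *\<^sub>R (r *\<^sub>R axis i 1 :: real^'d))"
        using dist_triangle[of a "x + s *\<^sub>R (r *\<^sub>R axis i 1)" x] by (simp add: dist_norm)
      ultimately have "dist a (x + s *\<^sub>R (r *\<^sub>R axis i 1)) \<le> (R + 1) * r" using x by (simp add: algebra_simps)
      from ext[OF this] show ?thesis by (simp flip: p(2))
    qed
    from C(2)[OF p(1) this] have c1: "\<bar>coeff p 1\<bar> \<le> C * (L * M)" .
    \<comment> \<open>With the line scaled by \<open>r\<close>, the linear coefficient is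
      \<open>r\<close> times the partial derivative; this gives the division by \<open>r\<close> in
      the estimate.\<close>
    have "((\<lambda>t. dpoly k c \<beta> (x + (t * r) *\<^sub>R axis i 1)) has_real_derivative
        dpoly k c (\<beta>(i := Suc (\<beta> i))) (x + (0 * r) *\<^sub>R axis i 1) * r) (at 0)"
      by (rule DERIV_chain'[where f="\<lambda>t. t * r" and g="\<lambda>s. dpoly k c \<beta> (x + s *\<^sub>R axis i 1)"])
        (auto intro!: derivative_eq_intros simp: dpoly_line_derivative[of k c \<beta> x i 0, simplified])
    moreover have "(\<lambda>t. dpoly k c \<beta> (x + (t * r) *\<^sub>R axis i 1)) = poly p" using p(2) by auto
    ultimately have "(poly p has_real_derivative dpoly k c (\<beta>(i := Suc (\<beta> i))) x * r) (at 0)" by simp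
    from DERIV_unique[OF this poly_DERIV]
    have "dpoly k c (\<beta>(i := Suc (\<beta> i))) x * r = coeff p 1"
      by (simp add: poly_0_coeff_0 coeff_pderiv)
    then have "\<bar>dpoly k c (\<beta>(i := Suc (\<beta> i))) x\<bar> * r \<le> C * (L * M)" using c1 r by (simp add: abs_mult)
    also have "\<dots> \<le> (C * L + 1) * M" using M0 by (simp add: algebra_simps)
    finally show ?thesis using r by (simp add: field_simps)
  qed
  moreover have "C * L + 1 > 0" using C(1) R by (simp add: L_def add_nonneg_pos)
  ultimately show ?thesis by blast
qed

section \<open>Comparable covering simplices\<close>

lemma barycentric_coordinates:
  fixes A :: "(real^'d::finite) set"
  assumes A: "finite A" "\<not> affine_dependent A" "affine hull A = UNIV"
  obtains l :: "real^'d \<Rightarrow> real^'d \<Rightarrow> real" where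
    "\<And>x. sum (l x) A = 1" "\<And>x. (\<Sum>v\<in>A. l x v *\<^sub>R v) = x"
    "\<And>x u. sum u A = 1 \<Longrightarrow> (\<Sum>v\<in>A. u v *\<^sub>R v) = x \<Longrightarrow> (\<forall>v\<in>A. u v = l x v)"
proof -
  have "\<exists>u. sum u A = 1 \<and> (\<Sum>v\<in>A. u v *\<^sub>R v) = x" for x
    using A(3) unfolding affine_hull_finite[OF A(1)] by blast
  then obtain l where l: "\<And>x. sum (l x) A = 1" "\<And>x. (\<Sum>v\<in>A. l x v *\<^sub>R v) = x" by metis
  have "\<forall>v\<in>A. u v = l x v" if u: "sum u A = 1" "(\<Sum>v\<in>A. u v *\<^sub>R v) = x" for x u
  proof (rule ccontr)
    assume "\<not> (\<forall>v\<in>A. u v = l x v)"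
    then have "\<exists>v\<in>A. u v - l x v \<noteq> 0" by auto
    moreover have "(\<Sum>v\<in>A. u v - l x v) = 0" using u l by (simp add: sum_subtractf)
    moreover have "(\<Sum>v\<in>A. (u v - l x v) *\<^sub>R v) = 0" using u l by (simp add: sum_subtractf scaleR_diff_left)
    ultimately have "affine_dependent A" unfolding affine_dependent_explicit_finite[OF A(1)]
      by (intro exI[of _ "\<lambda>v. u v - l x v"]) auto
    with A(2) show False by simp
  qed
  with l show ?thesis by (rule that)
qed

lemma affinity_interior:
  fixes S :: "(real^'d::finite) set"
  assumes "s \<noteq> 0"
  shows "interior ((\<lambda>x. a + s *\<^sub>R x) ` S) = (\<lambda>x. a + s *\<^sub>R x) ` interior S"
proof
  show "(\<lambda>x. a + s *\<^sub>R x) ` interior S \<subseteq> interior ((\<lambda>x. a + s *\<^sub>R x) ` S)"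
    by (intro interior_maximal image_mono interior_subset open_affinity open_interior assms)
  let ?g = "\<lambda>x. (- (1/s) *\<^sub>R a) + (1/s) *\<^sub>R x"
  have g: "?g (a + s *\<^sub>R x) = x" "a + s *\<^sub>R ?g x = x" for x using assms by (simp_all add: algebra_simps)
  have "?g ` interior ((\<lambda>x. a + s *\<^sub>R x) ` S) \<subseteq> interior S"
  proof (intro interior_maximal open_affinity open_interior)
    have "?g ` interior ((\<lambda>x. a + s *\<^sub>R x) ` S) \<subseteq> ?g ` ((\<lambda>x. a + s *\<^sub>R x) ` S)"
      by (intro image_mono interior_subset)
    also have "\<dots> = S" by (simp only: image_image g image_ident)
    finally show "?g ` interior ((\<lambda>x. a + s *\<^sub>R x) ` S) \<subseteq> S" .
  qed (use assms in auto)
  then show "interior ((\<lambda>x. a + s *\<^sub>R x) ` S) \<subseteq> (\<lambda>x. a + s *\<^sub>R x) ` interior S"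
    using g(2) by (metis (no_types, lifting) image_eqI image_subset_iff subsetI)
qed

lemma simplex_affinity:
  fixes S :: "(real^'d::finite) set"
  assumes "n simplex S" "s \<noteq> 0" "n \<ge> 0"
  shows "n simplex ((\<lambda>x. a + s *\<^sub>R x) ` S)"
proof -
  obtain C where C: "\<not> affine_dependent C" "int (card C) = n + 1" "S = convex hull C"
    using assms(1) by (auto simp: simplex_def)
  have fin: "finite C" using C(2) assms(3) by (metis add_nonneg_pos card.infinite less_irrefl of_nat_0 zero_less_one)
  let ?f = "\<lambda>x. a + s *\<^sub>R x"
  have inj: "inj_on ?f X" for X using assms(2) by (auto simp: inj_on_def)
  have "\<not> affine_dependent (?f ` C)"
  proof
    assume "affine_dependent (?f ` C)"
    then obtain U v where U: "sum U (?f ` C) = 0" "v \<in> ?f ` C" "U v \<noteq> 0" "(\<Sum>v\<in>?f ` C. U v *\<^sub>R v) = 0"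
      using fin by (auto simp: affine_dependent_explicit_finite)
    define W where "W x = U (?f x)" for x
    have 0: "sum W C = 0" using U(1) by (simp add: sum.reindex[OF inj] W_def o_def)
    have "0 = (\<Sum>x\<in>C. W x *\<^sub>R (a + s *\<^sub>R x))" using U(4) by (simp add: sum.reindex[OF inj] W_def o_def)
    also have "\<dots> = (\<Sum>x\<in>C. W x *\<^sub>R a) + (\<Sum>x\<in>C. s *\<^sub>R (W x *\<^sub>R x))"
      by (simp add: scaleR_add_right sum.distrib mult.commute)
    also have "\<dots> = s *\<^sub>R (\<Sum>x\<in>C. W x *\<^sub>R x)"
      by (simp only: scaleR_left.sum[symmetric] scaleR_right.sum[symmetric] 0) simp
    finally have "(\<Sum>x\<in>C. W x *\<^sub>R x) = 0" using assms(2) by simp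
    moreover obtain x where "x \<in> C" "v = ?f x" using U(2) by auto
    then have "\<exists>x\<in>C. W x \<noteq> 0" using U(3) by (auto simp: W_def)
    ultimately have "affine_dependent C" using 0 fin by (auto simp: affine_dependent_explicit_finite)
    with C(1) show False by simp
  qed
  moreover have "card (?f ` C) = card C" by (rule card_image[OF inj])
  moreover have "?f ` S = convex hull (?f ` C)" unfolding C(3) by (rule convex_hull_affinity[symmetric])
  ultimately show ?thesis using C(2) unfolding simplex_def by metis
qed

text \<open>
  The witness is the homothetic copy \<open>{x. \<forall>v. l x v > m v}\<close> of \<open>T\<close>, where \<open>m v\<close> is the infimum over \<open>K\<close> of
  the barycentric coordinate at the vertex \<open>v\<close>.
\<close>

lemma covering_simplex_comparable:
  fixes T K :: "(real^'d::finite) set"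
  assumes T: "open_simplex T" "shape_regular \<sigma> T" and K: "open K" "K \<noteq> {}" "K \<subseteq> T"
  obtains T' where "open_simplex T'" "shape_regular \<sigma> T'" "K \<subseteq> T'" "T' \<subseteq> T"
    "diameter T' \<le> 2 * (real CARD('d) + 1) * \<bar>\<sigma>\<bar> * diameter K"
proof -
  obtain S where S: "int CARD('d) simplex S" "T = interior S" using T(1) by (auto simp: open_simplex_def)
  obtain A where A: "\<not> affine_dependent A" "int (card A) = int CARD('d) + 1" "S = convex hull A"
    using S(1) by (auto simp: simplex_def)
  have finA: "finite A" using A(2) by (metis add_nonneg_pos card.infinite less_irrefl of_nat_0 zero_less_one of_nat_0_le_iff)
  obtain c r where c: "r > 0" "ball c r \<subseteq> T" "diameter T \<le> \<sigma> * r" using T(2) by (auto simp: shape_regular_def)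
  have TS: "T \<subseteq> S" using S(2) interior_subset by auto
  have "interior S \<noteq> {}" using K S(2) by auto
  then have "affine hull S = UNIV" by (rule affine_hull_nonempty_interior)
  then have hull: "affine hull A = UNIV" by (simp add: A(3))
  obtain l where l: "\<And>x. sum (l x) A = 1" "\<And>x. (\<Sum>v\<in>A. l x v *\<^sub>R v) = x"
    "\<And>x u. sum u A = 1 \<Longrightarrow> (\<Sum>v\<in>A. u v *\<^sub>R v) = x \<Longrightarrow> (\<forall>v\<in>A. u v = l x v)"
    using barycentric_coordinates[OF finA A(1) hull] by blast
  have lpos: "l x v \<ge> 0" if "x \<in> S" "v \<in> A" for x v
  proof -
    obtain u where "\<forall>v\<in>A. 0 \<le> u v" "sum u A = 1" "(\<Sum>v\<in>A. u v *\<^sub>R v) = x"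
      using \<open>x \<in> S\<close> unfolding A(3) convex_hull_finite[OF finA] by blast
    with l(3)[of u x] that(2) show ?thesis by metis
  qed
  have lle: "l x v \<le> 1" if "x \<in> S" "v \<in> A" for x v
    using member_le_sum[of v A "l x"] lpos[OF that(1)] that(2) finA l(1)[of x] by auto
  have laff: "l ((1 - t) *\<^sub>R x + t *\<^sub>R y) v = (1 - t) * l x v + t * l y v" if "v \<in> A" for x y t v
  proof -
    have "\<forall>v\<in>A. (1 - t) * l x v + t * l y v = l ((1 - t) *\<^sub>R x + t *\<^sub>R y) v"
    proof (rule l(3))
      show "(\<Sum>v\<in>A. (1 - t) * l x v + t * l y v) = 1"
        by (simp add: sum.distrib sum_distrib_left[symmetric] l(1))
      have "(\<Sum>v\<in>A. ((1 - t) * l x v + t * l y v) *\<^sub>R v) = (1 - t) *\<^sub>R (\<Sum>v\<in>A. l x v *\<^sub>R v) + t *\<^sub>R (\<Sum>v\<in>A. l y v *\<^sub>R v)"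
        by (simp add: scaleR_add_left sum.distrib scaleR_right.sum)
      then show "(\<Sum>v\<in>A. ((1 - t) * l x v + t * l y v) *\<^sub>R v) = (1 - t) *\<^sub>R x + t *\<^sub>R y" by (simp only: l(2))
    qed
    then show ?thesis using that by simp
  qed
  \<comment> \<open>A barycentric coordinate is affine with values in \<open>[0, 1]\<close> on the
    inscribed ball, so a displacement of length r/2 from the centre changes it by at most 1.
    Affinity spreads this slope to all points.\<close>
  have llip: "l x v - l y v \<le> 2 / r * dist x y" if v: "v \<in> A" for x y v
  proof (cases "x = y")
    case False
    define n where "n = dist x y"
    have n: "n > 0" using False by (simp add: n_def)
    define t where "t = r / (2 * n)"
    have t: "t > 0" using n c(1) by (simp add: t_def)
    define z where "z = c + t *\<^sub>R (x - y)"
    have "dist c z = r / 2" using n c(1) by (simp add: z_def dist_norm t_def n_def)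
    then have "z \<in> ball c r" "c \<in> ball c r" using c(1) by auto
    then have zc: "z \<in> S" "c \<in> S" using c(2) TS by blast+
    \<comment> \<open>both sides are the affine image of the point \<open>(c + t x)/(1 + t) = (z + t y)/(1 + t)\<close>\<close>
    define s where "s = t / (1 + t)"
    have s1: "1 - s = 1 / (1 + t)" using t by (simp add: s_def field_simps)
    have "(1 - s) *\<^sub>R c + s *\<^sub>R x = (1 - s) *\<^sub>R z + s *\<^sub>R y"
      unfolding z_def s1 by (simp add: s_def algebra_simps)
    then have "(1 - s) * l c v + s * l x v = (1 - s) * l z v + s * l y v"
      using laff[OF v, of s c x] laff[OF v, of s z y] by simp
    then have "(1 + t) * ((1 - s) * l c v + s * l x v) = (1 + t) * ((1 - s) * l z v + s * l y v)" by (simp only:)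
    moreover have "(1 + t) * (1 - s) = 1" "(1 + t) * s = t" using t by (simp_all add: s_def field_simps)
    ultimately have "l c v + t * l x v = l z v + t * l y v"
      by (simp only: distrib_left mult.assoc[symmetric] mult_1_left)
    moreover have "l z v \<le> 1" "l c v \<ge> 0" using lle[OF zc(1) v] lpos[OF zc(2) v] by auto
    ultimately have "t * (l x v - l y v) \<le> 1" by (simp add: algebra_simps)
    then have "l x v - l y v \<le> 1 / t" using t by (simp add: field_simps)
    then show ?thesis by (simp add: t_def n_def)
  qed simp
  have bS: "bounded S" using A(3) finA by (simp add: finite_imp_bounded bounded_convex_hull)
  have bK: "bounded K" using bS K(3) TS bounded_subset by blast
  obtain x0 where x0: "x0 \<in> K" using K(2) by blast
  have KS: "x \<in> S" if "x \<in> K" for x using that K(3) TS by blast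
  define m where "m v = Inf ((\<lambda>x. l x v) ` K)" for v
  have bb: "bdd_below ((\<lambda>x. l x v) ` K)" if "v \<in> A" for v
    using lpos[OF KS that] by (intro bdd_belowI2[of _ 0]) auto
  have m0: "m v \<ge> 0" if "v \<in> A" for v
    unfolding m_def using x0 lpos[OF KS that] by (intro cInf_greatest) auto
  have ml: "m v \<le> l x v" if "v \<in> A" "x \<in> K" for v x
    unfolding m_def using that by (intro cInf_lower bb) auto
  have lm: "l x v - 2 / r * diameter K \<le> m v" if v: "v \<in> A" and x: "x \<in> K" for v x
    unfolding m_def
  proof (rule cInf_greatest)
    fix w assume "w \<in> (\<lambda>x. l x v) ` K"
    then obtain y where y: "y \<in> K" "w = l y v" by auto
    have "l x v - l y v \<le> 2 / r * dist x y" by (rule llip[OF v])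
    also have "\<dots> \<le> 2 / r * diameter K" using c(1) diameter_bounded_bound[OF bK x y(1)] by (intro mult_left_mono) auto
    finally show "l x v - 2 / r * diameter K \<le> w" using y by simp
  qed (use x0 in auto)
  \<comment> \<open>The excesses \<open>l x v - m v\<close> of a point of \<open>K\<close> add up to
    \<open>s\<close>; divided by \<open>s\<close> they are barycentric coordinates again, so
    \<open>s\<close> is the ratio of the homothety onto the smaller simplex.\<close>
  define s where "s = 1 - sum m A"
  have s_eq: "s = (\<Sum>v\<in>A. l x v - m v)" for x by (simp add: s_def sum_subtractf l(1))
  have s_le: "s \<le> (real CARD('d) + 1) * (2 / r * diameter K)"
  proof -
    have "s \<le> (\<Sum>v\<in>A. 2 / r * diameter K)" unfolding s_eq[of x0] using lm[OF _ x0] by (intro sum_mono) (simp add: algebra_simps)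
    also have "\<dots> = real (card A) * (2 / r * diameter K)" by simp
    also have "real (card A) = real CARD('d) + 1" using A(2) by (metis of_int_of_nat_eq of_int_add of_int_1)
    finally show ?thesis .
  qed
  have s_pos: "s > 0"
  proof -
    have "s \<ge> 0" unfolding s_eq[of x0] using ml x0 by (intro sum_nonneg) auto
    moreover have "s \<noteq> 0"
    proof
      \<comment> \<open>All excesses would vanish and \<open>K\<close> would be a single point,
        contradicting openness.\<close>
      assume "s = 0"
      have "x = (\<Sum>v\<in>A. m v *\<^sub>R v)" if x: "x \<in> K" for x
      proof -
        have "\<forall>v\<in>A. l x v - m v = 0"
          using \<open>s = 0\<close> s_eq[of x] sum_nonneg_eq_0_iff[OF finA, of "\<lambda>v. l x v - m v"] ml[OF _ x] by simp
        then have "(\<Sum>v\<in>A. l x v *\<^sub>R v) = (\<Sum>v\<in>A. m v *\<^sub>R v)" by (intro sum.cong) auto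
        then show ?thesis by (simp only: l(2))
      qed
      then have "K \<subseteq> {\<Sum>v\<in>A. m v *\<^sub>R v}" by blast
      then have "finite K" by (rule finite_subset) simp
      then show False using K(1,2) finite_imp_not_open by blast
    qed
    ultimately show ?thesis by simp
  qed
  \<comment> \<open>\<open>p\<close> is the fixed point of the homothety. For \<open>s = 1\<close>
    all \<open>m v\<close> are 0, the map is the identity and any point of \<open>S\<close>
    serves.\<close>
  obtain p where p: "p \<in> S" "(1 - s) *\<^sub>R p = (\<Sum>v\<in>A. m v *\<^sub>R v)"
  proof (cases "s = 1")
    case True
    then have "sum m A = 0" by (simp add: s_def)
    then have "\<forall>v\<in>A. m v = 0" using sum_nonneg_eq_0_iff[OF finA, of m] m0 by simp
    then have "(\<Sum>v\<in>A. m v *\<^sub>R v) = 0" by simp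
    with True that[of x0] KS[OF x0] show ?thesis by simp
  next
    case False
    define p where "p = (\<Sum>v\<in>A. (m v / (1 - s)) *\<^sub>R v)"
    have "1 - s = sum m A" by (simp add: s_def)
    moreover have "sum m A \<ge> 0" using m0 by (intro sum_nonneg) auto
    ultimately have s1: "1 - s > 0" using False by simp
    have "p \<in> S" unfolding A(3) convex_hull_finite[OF finA] p_def
    proof (intro CollectI exI[of _ "\<lambda>v. m v / (1 - s)"] conjI ballI)
      show "(\<Sum>v\<in>A. m v / (1 - s)) = 1" using s1 \<open>1 - s = sum m A\<close> by (simp add: sum_divide_distrib[symmetric])
    qed (use m0 s1 in auto)
    moreover have "(1 - s) *\<^sub>R p = (\<Sum>v\<in>A. m v *\<^sub>R v)"
      using s1 by (simp add: p_def scaleR_right.sum)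
    ultimately show ?thesis by (rule that)
  qed
  define f where "f = (\<lambda>x. (1 - s) *\<^sub>R p + s *\<^sub>R x)"
  define T' where "T' = f ` T"
  have T': "T' = interior (f ` S)" unfolding T'_def f_def S(2) using s_pos by (intro affinity_interior[symmetric]) simp
  have s1: "s \<le> 1" using m0 by (simp add: s_def sum_nonneg)
  have cS: "convex S" by (simp add: A(3))
  have fS: "f ` S \<subseteq> S"
  proof
    fix y assume "y \<in> f ` S"
    then obtain x where "x \<in> S" "y = f x" by auto
    then show "y \<in> S" unfolding f_def using p(1) s1 s_pos by (auto intro!: convexD[OF cS])
  qed
  show ?thesis
  proof (rule that[of T'])
    show "open_simplex T'"
      unfolding open_simplex_def T' f_def using simplex_affinity[OF S(1), of s] s_pos by auto
    have fd: "dist (f x) (f y) = s * dist x y" for x y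
      using s_pos by (simp add: f_def dist_norm flip: scaleR_diff_right)
    have bT: "bounded T" using bS TS bounded_subset by blast
    have diamT': "diameter T' \<le> s * diameter T"
    proof (rule diameter_le)
      show "T' \<noteq> {} \<or> 0 \<le> s * diameter T" using K by (auto simp: T'_def)
      fix x y assume "x \<in> T'" "y \<in> T'"
      then obtain a b where ab: "a \<in> T" "b \<in> T" "x = f a" "y = f b" by (auto simp: T'_def)
      have "norm (x - y) = s * dist a b" using fd ab by (simp flip: dist_norm)
      also have "\<dots> \<le> s * diameter T" using diameter_bounded_bound[OF bT ab(1,2)] s_pos by (intro mult_left_mono) auto
      finally show "norm (x - y) \<le> s * diameter T" .
    qed
    show "shape_regular \<sigma> T'"
      unfolding shape_regular_def
    proof (intro exI conjI)
      show "s * r > 0" using s_pos c(1) by simp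
      show "ball (f c) (s * r) \<subseteq> T'"
      proof
        fix y assume y: "y \<in> ball (f c) (s * r)"
        define x where "x = (1 / s) *\<^sub>R (y - (1 - s) *\<^sub>R p)"
        have yx: "y = f x" using s_pos by (simp add: f_def x_def)
        then have "x \<in> ball c r" using y s_pos by (simp add: fd)
        then show "y \<in> T'" using c(2) yx by (auto simp: T'_def)
      qed
      have "s * diameter T \<le> s * (\<sigma> * r)" using c(3) s_pos by (intro mult_left_mono) auto
      then show "diameter T' \<le> \<sigma> * (s * r)" using diamT' by (simp add: mult_ac)
    qed
    have "K \<subseteq> f ` S"
    proof
      fix x assume x: "x \<in> K"
      define y where "y = (\<Sum>v\<in>A. ((l x v - m v) / s) *\<^sub>R v)"
      have "y \<in> S" unfolding A(3) convex_hull_finite[OF finA] y_def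
      proof (intro CollectI exI[of _ "\<lambda>v. (l x v - m v) / s"] conjI ballI)
        show "(\<Sum>v\<in>A. (l x v - m v) / s) = 1" using s_pos s_eq[of x] by (simp add: sum_divide_distrib[symmetric])
      qed (use ml[OF _ x] s_pos in auto)
      moreover have "f y = x"
      proof -
        have "s *\<^sub>R y = (\<Sum>v\<in>A. (l x v - m v) *\<^sub>R v)" using s_pos by (simp add: y_def scaleR_right.sum)
        then show ?thesis unfolding f_def p(2) by (simp add: scaleR_diff_left sum_subtractf l(2))
      qed
      ultimately show "x \<in> f ` S" by (metis image_eqI)
    qed
    then show "K \<subseteq> T'" unfolding T' using K(1) by (rule interior_maximal)
    show "T' \<subseteq> T" unfolding T' S(2) by (rule interior_mono[OF fS])
    have "diameter T' \<le> s * (\<sigma> * r)" using diamT' c(3) s_pos by (meson mult_left_mono less_imp_le order_trans)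
    also have "\<dots> \<le> s * (\<bar>\<sigma>\<bar> * r)" using s_pos c(1) by (intro mult_left_mono mult_right_mono) auto
    \<comment> \<open>The inradius cancels: the Lipschitz constant contributes 2/r and the shape
      regularity contributes \<open>r\<close>.\<close>
    also have "\<dots> \<le> ((real CARD('d) + 1) * (2 / r * diameter K)) * (\<bar>\<sigma>\<bar> * r)"
      using s_le c(1) by (intro mult_right_mono) auto
    also have "\<dots> = 2 * (real CARD('d) + 1) * \<bar>\<sigma>\<bar> * diameter K" using c(1) by simp
    finally show "diameter T' \<le> 2 * (real CARD('d) + 1) * \<bar>\<sigma>\<bar> * diameter K" .
  qed
qed

section \<open>Estimates for Sobolev functions\<close>

abbreviation nsq :: "(real^'d::finite) set \<Rightarrow> (real^'d \<Rightarrow> real) \<Rightarrow> real" where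
  "nsq U u \<equiv> (LINT x|lebesgue_on U. (u x)\<^sup>2)"

lemma abs_powr_two: "\<bar>x\<bar> powr 2 = (x::real)\<^sup>2"
  by (cases "x = 0") (auto simp: powr_numeral)

lemma in_Lp_two: "in_Lp 2 U u \<longleftrightarrow> u \<in> borel_measurable (lebesgue_on U) \<and> integrable (lebesgue_on U) (\<lambda>x. (u x)\<^sup>2)"
  unfolding in_Lp_def abs_powr_two ..

lemma nsq_nonneg: "nsq U u \<ge> 0" by simp

lemma in_Lp_two_diff:
  assumes "in_Lp 2 U f" "in_Lp 2 U g"
  shows "in_Lp 2 U (\<lambda>x. f x - g x)"
  unfolding in_Lp_two
proof
  show m: "(\<lambda>x. f x - g x) \<in> borel_measurable (lebesgue_on U)" using assms by (auto simp: in_Lp_two)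
  have "integrable (lebesgue_on U) (\<lambda>x. 2 * (f x)\<^sup>2 + 2 * (g x)\<^sup>2)" using assms by (auto simp: in_Lp_two)
  then show "integrable (lebesgue_on U) (\<lambda>x. (f x - g x)\<^sup>2)"
  proof (rule Bochner_Integration.integrable_bound)
    show "(\<lambda>x. (f x - g x)\<^sup>2) \<in> borel_measurable (lebesgue_on U)" using m by simp
    have "norm ((f x - g x)\<^sup>2) \<le> norm (2 * (f x)\<^sup>2 + 2 * (g x)\<^sup>2)" for x
    proof -
      have "(f x - g x)\<^sup>2 \<le> 2 * (f x)\<^sup>2 + 2 * (g x)\<^sup>2"
        using zero_le_power2[of "f x + g x"] by (simp add: power2_diff power2_sum)
      then show ?thesis by simp
    qed
    then show "AE x in lebesgue_on U. norm ((f x - g x)\<^sup>2) \<le> norm (2 * (f x)\<^sup>2 + 2 * (g x)\<^sup>2)" by simp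
  qed
qed

lemma in_Lp_two_bounded:
  assumes "open U" "bounded U" "f \<in> borel_measurable (lebesgue_on U)" "\<And>x. x \<in> U \<Longrightarrow> \<bar>f x\<bar> \<le> B"
  shows "in_Lp 2 U f"
  unfolding in_Lp_two
proof
  have "U \<in> lmeasurable" using assms(1,2) by (simp add: lmeasurable_open)
  then have fm: "finite_measure (lebesgue_on U)" by (simp add: finite_measure_lebesgue_on)
  show "integrable (lebesgue_on U) (\<lambda>x. (f x)\<^sup>2)"
  proof (rule finite_measure.integrable_const_bound[OF fm, of _ "B\<^sup>2"])
    show "AE x in lebesgue_on U. norm ((f x)\<^sup>2) \<le> B\<^sup>2"
      using assms(4) by (intro AE_I2) (force simp: power2_le_iff_abs_le intro: order_trans[OF abs_ge_zero] simp flip: abs_le_square_iff)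
  qed (use assms(3) in simp)
qed (rule assms(3))

text \<open>Mollification works with integrable functions; on a bounded set 2 |t| \<le> 1 + t^2
  supplies integrability from square integrability.\<close>

lemma L2_rep:
  fixes u :: "real^'d::finite \<Rightarrow> real"
  assumes T: "open T" "bounded T" and u: "in_Lp 2 T u"
  obtains u0 where "borel_rep T u u0" "integrable lborel u0" "integrable lborel (\<lambda>x. (u0 x)\<^sup>2)"
    "(\<integral>\<^sup>+x. ennreal ((u0 x)\<^sup>2) \<partial>lborel) = ennreal (nsq T u)"
proof -
  obtain u0 where r: "borel_rep T u u0" using borel_rep_exists[OF T(1)] u by (auto simp: in_Lp_two)
  have [measurable]: "u0 \<in> borel_measurable borel" "T \<in> sets borel" using r T by (auto simp: borel_rep_def)
  have eq: "(\<integral>\<^sup>+x. ennreal ((u0 x)\<^sup>2) \<partial>lborel) = ennreal (nsq T u)"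
    using borel_rep_nn_integral[OF T(1) r, of "\<lambda>t. ennreal (t\<^sup>2)"] u
    by (simp add: in_Lp_two nn_integral_eq_integral)
  have i2: "integrable lborel (\<lambda>x. (u0 x)\<^sup>2)"
    by (rule integrableI_bounded) (use eq in auto)
  have "integrable lborel (\<lambda>x. indicator T x + (u0 x)\<^sup>2 :: real)"
    using emeasure_bounded_finite[OF T(2)] i2 by (intro Bochner_Integration.integrable_add integrable_real_indicator) auto
  then have i1: "integrable lborel u0"
  proof (rule Bochner_Integration.integrable_bound)
    have "\<bar>u0 x\<bar> \<le> indicator T x + (u0 x)\<^sup>2" for x
    proof (cases "x \<in> T")
      case True
      have "0 \<le> (\<bar>u0 x\<bar> - 1)\<^sup>2" by simp
      then have "2 * \<bar>u0 x\<bar> \<le> 1 + (u0 x)\<^sup>2" by (simp add: power2_diff)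
      then show ?thesis using True by (simp add: indicator_def)
    qed (use r in \<open>auto simp: borel_rep_def\<close>)
    then show "AE x in lborel. norm (u0 x) \<le> norm (indicator T x + (u0 x)\<^sup>2 :: real)"
      by (intro AE_I2) (simp add: abs_of_nonneg)
  qed simp
  show ?thesis by (rule that[OF r i1 i2 eq])
qed

lemma measure_open_pos:
  fixes T :: "(real^'d::finite) set"
  assumes "open T" "bounded T" "T \<noteq> {}"
  shows "measure lborel T > 0" "measure lebesgue T = measure lborel T"
proof -
  obtain a e where "e > 0" "ball a e \<subseteq> T" using assms(1,3) openE by blast
  have Tm: "T \<in> sets lborel" using assms(1) by simp
  have "T \<in> fmeasurable lborel" using emeasure_bounded_finite[OF assms(2)] Tm by (simp add: fmeasurable_def)
  then have "measure lborel (ball a e) \<le> measure lborel T"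
    by (rule measure_mono_fmeasurable[OF \<open>ball a e \<subseteq> T\<close>, rotated]) simp
  then show "measure lborel T > 0" using content_ball_pos[OF \<open>e > 0\<close>, of a] by linarith
  show "measure lebesgue T = measure lborel T" by (rule measure_completion[OF Tm])
qed

text \<open>When the mean is zero, the cross term disappears on integrating
  \<open>(u x - u y)\<^sup>2\<close> over \<open>y\<close>, so the integral is at least the volume
  times \<open>(u x)\<^sup>2\<close>. The volume then cancels from the double integral
  inequality.\<close>

lemma poincare_mean_zero:
  fixes u :: "real^'d::finite \<Rightarrow> real"
  assumes T: "open T" "convex T" "bounded T" "T \<noteq> {}"
    and u: "in_Lp 2 T u" and g: "\<And>i. in_Lp 2 T (g i)" and wd: "\<And>i. has_weak_deriv T (unit_mi i) u (g i)"
    and mean: "(LINT x|lebesgue_on T. u x) = 0"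
    and h: "\<And>x y. x \<in> T \<Longrightarrow> y \<in> T \<Longrightarrow> dist x y \<le> h"
  shows "nsq T u \<le> 2 ^ CARD('d) * h\<^sup>2 * (\<Sum>i\<in>UNIV. nsq T (g i))"
proof -
  obtain u0 where u0: "borel_rep T u u0" "integrable lborel u0" "integrable lborel (\<lambda>x. (u0 x)\<^sup>2)"
    "(\<integral>\<^sup>+x. ennreal ((u0 x)\<^sup>2) \<partial>lborel) = ennreal (nsq T u)" using L2_rep[OF T(1,3) u] by blast
  have "\<exists>g0. borel_rep T (g i) g0 \<and> integrable lborel g0 \<and> (\<integral>\<^sup>+x. ennreal ((g0 x)\<^sup>2) \<partial>lborel) = ennreal (nsq T (g i))" for i
    using L2_rep[OF T(1,3) g[of i]] by metis
  then obtain g0 where g0: "\<And>i. borel_rep T (g i) (g0 i)" "\<And>i. integrable lborel (g0 i)"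
    "\<And>i. (\<integral>\<^sup>+x. ennreal ((g0 i x)\<^sup>2) \<partial>lborel) = ennreal (nsq T (g i))" by metis
  have [measurable]: "T \<in> sets borel" "u0 \<in> borel_measurable borel" using T(1) u0(1) by (auto simp: borel_rep_def)
  have z: "u0 x = 0" if "x \<notin> T" for x using u0(1) that by (simp add: borel_rep_def)
  define V where "V = measure lborel T"
  have Vf: "emeasure lborel T = ennreal V"
    using emeasure_bounded_finite[OF T(3)] by (simp add: V_def emeasure_eq_ennreal_measure)
  have V: "V > 0" unfolding V_def by (rule measure_open_pos(1)[OF T(1,3,4)])
  have int0: "(LINT x|lborel. u0 x) = 0"
    using borel_rep_integral[OF T(1) u0(1), of "\<lambda>_. 1"] mean by simp
  have lower: "ennreal V * ennreal ((u0 x)\<^sup>2) \<le> (\<integral>\<^sup>+y. indicator T x * indicator T y * ennreal ((u0 x - u0 y)\<^sup>2) \<partial>lborel)" for x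
  proof (cases "x \<in> T")
    case True
    let ?a = "u0 x"
    have iT: "integrable lborel (\<lambda>y. ?a\<^sup>2 * indicator T y)"
      using emeasure_bounded_finite[OF T(3)] by (intro integrable_mult_right integrable_real_indicator) auto
    have i: "integrable lborel (\<lambda>y. ?a\<^sup>2 * indicator T y - 2 * ?a * u0 y + (u0 y)\<^sup>2)"
      using iT u0(2,3) by simp
    have pt: "?a\<^sup>2 * indicator T y - 2 * ?a * u0 y + (u0 y)\<^sup>2 = indicator T y * (?a - u0 y)\<^sup>2" for y
      using z[of y] by (cases "y \<in> T") (auto simp: power2_diff)
    have "V * ?a\<^sup>2 \<le> V * ?a\<^sup>2 + (LINT y|lborel. (u0 y)\<^sup>2)" by simp
    also have "\<dots> = (LINT y|lborel. ?a\<^sup>2 * indicator T y - 2 * ?a * u0 y + (u0 y)\<^sup>2)"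
      using iT u0(2,3) int0 by (simp add: V_def)
    finally have "ennreal (V * ?a\<^sup>2) \<le> ennreal (LINT y|lborel. ?a\<^sup>2 * indicator T y - 2 * ?a * u0 y + (u0 y)\<^sup>2)"
      by (rule ennreal_leI)
    also have "\<dots> = (\<integral>\<^sup>+y. ennreal (?a\<^sup>2 * indicator T y - 2 * ?a * u0 y + (u0 y)\<^sup>2) \<partial>lborel)"
      by (rule nn_integral_eq_integral[symmetric, OF i]) (simp add: pt)
    also have "\<dots> = (\<integral>\<^sup>+y. indicator T x * indicator T y * ennreal ((u0 x - u0 y)\<^sup>2) \<partial>lborel)"
      unfolding pt using True by (intro nn_integral_cong) (auto simp: indicator_def)
    finally show ?thesis using V by (simp add: ennreal_mult)
  qed (simp add: z)
  have "ennreal (V * nsq T u) = (\<integral>\<^sup>+x. ennreal V * ennreal ((u0 x)\<^sup>2) \<partial>lborel)"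
    using u0(4) V by (simp add: nn_integral_cmult ennreal_mult)
  also have "\<dots> \<le> (\<integral>\<^sup>+x. (\<integral>\<^sup>+y. indicator T x * indicator T y * ennreal ((u0 x - u0 y)\<^sup>2) \<partial>lborel) \<partial>lborel)"
    by (intro nn_integral_mono lower)
  also have "\<dots> \<le> ennreal (2 ^ CARD('d) * h\<^sup>2) * emeasure lborel T * (\<Sum>i\<in>UNIV. \<integral>\<^sup>+x. ennreal ((g0 i x)\<^sup>2) \<partial>lborel)"
    by (rule poincare_double_integral[OF T(1-3) wd u0(1) g0(1) u0(2) g0(2) h])
  also have "\<dots> = ennreal (V * (2 ^ CARD('d) * h\<^sup>2 * (\<Sum>i\<in>UNIV. nsq T (g i))))"
    unfolding g0(3) Vf using V by (simp add: ennreal_mult[symmetric] sum_nonneg mult_ac)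
  finally have "V * nsq T u \<le> V * (2 ^ CARD('d) * h\<^sup>2 * (\<Sum>i\<in>UNIV. nsq T (g i)))"
    using V by (subst (asm) ennreal_le_iff) (auto intro!: mult_nonneg_nonneg sum_nonneg)
  then show ?thesis using V by simp
qed

lemma sobolev_sup_bound_real:
  fixes u :: "real^'d::finite \<Rightarrow> real"
  assumes d: "CARD('d) \<le> 3" and T: "open T" "convex T" "bounded T"
    and u: "in_Lp 2 T u" and g: "\<And>i. in_Lp 2 T (g i)" and k: "\<And>i j. in_Lp 2 T (k i j)"
    and wd: "\<And>i. has_weak_deriv T (unit_mi i) u (g i)" "\<And>i j. has_weak_deriv T (unit2_mi i j) u (k i j)"
    and h: "\<And>x y. x \<in> T \<Longrightarrow> y \<in> T \<Longrightarrow> dist x y \<le> h"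
  shows "AE x in lborel. x \<in> T \<longrightarrow> measure lborel T * (u x)\<^sup>2 \<le>
     3 * (nsq T u + h\<^sup>2 * (\<Sum>i\<in>UNIV. nsq T (g i)) + 4 * h ^ 4 * (\<Sum>i\<in>UNIV. \<Sum>j\<in>UNIV. nsq T (k i j)))"
proof -
  obtain u0 where u0: "borel_rep T u u0" "integrable lborel u0"
    "(\<integral>\<^sup>+x. ennreal ((u0 x)\<^sup>2) \<partial>lborel) = ennreal (nsq T u)" using L2_rep[OF T(1,3) u] by blast
  have "\<exists>g0. borel_rep T (g i) g0 \<and> integrable lborel g0 \<and> (\<integral>\<^sup>+x. ennreal ((g0 x)\<^sup>2) \<partial>lborel) = ennreal (nsq T (g i))" for i
    using L2_rep[OF T(1,3) g[of i]] by metis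
  then obtain g0 where g0: "\<And>i. borel_rep T (g i) (g0 i)" "\<And>i. integrable lborel (g0 i)"
    "\<And>i. (\<integral>\<^sup>+x. ennreal ((g0 i x)\<^sup>2) \<partial>lborel) = ennreal (nsq T (g i))" by metis
  have "\<exists>k0. borel_rep T (k i j) k0 \<and> integrable lborel k0 \<and> (\<integral>\<^sup>+x. ennreal ((k0 x)\<^sup>2) \<partial>lborel) = ennreal (nsq T (k i j))" for i j
    using L2_rep[OF T(1,3) k[of i j]] by metis
  then obtain k0 where k0: "\<And>i j. borel_rep T (k i j) (k0 i j)" "\<And>i j. integrable lborel (k0 i j)"
    "\<And>i j. (\<integral>\<^sup>+x. ennreal ((k0 i j x)\<^sup>2) \<partial>lborel) = ennreal (nsq T (k i j))" by metis
  have Vf: "emeasure lborel T = ennreal (measure lborel T)"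
    using emeasure_bounded_finite[OF T(3)] by (simp add: emeasure_eq_ennreal_measure)
  let ?B = "3 * (nsq T u + h\<^sup>2 * (\<Sum>i\<in>UNIV. nsq T (g i)) + 4 * h ^ 4 * (\<Sum>i\<in>UNIV. \<Sum>j\<in>UNIV. nsq T (k i j)))"
  have h4: "0 \<le> h ^ 4" by simp
  have pos: "0 \<le> (\<Sum>i\<in>UNIV. nsq T (g i))" "0 \<le> (\<Sum>i\<in>UNIV. \<Sum>j\<in>UNIV. nsq T (k i j))"
    by (auto intro!: sum_nonneg)
  have B: "3 * (ennreal (nsq T u) + ennreal (h\<^sup>2) * (\<Sum>i\<in>UNIV. ennreal (nsq T (g i)))
      + ennreal (4 * h ^ 4) * (\<Sum>i\<in>UNIV. \<Sum>j\<in>UNIV. ennreal (nsq T (k i j)))) = ennreal ?B"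
  proof -
    have "(\<Sum>i\<in>UNIV. ennreal (nsq T (g i))) = ennreal (\<Sum>i\<in>UNIV. nsq T (g i))"
      "(\<Sum>i\<in>UNIV. \<Sum>j\<in>UNIV. ennreal (nsq T (k i j))) = ennreal (\<Sum>i\<in>UNIV. \<Sum>j\<in>UNIV. nsq T (k i j))"
      by (simp_all add: sum_nonneg)
    moreover have "ennreal ?B = ennreal 3 * (ennreal (nsq T u) + ennreal (h\<^sup>2) * ennreal (\<Sum>i\<in>UNIV. nsq T (g i))
      + ennreal (4 * h ^ 4) * ennreal (\<Sum>i\<in>UNIV. \<Sum>j\<in>UNIV. nsq T (k i j)))"
      using pos h4 nsq_nonneg[of T u] by (simp only: ennreal_mult[symmetric] ennreal_plus[symmetric] add_nonneg_nonneg mult_nonneg_nonneg zero_le_power2 zero_le_numeral)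
    ultimately show ?thesis by simp
  qed
  have Bnn: "?B \<ge> 0" using pos h4 by simp
  have "AE x in lborel. x \<in> T \<longrightarrow> emeasure lborel T * ennreal ((u0 x)\<^sup>2) \<le> ennreal ?B"
    using sobolev_sup_bound[OF d T wd u0(1) g0(1) k0(1) u0(2) g0(2) k0(2) h] unfolding u0(3) g0(3) k0(3) B by simp
  moreover have "AE x in lborel. x \<in> T \<longrightarrow> u x = u0 x" using u0(1) by (simp add: borel_rep_def)
  ultimately show ?thesis
  proof eventually_elim
    case (elim x)
    show ?case
    proof
      assume x: "x \<in> T"
      then have "ennreal (measure lborel T * (u x)\<^sup>2) \<le> ennreal ?B" using elim by (simp add: Vf ennreal_mult)
      then show "measure lborel T * (u x)\<^sup>2 \<le> ?B" by (subst (asm) ennreal_le_iff[OF Bnn])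
    qed
  qed
qed

section \<open>Seminorms and weak derivatives of polynomials\<close>

text \<open>Completeness of Lebesgue measure; it is applied to the representative that
  \<open>weak_deriv\<close> selects.\<close>

lemma borel_measurable_lebesgue_on_AE:
  fixes f g :: "real^'d::finite \<Rightarrow> real"
  assumes U: "open U" and g: "g \<in> borel_measurable (lebesgue_on U)" and ae: "AE x in lebesgue_on U. f x = g x"
  shows "f \<in> borel_measurable (lebesgue_on U)"
proof -
  have Us: "U \<inter> space lebesgue \<in> sets lebesgue" using U by (auto intro: borel_open)
  let ?f = "\<lambda>x. indicator U x *\<^sub>R f x" and ?g = "\<lambda>x. indicator U x *\<^sub>R g x"
  have g': "?g \<in> borel_measurable lebesgue" using g Us by (simp add: borel_measurable_restrict_space_iff)
  have ae': "AE x in lebesgue. ?f x = ?g x"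
  proof -
    have "AE x in lebesgue. x \<in> U \<longrightarrow> f x = g x" using ae unfolding AE_restrict_space_iff[OF Us] .
    then show ?thesis by (rule eventually_mono) (simp add: indicator_def)
  qed
  have "?f \<in> borel_measurable lebesgue"
  proof (rule measurableI)
    fix A :: "real set" assume A: "A \<in> sets borel"
    have m1: "?g -` A \<inter> space lebesgue \<in> sets lebesgue" using g' A by (rule measurable_sets)
    have m2: "AE x in lebesgue. x \<in> ?g -` A \<inter> space lebesgue \<longleftrightarrow> x \<in> ?f -` A \<inter> space lebesgue"
      using ae' by (rule eventually_mono) (simp only: Int_iff vimage_eq)
    show "?f -` A \<inter> space lebesgue \<in> sets lebesgue"
      by (rule completion.in_sets_AE[OF m2 m1]) simp
  qed simp
  then show ?thesis using Us by (simp add: borel_measurable_restrict_space_iff)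
qed

lemma sobolev_seminorm_eq:
  fixes v :: "real^'d::finite \<Rightarrow> real"
  assumes U: "open U" and wd: "\<And>\<alpha>. mi_order \<alpha> = s \<Longrightarrow> has_weak_deriv U \<alpha> v (g \<alpha>)"
    and g: "\<And>\<alpha>. mi_order \<alpha> = s \<Longrightarrow> in_Lp 2 U (g \<alpha>)"
  shows "sobolev_seminorm s 2 U v = sqrt (\<Sum>\<alpha> | mi_order \<alpha> = s. nsq U (g \<alpha>))"
proof -
  have "(LINT x|lebesgue_on U. \<bar>weak_deriv U \<alpha> v x\<bar> powr 2) = nsq U (g \<alpha>)" if s: "mi_order \<alpha> = s" for \<alpha>
  proof -
    have "has_weak_deriv U \<alpha> v (weak_deriv U \<alpha> v)"
      unfolding weak_deriv_def by (rule someI[of "has_weak_deriv U \<alpha> v"]) (rule wd[OF s])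
    from weak_deriv_unique[OF U this wd[OF s]]
    have ae: "AE x in lebesgue_on U. weak_deriv U \<alpha> v x = g \<alpha> x" .
    have gm: "g \<alpha> \<in> borel_measurable (lebesgue_on U)" using g[OF s] by (simp add: in_Lp_two)
    have wm: "weak_deriv U \<alpha> v \<in> borel_measurable (lebesgue_on U)"
      by (rule borel_measurable_lebesgue_on_AE[OF U gm ae])
    show ?thesis unfolding abs_powr_two
      by (rule integral_cong_AE) (use gm wm ae in \<open>auto elim: eventually_mono\<close>)
  qed
  then have "sobolev_seminorm s 2 U v = (\<Sum>\<alpha> | mi_order \<alpha> = s. nsq U (g \<alpha>)) powr (1 / 2)"
    unfolding sobolev_seminorm_def by (intro arg_cong[where f="\<lambda>z. z powr (1/2)"] sum.cong) auto
  then show ?thesis by (simp add: powr_half_sqrt sum_nonneg)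
qed

lemma has_weak_deriv_0:
  fixes v :: "real^'d::finite \<Rightarrow> real"
  assumes "locally_integrable U v"
  shows "has_weak_deriv U (\<lambda>_. 0) v v"
  unfolding has_weak_deriv_def
proof (intro conjI allI impI)
  fix \<phi> and "is" :: "'d list" assume A: "test_function U \<phi> \<and> count_list is = (\<lambda>_. 0)"
  have 0: "mi_order ((\<lambda>_. 0) :: 'd \<Rightarrow> nat) = 0" by (simp add: mi_order_def)
  have "length is = mi_order (count_list is)" by (rule mi_order_count_list[symmetric])
  also have "\<dots> = 0" by (simp only: A 0)
  finally have "is = []" by simp
  then show "(LINT x|lebesgue_on U. v x * partials is \<phi> x) = (- 1) ^ mi_order ((\<lambda>_. 0) :: 'd \<Rightarrow> nat) * (LINT x|lebesgue_on U. v x * \<phi> x)"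
    unfolding 0 by simp
qed (rule assms)+

lemma has_weak_deriv_cong:
  assumes "\<And>x. x \<in> U \<Longrightarrow> v x = v' x" "has_weak_deriv U \<alpha> v g"
  shows "has_weak_deriv U \<alpha> v' g"
proof -
  have "locally_integrable U v'"
    unfolding locally_integrable_def
  proof (intro allI impI)
    fix C assume C: "compact C \<and> C \<subseteq> U"
    then have "integrable (lebesgue_on C) v" using has_weak_derivD(1)[OF assms(2)] by (auto simp: locally_integrable_def)
    then show "integrable (lebesgue_on C) v'"
      by (rule Bochner_Integration.integrable_cong[THEN iffD1, rotated -1]) (use C assms(1) in auto)
  qed
  moreover have "(LINT x|lebesgue_on U. v x * f x) = (LINT x|lebesgue_on U. v' x * f x)" for f
    by (intro Bochner_Integration.integral_cong) (use assms(1) in auto)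
  ultimately show ?thesis using assms(2) by (simp add: has_weak_deriv_def)
qed

lemma locally_integrable_continuous:
  fixes f :: "real^'d::finite \<Rightarrow> real"
  assumes "continuous_on UNIV f"
  shows "locally_integrable U f"
  unfolding locally_integrable_def
proof (intro allI impI)
  fix C assume C: "compact C \<and> C \<subseteq> U"
  have Cm: "C \<in> sets borel" using C borel_compact by blast
  have "integrable lborel (\<lambda>x. indicator C x *\<^sub>R f x)"
    using C continuous_on_subset[OF assms subset_UNIV, of C] by (intro borel_integrable_compact) auto
  then have "integrable lebesgue (\<lambda>x. indicator C x *\<^sub>R f x)"
    using Cm borel_measurable_continuous_onI[OF assms] by (subst integrable_completion) auto
  then show "integrable (lebesgue_on C) f" using Cm by (subst integrable_restrict_space) auto
qed

lemma has_weak_deriv_dpoly: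
  fixes U :: "(real^'d::finite) set"
  assumes U: "open U"
  shows "has_weak_deriv U \<beta> (dpoly k c (\<lambda>_. 0)) (dpoly k c \<beta>)"
  unfolding has_weak_deriv_def
proof (intro conjI allI impI)
  show "locally_integrable U (dpoly k c (\<lambda>_. 0))" "locally_integrable U (dpoly k c \<beta>)"
    by (intro locally_integrable_continuous continuous_dpoly)+
  fix \<phi> "is" assume "test_function U \<phi> \<and> count_list is = \<beta>"
  then have \<phi>: "test_function U \<phi>" and cl: "count_list is = \<beta>" by auto
  have len: "mi_order \<beta> = length is" using mi_order_count_list[of "is"] cl by simp
  have out: "partials js \<phi> x = 0" if "x \<notin> U" for js x
    using test_functionD(3)[OF \<phi>] that by (intro partials_outside_support) auto
  have lint: "(LINT x|lebesgue_on U. dpoly k c \<gamma> x * partials js \<phi> x)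
      = (\<Sum>\<alpha> | mi_order \<alpha> \<le> k. c \<alpha> * (LINT x|lborel. dmono \<alpha> \<gamma> x * partials js \<phi> x))" for \<gamma> js
  proof -
    have "(LINT x|lebesgue_on U. dpoly k c \<gamma> x * partials js \<phi> x) = (LINT x|lborel. dpoly k c \<gamma> x * partials js \<phi> x)"
    proof (rule integral_lebesgue_on_open[OF U])
      show "(\<lambda>x. dpoly k c \<gamma> x * partials js \<phi> x) \<in> borel_measurable borel"
        by (intro borel_measurable_continuous_onI continuous_on_mult continuous_dpoly continuous_partials test_functionD(1)[OF \<phi>])
    qed (simp add: out)
    also have "\<dots> = (LINT x|lborel. (\<Sum>\<alpha> | mi_order \<alpha> \<le> k. c \<alpha> * (dmono \<alpha> \<gamma> x * partials js \<phi> x)))"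
      by (simp add: dpoly_def sum_distrib_right mult.assoc)
    also have "\<dots> = (\<Sum>\<alpha> | mi_order \<alpha> \<le> k. c \<alpha> * (LINT x|lborel. dmono \<alpha> \<gamma> x * partials js \<phi> x))"
      using integrable_continuous_times_partials[OF continuous_dmono \<phi>]
      by (subst Bochner_Integration.integral_sum) auto
    finally show ?thesis .
  qed
  have ibp: "(LINT x|lborel. dmono \<alpha> (\<lambda>_. 0) x * partials is \<phi> x) = (- 1) ^ length is * (LINT x|lborel. dmono \<alpha> \<beta> x * \<phi> x)" for \<alpha>
    using integral_by_parts_dmono[OF \<phi>, of \<alpha> "\<lambda>_. 0" "is"] cl by simp
  have "(LINT x|lebesgue_on U. dpoly k c (\<lambda>_. 0) x * partials is \<phi> x)
      = (\<Sum>\<alpha> | mi_order \<alpha> \<le> k. c \<alpha> * ((- 1) ^ length is * (LINT x|lborel. dmono \<alpha> \<beta> x * \<phi> x)))"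
    unfolding lint ibp ..
  also have "\<dots> = (- 1) ^ length is * (\<Sum>\<alpha> | mi_order \<alpha> \<le> k. c \<alpha> * (LINT x|lborel. dmono \<alpha> \<beta> x * \<phi> x))"
    by (simp add: sum_distrib_left mult.left_commute)
  also have "(\<Sum>\<alpha> | mi_order \<alpha> \<le> k. c \<alpha> * (LINT x|lborel. dmono \<alpha> \<beta> x * \<phi> x)) = (LINT x|lebesgue_on U. dpoly k c \<beta> x * \<phi> x)"
    using lint[of \<beta> "[]"] by (simp only: partials.simps)
  finally show "(LINT x|lebesgue_on U. dpoly k c (\<lambda>_. 0) x * partials is \<phi> x)
      = (- 1) ^ mi_order \<beta> * (LINT x|lebesgue_on U. dpoly k c \<beta> x * \<phi> x)"
    unfolding len .
qed

lemma in_Lp_two_dpoly: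
  assumes "open U" "bounded U"
  shows "in_Lp 2 U (dpoly k c \<beta>)"
proof -
  have "compact (dpoly k c \<beta> ` closure U)"
    using assms(2) by (intro compact_continuous_image continuous_dpoly) (simp add: compact_closure)
  then obtain b where b: "\<And>y. y \<in> dpoly k c \<beta> ` closure U \<Longrightarrow> norm y \<le> b" using compact_imp_bounded bounded_iff by metis
  show ?thesis
  proof (rule in_Lp_two_bounded[OF assms])
    show "dpoly k c \<beta> \<in> borel_measurable (lebesgue_on U)"
      by (intro borel_measurable_lebesgue_onI borel_measurable_continuous_onI continuous_dpoly)
    show "\<bar>dpoly k c \<beta> x\<bar> \<le> b" if "x \<in> U" for x using b[of "dpoly k c \<beta> x"] that closure_subset by auto
  qed
qed

lemma in_Lp_two_integrable:
  fixes u :: "real^'d::finite \<Rightarrow> real"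
  assumes "open T" "bounded T" "in_Lp 2 T u"
  shows "integrable (lebesgue_on T) u"
proof -
  obtain u0 where u0: "borel_rep T u u0" "integrable lborel u0" using L2_rep[OF assms] by blast
  show ?thesis
  proof (rule integrableI_bounded)
    show "u \<in> borel_measurable (lebesgue_on T)" using assms(3) by (simp add: in_Lp_two)
    show "(\<integral>\<^sup>+x. ennreal (norm (u x)) \<partial>lebesgue_on T) < \<infinity>"
      using u0(2) borel_rep_nn_integral[OF assms(1) u0(1), of "\<lambda>t. ennreal (norm t)"] by (simp add: integrable_iff_bounded)
  qed
qed

section \<open>The moment-matching polynomial and its error\<close>

text \<open>The unknown coefficients solve a system whose matrix consists of the integrals over
  \<open>T\<close> of derivatives of monomials. It is triangular with respect to order, and its
  diagonal is a positive constant times the volume.\<close>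

lemma moment_polynomial:
  fixes T :: "(real^'d::finite) set"
  assumes T: "open T" "bounded T" "T \<noteq> {}" and v: "in_sobolev (k + 1) 2 T v"
  obtains c W where "W (\<lambda>_. 0) = (\<lambda>x. v x - dpoly k c (\<lambda>_. 0) x)"
    "\<And>\<beta>. mi_order \<beta> \<le> k + 1 \<Longrightarrow> has_weak_deriv T \<beta> (\<lambda>x. v x - dpoly k c (\<lambda>_. 0) x) (W \<beta>)"
    "\<And>\<beta>. mi_order \<beta> \<le> k + 1 \<Longrightarrow> in_Lp 2 T (W \<beta>)"
    "\<And>\<beta>. mi_order \<beta> \<le> k \<Longrightarrow> (LINT x|lebesgue_on T. W \<beta> x) = 0"
    "(\<Sum>\<alpha> | mi_order \<alpha> = k + 1. nsq T (W \<alpha>)) = (sobolev_seminorm (k + 1) 2 T v)\<^sup>2"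
proof -
  have "\<forall>\<alpha>. \<exists>g. mi_order \<alpha> \<le> k + 1 \<longrightarrow> has_weak_deriv T \<alpha> v g \<and> in_Lp 2 T g"
    using v by (auto simp: in_sobolev_def)
  then obtain g where g: "\<And>\<alpha>. mi_order \<alpha> \<le> k + 1 \<Longrightarrow> has_weak_deriv T \<alpha> v (g \<alpha>)" "\<And>\<alpha>. mi_order \<alpha> \<le> k + 1 \<Longrightarrow> in_Lp 2 T (g \<alpha>)"
    by metis
  \<comment> \<open>Replacing the order-zero representative by \<open>v\<close> makes the order-zero
    error equal to \<open>v - p\<close> everywhere and not just almost everywhere.\<close>
  define G where "G \<alpha> = (if \<alpha> = (\<lambda>_. 0) then v else g \<alpha>)" for \<alpha>
  have "mi_order ((\<lambda>_. 0) :: 'd \<Rightarrow> nat) \<le> k + 1" by (simp add: mi_order_def)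
  then have "locally_integrable T v" using g(1) has_weak_derivD(1) by blast
  from has_weak_deriv_0[OF this] have G: "\<And>\<alpha>. mi_order \<alpha> \<le> k + 1 \<Longrightarrow> has_weak_deriv T \<alpha> v (G \<alpha>)"
    "\<And>\<alpha>. mi_order \<alpha> \<le> k + 1 \<Longrightarrow> in_Lp 2 T (G \<alpha>)"
    using g v by (auto simp: G_def in_sobolev_def)
  define A where "A \<alpha> \<beta> = (LINT x|lebesgue_on T. dmono \<alpha> \<beta> x)" for \<alpha> \<beta>
  have Tl: "T \<in> sets lebesgue" using T(1) by (auto intro: borel_open)
  have Apos: "A \<alpha> \<alpha> \<noteq> 0" for \<alpha>
  proof -
    have "A \<alpha> \<alpha> = (LINT x|lebesgue_on T. dmono \<alpha> \<alpha> 0)"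
      unfolding A_def by (intro Bochner_Integration.integral_cong refl dmono_diag_pos(1))
    also have "\<dots> = measure (lebesgue_on T) (space (lebesgue_on T)) * dmono \<alpha> \<alpha> 0" by simp
    also have "measure (lebesgue_on T) (space (lebesgue_on T)) = measure lborel T"
      using Tl measure_open_pos(2)[OF T] by (simp add: measure_restrict_space space_restrict_space)
    finally show ?thesis using measure_open_pos[OF T] dmono_diag_pos(2)[of \<alpha> 0] by simp
  qed
  have "A \<alpha> \<beta> = 0" if "mi_order \<alpha> \<le> mi_order \<beta>" "\<alpha> \<noteq> \<beta>" for \<alpha> \<beta>
  proof -
    have "dmono \<alpha> \<beta> = (\<lambda>_. 0)" by (intro ext dmono_eq_0 that)
    then show ?thesis by (simp add: A_def)
  qed
  from triangular_system[of A k "\<lambda>\<beta>. LINT x|lebesgue_on T. G \<beta> x", OF Apos this]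
  obtain c where c: "\<And>\<beta>. mi_order \<beta> \<le> k \<Longrightarrow> (\<Sum>\<alpha> | mi_order \<alpha> \<le> k. c \<alpha> * A \<alpha> \<beta>) = (LINT x|lebesgue_on T. G \<beta> x)"
    by blast
  define W where "W \<beta> x = G \<beta> x - dpoly k c \<beta> x" for \<beta> x
  show ?thesis
  proof (rule that[of W c])
    show "W (\<lambda>_. 0) = (\<lambda>x. v x - dpoly k c (\<lambda>_. 0) x)" by (simp add: W_def G_def fun_eq_iff)
    show "has_weak_deriv T \<beta> (\<lambda>x. v x - dpoly k c (\<lambda>_. 0) x) (W \<beta>)" if "mi_order \<beta> \<le> k + 1" for \<beta>
      unfolding W_def[abs_def] by (intro has_weak_deriv_diff T(1) G that has_weak_deriv_dpoly)
    show "in_Lp 2 T (W \<beta>)" if "mi_order \<beta> \<le> k + 1" for \<beta>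
      unfolding W_def[abs_def] by (intro in_Lp_two_diff G that in_Lp_two_dpoly T)
    show "(LINT x|lebesgue_on T. W \<beta> x) = 0" if b: "mi_order \<beta> \<le> k" for \<beta>
    proof -
      have dm: "integrable (lebesgue_on T) (dmono \<alpha> \<beta>)" for \<alpha>
      proof -
        have "compact (closure T)" using T(2) by (simp add: compact_closure)
        then have "integrable (lebesgue_on (closure T)) (dmono \<alpha> \<beta>)"
          using locally_integrable_continuous[OF continuous_dmono, of UNIV \<alpha> \<beta>] by (auto simp: locally_integrable_def)
        then have "set_integrable lebesgue (closure T) (dmono \<alpha> \<beta>)" by (simp add: set_integrable_def integrable_restrict_space)
        then have "set_integrable lebesgue T (dmono \<alpha> \<beta>)" by (rule set_integrable_subset) (use Tl closure_subset in auto)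
        then show ?thesis using Tl by (simp add: set_integrable_def integrable_restrict_space)
      qed
      have "(LINT x|lebesgue_on T. dpoly k c \<beta> x) = (\<Sum>\<alpha> | mi_order \<alpha> \<le> k. c \<alpha> * A \<alpha> \<beta>)"
        unfolding dpoly_def A_def using dm by (subst Bochner_Integration.integral_sum) auto
      moreover have "integrable (lebesgue_on T) (G \<beta>)"
        by (rule in_Lp_two_integrable[OF T(1,2) G(2)]) (use b in simp)
      moreover have "integrable (lebesgue_on T) (dpoly k c \<beta>)"
        by (rule in_Lp_two_integrable[OF T(1,2) in_Lp_two_dpoly[OF T(1,2)]])
      ultimately show ?thesis using c[OF b] by (simp add: W_def)
    qed
    \<comment> \<open>Derivatives of order k+1 annihilate the polynomial, so \<open>v\<close> and
      \<open>v - p\<close> share the top seminorm.\<close>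
    have "W \<alpha> = G \<alpha>" if "mi_order \<alpha> = k + 1" for \<alpha>
      unfolding W_def[abs_def] using dpoly_order_gt[of k \<alpha>] that by (simp add: fun_eq_iff)
    then have "(\<Sum>\<alpha> | mi_order \<alpha> = k + 1. nsq T (W \<alpha>)) = (\<Sum>\<alpha> | mi_order \<alpha> = k + 1. nsq T (G \<alpha>))"
      by (intro sum.cong) auto
    also have "\<dots> = (sobolev_seminorm (k + 1) 2 T v)\<^sup>2"
    proof -
      have "sobolev_seminorm (k + 1) 2 T v = sqrt (\<Sum>\<alpha> | mi_order \<alpha> = k + 1. nsq T (G \<alpha>))"
        by (rule sobolev_seminorm_eq[OF T(1)]) (simp_all only: G order_refl)
      then show ?thesis by (simp only:) (rule real_sqrt_pow2[symmetric], rule sum_nonneg, simp)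
    qed
    finally show "(\<Sum>\<alpha> | mi_order \<alpha> = k + 1. nsq T (W \<alpha>)) = (sobolev_seminorm (k + 1) 2 T v)\<^sup>2" .
  qed
qed

lemma chain_bound:
  fixes N :: "nat \<Rightarrow> real"
  assumes "\<And>j. j \<le> k \<Longrightarrow> N j \<le> q * N (Suc j)" "q \<ge> 0" "j \<le> Suc k"
  shows "N j \<le> q ^ (Suc k - j) * N (Suc k)"
  using assms(3)
proof (induction "Suc k - j" arbitrary: j)
  case 0
  then have "j = Suc k" by simp
  then show ?case by simp
next
  case (Suc n)
  then have j: "j \<le> k" by simp
  have "N j \<le> q * N (Suc j)" by (rule assms(1)[OF j])
  also have "\<dots> \<le> q * (q ^ (Suc k - Suc j) * N (Suc k))"
    using Suc j assms(2) by (intro mult_left_mono Suc.hyps(1)) auto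
  also have "q * (q ^ (Suc k - Suc j) * N (Suc k)) = q ^ (Suc k - j) * N (Suc k)"
    using j by (simp add: Suc_diff_le)
  finally show ?case .
qed

text \<open>One factor that serves every order up to \<open>k\<close>: 2^d from the Poincare
  inequality, d because each partial derivative is bounded by the full sum of the next order, and
  the cardinality for the number of multi-indices summed.\<close>

definition poincare_const :: "'d::finite itself \<Rightarrow> nat \<Rightarrow> real" where
  "poincare_const _ k = real (card {\<alpha>::'d \<Rightarrow> nat. mi_order \<alpha> \<le> k}) * (2 ^ CARD('d) * real CARD('d))"

lemma nsq_le_level:
  fixes W :: "('d::finite \<Rightarrow> nat) \<Rightarrow> real^'d \<Rightarrow> real"
  shows "nsq T (W \<beta>) \<le> (\<Sum>\<alpha> | mi_order \<alpha> = mi_order \<beta>. nsq T (W \<alpha>))"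
  by (rule member_le_sum) (auto simp: finite_mi_eq)

text \<open>Every derivative of order at most \<open>k\<close> has mean zero, so the Poincare
  inequality climbs from order \<open>j\<close> to order k+1, and each step contributes one factor
  h^2 to the squared norm.\<close>

lemma mean_zero_derivatives_bound:
  fixes W :: "('d::finite \<Rightarrow> nat) \<Rightarrow> real^'d \<Rightarrow> real"
  assumes T: "open T" "convex T" "bounded T" "T \<noteq> {}"
    and h: "\<And>x y. x \<in> T \<Longrightarrow> y \<in> T \<Longrightarrow> dist x y \<le> h"
    and wd: "\<And>\<beta>. mi_order \<beta> \<le> k + 1 \<Longrightarrow> has_weak_deriv T \<beta> u (W \<beta>)"
    and L2: "\<And>\<beta>. mi_order \<beta> \<le> k + 1 \<Longrightarrow> in_Lp 2 T (W \<beta>)"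
    and mean: "\<And>\<beta>. mi_order \<beta> \<le> k \<Longrightarrow> (LINT x|lebesgue_on T. W \<beta> x) = 0"
    and j: "j \<le> k + 1"
  shows "(\<Sum>\<alpha> | mi_order \<alpha> = j. nsq T (W \<alpha>))
     \<le> (poincare_const TYPE('d) k * h\<^sup>2) ^ (k + 1 - j) * (\<Sum>\<alpha> | mi_order \<alpha> = k + 1. nsq T (W \<alpha>))"
proof -
  define N where "N j = (\<Sum>\<alpha> | mi_order \<alpha> = j. nsq T (W \<alpha>))" for j
  have N0: "N j \<ge> 0" for j unfolding N_def by (intro sum_nonneg) simp
  have step: "N j \<le> (poincare_const TYPE('d) k * h\<^sup>2) * N (Suc j)" if j: "j \<le> k" for j
  proof -
    have le: "nsq T (W \<beta>) \<le> 2 ^ CARD('d) * h\<^sup>2 * (real CARD('d) * N (Suc j))" if b: "mi_order \<beta> = j" for \<beta>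
    proof -
      have "nsq T (W \<beta>) \<le> 2 ^ CARD('d) * h\<^sup>2 * (\<Sum>i\<in>UNIV. nsq T (W (\<beta>(i := Suc (\<beta> i)))))"
      proof (rule poincare_mean_zero[OF T])
        show "has_weak_deriv T (unit_mi i) (W \<beta>) (W (\<beta>(i := Suc (\<beta> i))))" for i
          by (rule has_weak_deriv_step[where v=u]) (use b j in \<open>auto intro!: wd simp: mi_order_upd simp del: fun_upd_apply\<close>)
      qed (use b j in \<open>auto intro!: L2 mean h simp: mi_order_upd simp del: fun_upd_apply\<close>)
      also have "\<dots> \<le> 2 ^ CARD('d) * h\<^sup>2 * (\<Sum>i\<in>(UNIV::'d set). N (Suc j))"
        using nsq_le_level[of T W] b unfolding N_def
        by (intro mult_left_mono sum_mono) (auto simp: mi_order_upd simp del: fun_upd_apply intro: order_trans[OF nsq_le_level])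
      finally show ?thesis by simp
    qed
    have "N j \<le> (\<Sum>\<alpha> | mi_order (\<alpha> :: 'd \<Rightarrow> nat) = j. 2 ^ CARD('d) * h\<^sup>2 * (real CARD('d) * N (Suc j)))"
      unfolding N_def[of j] by (rule sum_mono) (use le in auto)
    also have "\<dots> = real (card {\<alpha>::'d \<Rightarrow> nat. mi_order \<alpha> = j}) * (2 ^ CARD('d) * h\<^sup>2 * (real CARD('d) * N (Suc j)))"
      by simp
    also have "\<dots> \<le> real (card {\<alpha>::'d \<Rightarrow> nat. mi_order \<alpha> \<le> k}) * (2 ^ CARD('d) * h\<^sup>2 * (real CARD('d) * N (Suc j)))"
      using j N0 by (intro mult_right_mono of_nat_mono card_mono finite_mi_le) auto
    finally show ?thesis by (simp add: poincare_const_def mult_ac)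
  qed
  have "N j \<le> (poincare_const TYPE('d) k * h\<^sup>2) ^ (Suc k - j) * N (Suc k)"
    by (rule chain_bound[where N=N, OF step]) (use j in \<open>auto simp: poincare_const_def\<close>)
  then show ?thesis by (simp add: N_def)
qed

text \<open>A nonempty open set is not negligible. This turns the almost everywhere range condition
  on \<open>v\<close> into bounds on the polynomial at every point of \<open>T\<close>.\<close>

lemma AE_open_imp_all:
  fixes f :: "real^'d::finite \<Rightarrow> real"
  assumes "open T" "continuous_on UNIV f" and ae: "AE x in lborel. x \<in> T \<longrightarrow> f x \<le> b" and x: "x \<in> T"
  shows "f x \<le> b"
proof (rule ccontr)
  assume "\<not> f x \<le> b"
  define A where "A = T \<inter> {x. b < f x}"
  have A: "open A" "x \<in> A" unfolding A_def using assms(1,2) x \<open>\<not> f x \<le> b\<close>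
    by (auto intro!: open_Int open_Collect_less continuous_intros)
  have "AE x in lborel. x \<notin> A" using ae by (auto elim!: eventually_mono simp: A_def)
  then have "A \<in> null_sets lborel"
    using A(1) by (subst (asm) AE_iff_null_sets[symmetric]) auto
  then have "negligible A" by (simp add: negligible_iff_null_sets null_sets_completionI)
  with A show False using open_not_negligible by blast
qed

text \<open>The three summands come from the derivatives of order 0, 1 and 2 in the pointwise bound,
  each estimated by the top order through the chain of Poincare inequalities.\<close>

definition sup_const :: "'d::finite itself \<Rightarrow> nat \<Rightarrow> real" where
  "sup_const d k = (let a = poincare_const d k; n = real CARD('d) in
     3 * (a ^ (k + 1) + n * a ^ k + 4 * n\<^sup>2 * a ^ (k - 1)))"

text \<open>The weights 1, h^2 and h^4 of the pointwise bound are exactly compensated by the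
  Poincare powers, so all terms scale like h^(2(k+1)). For k \<ge> 1 the second derivatives are
  among those of order at most k+1.\<close>

lemma mean_zero_sup_bound:
  fixes W :: "('d::finite \<Rightarrow> nat) \<Rightarrow> real^'d \<Rightarrow> real"
  assumes d: "CARD('d) \<le> 3" and T: "open T" "convex T" "bounded T" "T \<noteq> {}"
    and h: "\<And>x y. x \<in> T \<Longrightarrow> y \<in> T \<Longrightarrow> dist x y \<le> h"
    and k: "k \<ge> 1"
    and W0: "W (\<lambda>_. 0) = u"
    and wd: "\<And>\<beta>. mi_order \<beta> \<le> k + 1 \<Longrightarrow> has_weak_deriv T \<beta> u (W \<beta>)"
    and L2: "\<And>\<beta>. mi_order \<beta> \<le> k + 1 \<Longrightarrow> in_Lp 2 T (W \<beta>)"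
    and mean: "\<And>\<beta>. mi_order \<beta> \<le> k \<Longrightarrow> (LINT x|lebesgue_on T. W \<beta> x) = 0"
  shows "AE x in lborel. x \<in> T \<longrightarrow> measure lborel T * (u x)\<^sup>2
     \<le> sup_const TYPE('d) k * h ^ (2 * (k + 1)) * (\<Sum>\<alpha> | mi_order \<alpha> = k + 1. nsq T (W \<alpha>))"
proof -
  define a where "a = poincare_const TYPE('d) k"
  define n where "n = real CARD('d)"
  define M where "M = (\<Sum>\<alpha> | mi_order \<alpha> = k + 1. nsq T (W \<alpha>))"
  have level: "nsq T (W \<beta>) \<le> (a * h\<^sup>2) ^ (k + 1 - mi_order \<beta>) * M" if "mi_order \<beta> \<le> k + 1" for \<beta>
    using order.trans[OF nsq_le_level mean_zero_derivatives_bound[OF T h wd L2 mean that]]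
    by (simp only: a_def M_def)
  have o0: "mi_order ((\<lambda>_. 0)::'d \<Rightarrow> nat) = 0" by (simp add: mi_order_def)
  have o1: "mi_order (unit_mi i) = 1" for i :: 'd
    using mi_order_upd[of "\<lambda>_. 0" i] o0 by simp
  have o2: "mi_order (unit2_mi i j) = 2" for i j :: 'd
    using mi_order_upd[of "unit_mi i" j] o1[of i] by simp
  have "AE x in lborel. x \<in> T \<longrightarrow> measure lborel T * (u x)\<^sup>2 \<le>
     3 * (nsq T u + h\<^sup>2 * (\<Sum>i\<in>UNIV. nsq T (W (unit_mi i))) + 4 * h ^ 4 * (\<Sum>i\<in>UNIV. \<Sum>j\<in>UNIV. nsq T (W (unit2_mi i j))))"
  proof (rule sobolev_sup_bound_real[OF d T(1-3) _ _ _ _ _ h])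
    show "in_Lp 2 T u" using L2[of "\<lambda>_. 0"] o0 W0 by simp
    show "in_Lp 2 T (W (unit_mi i))" "has_weak_deriv T (unit_mi i) u (W (unit_mi i))" for i
      using o1[of i] by (auto intro!: L2 wd simp del: fun_upd_apply)
    show "in_Lp 2 T (W (unit2_mi i j))" "has_weak_deriv T (unit2_mi i j) u (W (unit2_mi i j))" for i j
      using o2[of i j] k by (auto intro!: L2 wd simp del: fun_upd_apply)
  qed
  moreover have "3 * (nsq T u + h\<^sup>2 * (\<Sum>i\<in>UNIV. nsq T (W (unit_mi i))) + 4 * h ^ 4 * (\<Sum>i\<in>UNIV. \<Sum>j\<in>UNIV. nsq T (W (unit2_mi i j))))
     \<le> sup_const TYPE('d) k * h ^ (2 * (k + 1)) * M"
  proof -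
    have h4: "0 \<le> h ^ 4" by simp
    have 0: "nsq T u \<le> (a * h\<^sup>2) ^ (k + 1) * M" using level[of "\<lambda>_. 0"] o0 W0 by simp
    have 1: "(\<Sum>i\<in>UNIV. nsq T (W (unit_mi i))) \<le> (\<Sum>i\<in>(UNIV::'d set). (a * h\<^sup>2) ^ k * M)"
    proof (rule sum_mono)
      fix i show "nsq T (W (unit_mi i)) \<le> (a * h\<^sup>2) ^ k * M"
        using level[of "unit_mi i"] unfolding o1[of i] by simp
    qed
    have 2: "(\<Sum>i\<in>UNIV. \<Sum>j\<in>UNIV. nsq T (W (unit2_mi i j))) \<le> (\<Sum>i\<in>(UNIV::'d set). \<Sum>j\<in>(UNIV::'d set). (a * h\<^sup>2) ^ (k - 1) * M)"
    proof (intro sum_mono)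
      fix i j show "nsq T (W (unit2_mi i j)) \<le> (a * h\<^sup>2) ^ (k - 1) * M"
        using level[of "unit2_mi i j"] k unfolding o2[of i j] by (simp add: numeral_2_eq_2)
    qed
    have "3 * (nsq T u + h\<^sup>2 * (\<Sum>i\<in>UNIV. nsq T (W (unit_mi i))) + 4 * h ^ 4 * (\<Sum>i\<in>UNIV. \<Sum>j\<in>UNIV. nsq T (W (unit2_mi i j))))
      \<le> 3 * ((a * h\<^sup>2) ^ (k + 1) * M + h\<^sup>2 * (n * ((a * h\<^sup>2) ^ k * M)) + 4 * h ^ 4 * (n * (n * ((a * h\<^sup>2) ^ (k - 1) * M))))"
      using 0 1 2 h4 unfolding n_def by (intro mult_left_mono add_mono) auto
    also have "\<dots> = sup_const TYPE('d) k * h ^ (2 * (k + 1)) * M"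
    proof -
      obtain l where l: "k = Suc l" using k by (cases k) auto
      have h4e: "h ^ 4 = h * (h * (h * h))" by (simp add: eval_nat_numeral)
      have e: "(a * h\<^sup>2) ^ (k + 1) = a ^ (k + 1) * h ^ (2 * (k + 1))" "h\<^sup>2 * (a * h\<^sup>2) ^ k = a ^ k * h ^ (2 * (k + 1))"
        "h ^ 4 * (a * h\<^sup>2) ^ (k - 1) = a ^ (k - 1) * h ^ (2 * (k + 1))"
        unfolding l by (simp_all add: power_mult_distrib power_mult[symmetric] power_add[symmetric] algebra_simps)
          (simp_all add: power_add power_mult power2_eq_square h4e mult_ac)
      have "3 * ((a * h\<^sup>2) ^ (k + 1) * M + h\<^sup>2 * (n * ((a * h\<^sup>2) ^ k * M)) + 4 * h ^ 4 * (n * (n * ((a * h\<^sup>2) ^ (k - 1) * M))))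
        = 3 * ((a * h\<^sup>2) ^ (k + 1) + n * (h\<^sup>2 * (a * h\<^sup>2) ^ k) + 4 * n\<^sup>2 * (h ^ 4 * (a * h\<^sup>2) ^ (k - 1))) * M"
        by (simp add: algebra_simps power2_eq_square[of n])
      also have "\<dots> = sup_const TYPE('d) k * h ^ (2 * (k + 1)) * M"
        unfolding e sup_const_def Let_def a_def[symmetric] n_def[symmetric] by (simp add: algebra_simps)
      finally show ?thesis .
    qed
    finally show ?thesis .
  qed
  ultimately show ?thesis
    unfolding M_def by (auto elim!: eventually_mono intro: order_trans)
qed

text \<open>Squeezing \<open>p\<close> affinely about the midpoint \<open>\<kappa>/2\<close> restores the range and moves values by at most \<open>\<delta>\<close>.\<close>

lemma squeeze_range:
  fixes \<kappa> \<delta> p :: real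
  assumes "\<kappa> > 0" "\<delta> \<ge> 0" "- \<delta> \<le> p" "p \<le> \<kappa> + \<delta>"
  defines "\<theta> \<equiv> - (2 * \<delta>) / (\<kappa> + 2 * \<delta>)"
  shows "p + \<theta> * (p - \<kappa> / 2) \<in> {0..\<kappa>}" "\<bar>\<theta> * (p - \<kappa> / 2)\<bar> \<le> \<delta>"
proof -
  have pos: "\<kappa> + 2 * \<delta> > 0" using assms(1,2) by linarith
  have b: "\<bar>p - \<kappa> / 2\<bar> \<le> (\<kappa> + 2 * \<delta>) / 2" by (rule abs_leI) (use assms(3,4) in \<open>simp_all add: field_simps\<close>)
  have "\<theta> \<le> 0" unfolding \<theta>_def using pos assms(2) by (intro divide_nonpos_pos) auto
  then have \<theta>: "\<bar>\<theta>\<bar> = 2 * \<delta> / (\<kappa> + 2 * \<delta>)" using pos assms(2) by (simp add: \<theta>_def abs_of_nonneg)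
  \<comment> \<open>The contraction factor is the ratio of the lengths of
    \<open>[0, \<kappa>]\<close> and \<open>[-\<delta>, \<kappa> + \<delta>]\<close>, two intervals
    with the same midpoint.\<close>
  have \<theta>1: "1 + \<theta> = \<kappa> / (\<kappa> + 2 * \<delta>)" using pos by (simp add: \<theta>_def field_simps)
  have "\<bar>\<theta> * (p - \<kappa> / 2)\<bar> \<le> 2 * \<delta> / (\<kappa> + 2 * \<delta>) * ((\<kappa> + 2 * \<delta>) / 2)"
    unfolding abs_mult \<theta> using b pos assms(2) by (intro mult_left_mono) auto
  also have "\<dots> = \<delta>" using pos by simp
  finally show "\<bar>\<theta> * (p - \<kappa> / 2)\<bar> \<le> \<delta>" .
  have "\<bar>(1 + \<theta>) * (p - \<kappa> / 2)\<bar> \<le> \<kappa> / (\<kappa> + 2 * \<delta>) * ((\<kappa> + 2 * \<delta>) / 2)"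
    unfolding abs_mult \<theta>1 using b pos assms(1) by (intro mult_mono) auto
  also have "\<dots> = \<kappa> / 2" using pos by simp
  finally have "\<bar>(1 + \<theta>) * (p - \<kappa> / 2)\<bar> \<le> \<kappa> / 2" .
  moreover have "p + \<theta> * (p - \<kappa> / 2) = (1 + \<theta>) * (p - \<kappa> / 2) + \<kappa> / 2" by (simp add: algebra_simps)
  ultimately show "p + \<theta> * (p - \<kappa> / 2) \<in> {0..\<kappa>}" by (auto simp: abs_le_iff)
qed

lemma dpoly_add: "dpoly k (\<lambda>\<alpha>. c \<alpha> + c' \<alpha>) \<beta> x = dpoly k c \<beta> x + dpoly k c' \<beta> x"
  by (simp add: dpoly_def distrib_right sum.distrib)

lemma dpoly_affine_image:
  "dpoly k (\<lambda>\<alpha>. s * (c \<alpha> - (if \<alpha> = (\<lambda>_. 0) then t else 0))) (\<lambda>_. 0) x = s * (dpoly k c (\<lambda>_. 0) x - t)"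
proof -
  let ?z = "(\<lambda>_. 0) :: 'a \<Rightarrow> nat"
  have "(\<Sum>\<alpha> | mi_order \<alpha> \<le> k. (if \<alpha> = ?z then t else 0) * dmono \<alpha> ?z x) = (\<Sum>\<alpha> | mi_order \<alpha> \<le> k. if \<alpha> = ?z then t else 0)"
    by (intro sum.cong) (auto simp: dmono_0)
  also have "mi_order ?z = 0" by (simp add: mi_order_def)
  then have "(\<Sum>\<alpha> | mi_order \<alpha> \<le> k. if \<alpha> = ?z then t else 0) = t" by (simp add: finite_mi_le)
  finally have "(\<Sum>\<alpha> | mi_order \<alpha> \<le> k. (if \<alpha> = ?z then t else 0) * dmono \<alpha> ?z x) = t" .
  then show ?thesis
    by (simp add: dpoly_def mult.assoc left_diff_distrib sum_subtractf flip: sum_distrib_left)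
qed

section \<open>Range-preserving approximation\<close>

lemma in_Lp_two_subset:
  fixes g :: "real^'d::finite \<Rightarrow> real"
  assumes "open T" "open K" "K \<subseteq> T" "in_Lp 2 T g"
  shows "in_Lp 2 K g" "nsq K g \<le> nsq T g"
proof -
  have l: "T \<in> sets lebesgue" "K \<in> sets lebesgue" using assms(1,2) by (auto intro: borel_open)
  have iT: "set_integrable lebesgue T (\<lambda>x. (g x)\<^sup>2)"
    using assms(4) l by (simp add: in_Lp_two set_integrable_def integrable_restrict_space)
  then have iK: "set_integrable lebesgue K (\<lambda>x. (g x)\<^sup>2)" by (rule set_integrable_subset[OF _ l(2) assms(3)])
  have "g \<in> borel_measurable (lebesgue_on K)"
    using assms(3,4) measurable_restrict_mono unfolding in_Lp_two by blast
  then show "in_Lp 2 K g" using iK l by (simp add: in_Lp_two set_integrable_def integrable_restrict_space)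
  have "(LINT x|lebesgue. indicator K x *\<^sub>R (g x)\<^sup>2) \<le> (LINT x|lebesgue. indicator T x *\<^sub>R (g x)\<^sup>2)"
    using iT iK assms(3) unfolding set_integrable_def by (intro integral_mono) (auto simp: indicator_def)
  then show "nsq K g \<le> nsq T g" using l by (simp add: integral_restrict_space)
qed

lemma nsq_diff_bounded:
  fixes f g :: "real^'d::finite \<Rightarrow> real"
  assumes T: "open T" "bounded T" "T \<noteq> {}" and f: "in_Lp 2 T f" and g: "in_Lp 2 T g" and B: "\<And>x. x \<in> T \<Longrightarrow> \<bar>g x\<bar> \<le> B"
  shows "nsq T (\<lambda>x. f x - g x) \<le> 2 * nsq T f + 2 * (measure lborel T * B\<^sup>2)"
proof -
  have Tl: "T \<in> sets lebesgue" using T(1) by (auto intro: borel_open)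
  have fm: "finite_measure (lebesgue_on T)" using T by (simp add: finite_measure_lebesgue_on lmeasurable_open)
  have ic: "integrable (lebesgue_on T) (\<lambda>x. 2 * B\<^sup>2)" by (rule finite_measure.integrable_const[OF fm])
  have if2: "integrable (lebesgue_on T) (\<lambda>x. 2 * (f x)\<^sup>2)" using f by (simp add: in_Lp_two)
  have pt: "(f x - g x)\<^sup>2 \<le> 2 * (f x)\<^sup>2 + 2 * B\<^sup>2" if "x \<in> space (lebesgue_on T)" for x
  proof -
    have "\<bar>g x\<bar> \<le> B" using that B by simp
    then have "(g x)\<^sup>2 \<le> B\<^sup>2" using power_mono[of "\<bar>g x\<bar>" B 2] by simp
    moreover have "(f x - g x)\<^sup>2 \<le> 2 * (f x)\<^sup>2 + 2 * (g x)\<^sup>2"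
      using zero_le_power2[of "f x + g x"] by (simp add: power2_diff power2_sum)
    ultimately show ?thesis by linarith
  qed
  have "nsq T (\<lambda>x. f x - g x) \<le> (LINT x|lebesgue_on T. 2 * (f x)\<^sup>2 + 2 * B\<^sup>2)"
    using in_Lp_two_diff[OF f g] pt by (intro integral_mono Bochner_Integration.integrable_add if2 ic) (auto simp: in_Lp_two)
  also have "\<dots> = 2 * nsq T f + (LINT x|lebesgue_on T. 2 * B\<^sup>2)"
    using if2 ic by (subst Bochner_Integration.integral_add) auto
  also have "(LINT x|lebesgue_on T. 2 * B\<^sup>2) = measure (lebesgue_on T) (space (lebesgue_on T)) * (2 * B\<^sup>2)" by simp
  also have "measure (lebesgue_on T) (space (lebesgue_on T)) = measure lborel T"
    using Tl measure_open_pos(2)[OF T] by (simp add: measure_restrict_space space_restrict_space)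
  finally show ?thesis by (simp add: mult_ac)
qed

lemma mi_order_Suc_obtain:
  assumes "mi_order (\<beta> :: 'd::finite \<Rightarrow> nat) = Suc n"
  obtains \<gamma> i where "\<beta> = \<gamma>(i := Suc (\<gamma> i))" "mi_order \<gamma> = n"
proof -
  obtain "is" where cl: "count_list is = \<beta>" using ex_count_list by blast
  then have "length is = Suc n" using mi_order_count_list[of "is"] assms by simp
  then obtain i js where js: "is = i # js" "length js = n" by (cases "is") auto
  show ?thesis
  proof (rule that)
    show "\<beta> = (count_list js)(i := Suc (count_list js i))" using cl js(1) by (simp only: count_list_Cons_upd)
    show "mi_order (count_list js) = n" using js(2) by (simp only: mi_order_count_list)
  qed
qed

text \<open>The constant is fixed before the domain, the function and \<open>\<kappa>\<close>, which
  is the uniformity that the theorem needs. \<open>h\<close> bounds the distances in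
  \<open>T\<close> and is comparable to the radius of an inscribed ball.\<close>

lemma range_preserving_approximation:
  fixes k :: nat and R :: real
  assumes d: "CARD('d::finite) \<le> 3" and k: "k \<ge> 1" and R: "R \<ge> 1"
  shows "\<exists>B\<ge>0. \<forall>(T :: (real^'d) set) v \<kappa> h a r.
     open T \<longrightarrow> convex T \<longrightarrow> bounded T \<longrightarrow> (\<forall>x\<in>T. \<forall>y\<in>T. dist x y \<le> h) \<longrightarrow> h > 0 \<longrightarrow>
     r > 0 \<longrightarrow> ball a r \<subseteq> T \<longrightarrow> h \<le> R * r \<longrightarrow>
     in_sobolev (k + 1) 2 T v \<longrightarrow> \<kappa> > 0 \<longrightarrow> (AE x in lebesgue_on T. v x \<in> {0..\<kappa>}) \<longrightarrow>
     (\<exists>c. (\<forall>x\<in>T. dpoly k c (\<lambda>_. 0) x \<in> {0..\<kappa>}) \<and>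
        (\<forall>m\<le>2. \<exists>G. (\<forall>\<beta>. mi_order \<beta> = m \<longrightarrow>
             has_weak_deriv T \<beta> (\<lambda>x. v x - dpoly k c (\<lambda>_. 0) x) (G \<beta>) \<and> in_Lp 2 T (G \<beta>)) \<and>
           (\<Sum>\<beta> | mi_order \<beta> = m. nsq T (G \<beta>)) \<le> B * h ^ (2 * (k + 1 - m)) * (sobolev_seminorm (k + 1) 2 T v)\<^sup>2))"
proof -
  let ?z = "(\<lambda>_. 0) :: 'd \<Rightarrow> nat"
  \<comment> \<open>Radius factor 1 keeps the first derivative bounded on the ball itself, so that
    the estimate can be repeated for second derivatives; \<open>CR\<close> reaches all of
    \<open>T\<close>.\<close>
  obtain C1 where C1: "C1 > 0" "\<And>c \<beta> a r M x i. r > 0 \<Longrightarrow> (\<forall>y\<in>ball (a::real^'d) r. \<bar>dpoly k c \<beta> y\<bar> \<le> M) \<Longrightarrow>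
     x \<in> cball a (1 * r) \<Longrightarrow> \<bar>dpoly k c (\<beta>(i := Suc (\<beta> i))) x\<bar> \<le> C1 * M / r"
    using inverse_estimate[of 1 k, where 'd='d] by (auto simp del: fun_upd_apply)
  obtain CR where CR: "CR > 0" "\<And>c \<beta> a r M x i. r > 0 \<Longrightarrow> (\<forall>y\<in>ball (a::real^'d) r. \<bar>dpoly k c \<beta> y\<bar> \<le> M) \<Longrightarrow>
     x \<in> cball a (R * r) \<Longrightarrow> \<bar>dpoly k c (\<beta>(i := Suc (\<beta> i))) x\<bar> \<le> CR * M / r"
    using inverse_estimate[OF R, of k, where 'd='d] by blast
  \<comment> \<open>The summands belong to derivatives of the correction of order 0, 1 and 2, after
    each 1/r is replaced by R/h.\<close>
  define I where "I = 1 + CR * R + CR * C1 * R\<^sup>2"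
  define q where "q = poincare_const TYPE('d) k"
  define b where "b = sup_const TYPE('d) k"
  have q: "q \<ge> 0" by (simp add: q_def poincare_const_def)
  have b: "b \<ge> 0" using q unfolding b_def sup_const_def Let_def q_def[symmetric] by simp
  have I: "1 \<le> I" "CR * R \<le> I" "CR * C1 * R\<^sup>2 \<le> I" using C1(1) CR(1) R by (auto simp: I_def)
  define D where "D m = real (card {\<beta> :: 'd \<Rightarrow> nat. mi_order \<beta> = m})" for m
  \<comment> \<open>The factors 2 come from (a - b)^2 \<le> 2 a^2 + 2 b^2. The first term is the
    error of the moment polynomial, the second that of the squeezing correction, counted once per
    multi-index.\<close>
  define Bm where "Bm m = 2 * q ^ (k + 1 - m) + 2 * D m * I\<^sup>2 * b" for m
  define B where "B = (\<Sum>m\<le>2. Bm m)"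
  have Bm0: "Bm m \<ge> 0" for m using q b by (simp add: Bm_def D_def)
  have BmB: "Bm m \<le> B" if "m \<le> 2" for m unfolding B_def using that Bm0 by (intro member_le_sum) auto
  have B0: "B \<ge> 0" unfolding B_def using Bm0 by (intro sum_nonneg)
  show ?thesis
  proof (intro exI[of _ B] conjI allI impI B0)
    fix T :: "(real^'d) set" and v \<kappa> h a r
    assume T: "open T" "convex T" "bounded T" and hh: "\<forall>x\<in>T. \<forall>y\<in>T. dist x y \<le> h" and h0: "h > 0"
      and r: "r > 0" and ball: "ball a r \<subseteq> T" and hr: "h \<le> R * r" and v: "in_sobolev (k + 1) 2 T v"
      and \<kappa>: "\<kappa> > 0" and range: "AE x in lebesgue_on T. v x \<in> {0..\<kappa>}"
    have h: "\<And>x y. x \<in> T \<Longrightarrow> y \<in> T \<Longrightarrow> dist x y \<le> h" using hh by blast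
    have aT: "a \<in> T" using ball r by auto
    then have ne: "T \<noteq> {}" by blast
    obtain c W where W0: "W ?z = (\<lambda>x. v x - dpoly k c ?z x)"
      and wd: "\<And>\<beta>. mi_order \<beta> \<le> k + 1 \<Longrightarrow> has_weak_deriv T \<beta> (\<lambda>x. v x - dpoly k c ?z x) (W \<beta>)"
      and L2: "\<And>\<beta>. mi_order \<beta> \<le> k + 1 \<Longrightarrow> in_Lp 2 T (W \<beta>)"
      and mean: "\<And>\<beta>. mi_order \<beta> \<le> k \<Longrightarrow> (LINT x|lebesgue_on T. W \<beta> x) = 0"
      and top: "(\<Sum>\<alpha> | mi_order \<alpha> = k + 1. nsq T (W \<alpha>)) = (sobolev_seminorm (k + 1) 2 T v)\<^sup>2"
      by (rule moment_polynomial[OF T(1,3) ne v]) (rule that)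
    define V where "V = measure lborel T"
    have V: "V > 0" using measure_open_pos[OF T(1,3) ne] by (simp add: V_def)
    define M where "M = (sobolev_seminorm (k + 1) 2 T v)\<^sup>2"
    have M: "M \<ge> 0" by (simp add: M_def)
    \<comment> \<open>The square root of the squared sup bound per unit volume, so that the volume
      cancels when the correction is integrated over \<open>T\<close>.\<close>
    define \<delta> where "\<delta> = sqrt (b * h ^ (2 * (k + 1)) * M / V)"
    have \<delta>0: "\<delta> \<ge> 0" using b M V h0 by (simp add: \<delta>_def)
    have \<delta>2: "V * \<delta>\<^sup>2 = b * h ^ (2 * (k + 1)) * M" using b M V h0 by (simp add: \<delta>_def)
    have "AE x in lborel. x \<in> T \<longrightarrow> V * (v x - dpoly k c ?z x)\<^sup>2 \<le> b * h ^ (2 * (k + 1)) * M"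
      using mean_zero_sup_bound[OF d T ne h k W0 wd L2 mean] unfolding top V_def M_def b_def .
    then have close: "AE x in lborel. x \<in> T \<longrightarrow> \<bar>v x - dpoly k c ?z x\<bar> \<le> \<delta>"
    proof eventually_elim
      case (elim x)
      show ?case
      proof
        assume "x \<in> T"
        then have "V * (v x - dpoly k c ?z x)\<^sup>2 \<le> V * \<delta>\<^sup>2" using elim unfolding \<delta>2 by blast
        then have "(v x - dpoly k c ?z x)\<^sup>2 \<le> \<delta>\<^sup>2" using V by simp
        then show "\<bar>v x - dpoly k c ?z x\<bar> \<le> \<delta>" using \<delta>0 by (simp add: abs_le_square_iff[symmetric])
      qed
    qed
    have Ts: "T \<inter> space lebesgue \<in> sets lebesgue" using T(1) by (auto intro: borel_open)
    have "AE x in lebesgue. x \<in> T \<longrightarrow> v x \<in> {0..\<kappa>}" using range unfolding AE_restrict_space_iff[OF Ts] .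
    then have range': "AE x in lborel. x \<in> T \<longrightarrow> v x \<in> {0..\<kappa>}" unfolding AE_completion_iff .
    have up: "dpoly k c ?z x \<le> \<kappa> + \<delta>" if "x \<in> T" for x
    proof (rule AE_open_imp_all[OF T(1) continuous_dpoly _ that])
      show "AE x in lborel. x \<in> T \<longrightarrow> dpoly k c ?z x \<le> \<kappa> + \<delta>"
        using close range' by eventually_elim (auto simp: abs_le_iff)
    qed
    have low: "- dpoly k c ?z x \<le> \<delta>" if "x \<in> T" for x
    proof (rule AE_open_imp_all[OF T(1) continuous_on_minus[OF continuous_dpoly] _ that])
      show "AE x in lborel. x \<in> T \<longrightarrow> - dpoly k c ?z x \<le> \<delta>"
        using close range' by eventually_elim (auto simp: abs_le_iff)
    qed
    define \<theta> where "\<theta> = - (2 * \<delta>) / (\<kappa> + 2 * \<delta>)"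
    define c' where "c' \<alpha> = \<theta> * (c \<alpha> - (if \<alpha> = ?z then \<kappa> / 2 else 0))" for \<alpha>
    have c': "dpoly k c' ?z x = \<theta> * (dpoly k c ?z x - \<kappa> / 2)" for x
      unfolding c'_def by (rule dpoly_affine_image)
    define e where "e \<alpha> = c \<alpha> + c' \<alpha>" for \<alpha>
    have e: "dpoly k e \<beta> x = dpoly k c \<beta> x + dpoly k c' \<beta> x" for \<beta> x unfolding e_def by (rule dpoly_add)
    have sq: "dpoly k e ?z x \<in> {0..\<kappa>}" "\<bar>dpoly k c' ?z x\<bar> \<le> \<delta>" if "x \<in> T" for x
      unfolding e c' \<theta>_def using squeeze_range[OF \<kappa> \<delta>0, of "dpoly k c ?z x"] low[OF that] up[OF that] by auto
    have Tc: "x \<in> cball a (R * r)" if "x \<in> T" for x using h[OF aT that] hr by simp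
    have rh: "1 / r \<le> R / h" using r h0 hr by (simp add: field_simps)
    have d1: "\<bar>dpoly k c' \<beta> x\<bar> \<le> I * \<delta> / h ^ m" if m: "m \<le> 2" "mi_order \<beta> = m" and x: "x \<in> T" for m \<beta> x
    proof -
      have ball0: "\<forall>y\<in>ball a r. \<bar>dpoly k c' ?z y\<bar> \<le> \<delta>" using sq(2) ball by blast
      consider "m = 0" | "m = 1" | "m = 2" using m(1) by linarith
      then show ?thesis
      proof cases
        case 1
        then have "\<beta> = ?z" using m(2) by (auto simp: mi_order_def)
        moreover have "1 * \<delta> \<le> I * \<delta>" using I(1) \<delta>0 by (rule mult_right_mono)
        ultimately show ?thesis using sq(2)[OF x] 1 by simp
      next
        case 2
        then obtain \<gamma> i where g: "\<beta> = \<gamma>(i := Suc (\<gamma> i))" "mi_order \<gamma> = 0" using m(2) mi_order_Suc_obtain[of \<beta> 0] by auto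
        then have "\<gamma> = ?z" by (auto simp: mi_order_def)
        then have "\<bar>dpoly k c' \<beta> x\<bar> \<le> CR * \<delta> / r" unfolding g(1) using CR(2)[OF r, of a c' \<gamma> \<delta> x i] ball0 Tc[OF x] by blast
        also have "\<dots> = CR * \<delta> * (1 / r)" by simp
        also have "\<dots> \<le> CR * \<delta> * (R / h)" using CR(1) \<delta>0 rh by (intro mult_left_mono) auto
        also have "\<dots> = CR * R * (\<delta> / h)" by simp
        also have "\<dots> \<le> I * (\<delta> / h)" using I(2) \<delta>0 h0 by (intro mult_right_mono) auto
        finally show ?thesis using 2 by simp
      next
        case 3
        then obtain \<gamma> i where g: "\<beta> = \<gamma>(i := Suc (\<gamma> i))" "mi_order \<gamma> = 1" using m(2) mi_order_Suc_obtain[of \<beta> 1] by auto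
        then obtain \<epsilon> j where g': "\<gamma> = \<epsilon>(j := Suc (\<epsilon> j))" "mi_order \<epsilon> = 0" using mi_order_Suc_obtain[of \<gamma> 0] by auto
        then have ez: "\<epsilon> = ?z" by (auto simp: mi_order_def)
        have "\<forall>y\<in>ball a r. \<bar>dpoly k c' \<gamma> y\<bar> \<le> C1 * \<delta> / r"
        proof
          fix y assume "y \<in> ball a r"
          then have "y \<in> cball a (1 * r)" by simp
          then show "\<bar>dpoly k c' \<gamma> y\<bar> \<le> C1 * \<delta> / r"
            unfolding g'(1) using C1(2)[OF r, of a c' \<epsilon> \<delta> y j] ball0 ez by blast
        qed
        then have "\<bar>dpoly k c' \<beta> x\<bar> \<le> CR * (C1 * \<delta> / r) / r"
          unfolding g(1) using CR(2)[OF r, of a c' \<gamma> "C1 * \<delta> / r" x i] Tc[OF x] by blast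
        also have "\<dots> = CR * C1 * \<delta> * (1 / r * (1 / r))" by simp
        also have "\<dots> \<le> CR * C1 * \<delta> * (R / h * (R / h))"
          using CR(1) C1(1) \<delta>0 rh r R h0 by (intro mult_left_mono mult_mono) auto
        also have "\<dots> = CR * C1 * R\<^sup>2 * (\<delta> / h\<^sup>2)" by (simp add: power2_eq_square)
        also have "\<dots> \<le> I * (\<delta> / h\<^sup>2)" using I(3) \<delta>0 by (intro mult_right_mono) auto
        finally show ?thesis using 3 by simp
      qed
    qed
    show "\<exists>c. (\<forall>x\<in>T. dpoly k c ?z x \<in> {0..\<kappa>}) \<and>
        (\<forall>m\<le>2. \<exists>G. (\<forall>\<beta>. mi_order \<beta> = m \<longrightarrow>
             has_weak_deriv T \<beta> (\<lambda>x. v x - dpoly k c ?z x) (G \<beta>) \<and> in_Lp 2 T (G \<beta>)) \<and>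
           (\<Sum>\<beta> | mi_order \<beta> = m. nsq T (G \<beta>)) \<le> B * h ^ (2 * (k + 1 - m)) * (sobolev_seminorm (k + 1) 2 T v)\<^sup>2)"
    proof (intro exI[of _ e] conjI ballI allI impI)
      show "dpoly k e ?z x \<in> {0..\<kappa>}" if "x \<in> T" for x by (rule sq(1)[OF that])
      fix m :: nat assume m: "m \<le> 2"
      define G where "G \<beta> x = W \<beta> x - dpoly k c' \<beta> x" for \<beta> x
      have G1: "has_weak_deriv T \<beta> (\<lambda>x. v x - dpoly k e ?z x) (G \<beta>)" if "mi_order \<beta> = m" for \<beta>
      proof -
        have "mi_order \<beta> \<le> k + 1" using that m k by simp
        from has_weak_deriv_diff[OF T(1) wd[OF this] has_weak_deriv_dpoly[OF T(1), of \<beta> k c']]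
        show ?thesis unfolding G_def[abs_def] e by (simp only: diff_diff_eq)
      qed
      have G2: "in_Lp 2 T (G \<beta>)" if "mi_order \<beta> = m" for \<beta>
        unfolding G_def[abs_def] by (intro in_Lp_two_diff L2 in_Lp_two_dpoly T) (use that m k in simp)
      have G3: "nsq T (G \<beta>) \<le> 2 * nsq T (W \<beta>) + 2 * (I\<^sup>2 * b * h ^ (2 * (k + 1 - m)) * M)" if \<beta>: "mi_order \<beta> = m" for \<beta>
      proof -
        have "nsq T (G \<beta>) \<le> 2 * nsq T (W \<beta>) + 2 * (V * (I * \<delta> / h ^ m)\<^sup>2)"
          unfolding G_def V_def
          by (rule nsq_diff_bounded[OF T(1,3) ne L2 in_Lp_two_dpoly[OF T(1,3)] d1[OF m \<beta>]]) (use \<beta> m k in simp)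
        also have "V * (I * \<delta> / h ^ m)\<^sup>2 = I\<^sup>2 * (V * \<delta>\<^sup>2) / h ^ (2 * m)"
          by (simp add: power_mult_distrib power_divide mult_ac flip: power_mult)
        also have "\<dots> = I\<^sup>2 * b * (h ^ (2 * (k + 1)) / h ^ (2 * m)) * M" unfolding \<delta>2 by simp
        also have "h ^ (2 * (k + 1)) / h ^ (2 * m) = h ^ (2 * (k + 1) - 2 * m)"
          using h0 m k by (intro power_diff[symmetric]) auto
        also have "2 * (k + 1) - 2 * m = 2 * (k + 1 - m)" by simp
        finally show ?thesis .
      qed
      have "(\<Sum>\<beta> | mi_order \<beta> = m. nsq T (G \<beta>))
        \<le> (\<Sum>\<beta> | mi_order \<beta> = m. 2 * nsq T (W \<beta>) + 2 * (I\<^sup>2 * b * h ^ (2 * (k + 1 - m)) * M))"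
        by (rule sum_mono) (use G3 in auto)
      also have "\<dots> = 2 * (\<Sum>\<beta> | mi_order \<beta> = m. nsq T (W \<beta>)) + D m * (2 * (I\<^sup>2 * b * h ^ (2 * (k + 1 - m)) * M))"
        by (simp add: sum.distrib sum_distrib_left[symmetric] D_def)
      also have "\<dots> \<le> 2 * ((q * h\<^sup>2) ^ (k + 1 - m) * M) + D m * (2 * (I\<^sup>2 * b * h ^ (2 * (k + 1 - m)) * M))"
      proof -
        have "m \<le> k + 1" using m k by simp
        from mean_zero_derivatives_bound[OF T ne h wd L2 mean this]
        have "(\<Sum>\<beta> | mi_order \<beta> = m. nsq T (W \<beta>)) \<le> (q * h\<^sup>2) ^ (k + 1 - m) * M"
          unfolding top M_def q_def .
        then show ?thesis by simp
      qed
      also have "\<dots> = Bm m * h ^ (2 * (k + 1 - m)) * M"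
        by (simp add: Bm_def power_mult_distrib power_mult[symmetric] algebra_simps)
      also have "\<dots> \<le> B * h ^ (2 * (k + 1 - m)) * M"
        using BmB[OF m] h0 M by (intro mult_right_mono) auto
      finally have "(\<Sum>\<beta> | mi_order \<beta> = m. nsq T (G \<beta>)) \<le> B * h ^ (2 * (k + 1 - m)) * M" .
      then show "\<exists>G. (\<forall>\<beta>. mi_order \<beta> = m \<longrightarrow>
             has_weak_deriv T \<beta> (\<lambda>x. v x - dpoly k e ?z x) (G \<beta>) \<and> in_Lp 2 T (G \<beta>)) \<and>
           (\<Sum>\<beta> | mi_order \<beta> = m. nsq T (G \<beta>)) \<le> B * h ^ (2 * (k + 1 - m)) * (sobolev_seminorm (k + 1) 2 T v)\<^sup>2"
        using G1 G2 unfolding M_def by blast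
    qed
  qed
qed

section \<open>From the covering simplex to the mesh\<close>

lemma poly_space_dpoly: "dpoly k c (\<lambda>_. 0) \<in> poly_space k"
  unfolding poly_space_def by (auto simp: dpoly_def dmono_0 fun_eq_iff)

lemma open_simplexD:
  assumes "open_simplex T"
  shows "open T" "convex T" "bounded T"
proof -
  obtain S where S: "int CARD('a) simplex S" "T = interior S" using assms by (auto simp: open_simplex_def)
  obtain C where C: "int (card C) = int CARD('a) + 1" "S = convex hull C" using S(1) by (auto simp: simplex_def)
  have "finite C" using C(1) by (metis add_nonneg_pos card.infinite less_irrefl of_nat_0 zero_less_one of_nat_0_le_iff)
  then have "bounded S" unfolding C(2) by (intro bounded_convex_hull finite_imp_bounded)
  then show "bounded T" using S(2) bounded_interior by blast
  show "open T" "convex T" unfolding S(2) C(2) by (auto intro: convex_interior)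
qed

text \<open>The estimate concerns \<open>K\<close> alone and 0 lies in \<open>[0, \<kappa>]\<close>,
  so zero is an admissible value elsewhere; disjointness makes it a polynomial on every other
  element.\<close>

lemma piecewise_in_discrete_space:
  assumes \<Omega>: "open \<Omega>" "bounded \<Omega>" and K: "K \<in> \<P>" "open K" and dj: "disjoint \<P>"
    and b: "\<And>x. x \<in> K \<Longrightarrow> dpoly k c (\<lambda>_. 0) x \<in> {0..\<kappa>}" and \<kappa>: "\<kappa> > 0"
  shows "(\<lambda>x. if x \<in> K then dpoly k c (\<lambda>_. 0) x else 0) \<in> discrete_space \<Omega> \<P> k"
  unfolding discrete_space_def
proof (intro CollectI conjI ballI)
  show "in_Lp 2 \<Omega> (\<lambda>x. if x \<in> K then dpoly k c (\<lambda>_. 0) x else 0)"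
  proof (rule in_Lp_two_bounded[OF \<Omega>])
    have [measurable]: "dpoly k c (\<lambda>_. 0) \<in> borel_measurable borel" "K \<in> sets borel"
      using K(2) by (auto intro: borel_measurable_continuous_onI continuous_dpoly)
    have "(\<lambda>x. if x \<in> K then dpoly k c (\<lambda>_. 0) x else 0) \<in> borel_measurable borel" by measurable
    then show "(\<lambda>x. if x \<in> K then dpoly k c (\<lambda>_. 0) x else 0) \<in> borel_measurable (lebesgue_on \<Omega>)"
      by (rule borel_measurable_lebesgue_onI)
    show "\<bar>if x \<in> K then dpoly k c (\<lambda>_. 0) x else 0\<bar> \<le> \<kappa>" for x using b[of x] \<kappa> by auto
  qed
  fix K' assume K': "K' \<in> \<P>"
  show "\<exists>q\<in>poly_space k. \<forall>x\<in>K'. (if x \<in> K then dpoly k c (\<lambda>_. 0) x else 0) = q x"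
  proof (cases "K' = K")
    case True
    then show ?thesis using poly_space_dpoly by (intro bexI[of _ "dpoly k c (\<lambda>_. 0)"]) auto
  next
    case False
    then have "K' \<inter> K = {}" using dj K(1) K' by (auto simp: disjoint_def)
    then have "\<forall>x\<in>K'. (if x \<in> K then dpoly k c (\<lambda>_. 0) x else 0) = dpoly k (\<lambda>_. 0) (\<lambda>_. 0) x"
      by (auto simp: dpoly_def)
    then show ?thesis using poly_space_dpoly by blast
  qed
qed

theorem theorem4p2:
  assumes dim: "CARD('d::finite) \<in> {2, 3}"
  shows "\<exists>(C0 :: nat \<Rightarrow> real \<Rightarrow> real)
          (C1 :: nat \<Rightarrow> real \<Rightarrow> real \<Rightarrow> real \<Rightarrow> real \<Rightarrow> real)
          (C2 :: nat \<Rightarrow> real \<Rightarrow> real \<Rightarrow> real \<Rightarrow> real \<Rightarrow> real).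
    (\<forall>k \<sigma>. C0 k \<sigma> > 0) \<and>
    (\<forall>k \<sigma> C_star \<kappa> M. C1 k \<sigma> C_star \<kappa> M > 0) \<and>
    (\<forall>k \<sigma> C_star \<kappa> M. C2 k \<sigma> C_star \<kappa> M > 0) \<and>
    (\<forall>(\<Omega> :: (real^'d) set) \<P> \<P>s cov \<sigma> C_star C_qu C_sh \<kappa> k K v.
       polyhedral_domain \<Omega> \<and>
       polytopic_mesh C_star C_qu \<Omega> \<P> \<and>
       simplicial_covering \<sigma> C_sh \<Omega> \<P> \<P>s cov \<and>
       K \<in> \<P> \<and> k \<ge> 1 \<and> \<kappa> > 0 \<and>
       in_sobolev (k + 1) 2 (cov K) v \<and>
       (AE x in lebesgue_on (cov K). v x \<in> {0..\<kappa>})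
       \<longrightarrow>
       (\<exists>\<pi>v \<in> discrete_space \<Omega> \<P> k.
          (\<forall>x\<in>\<Omega>. \<pi>v x \<in> {0..\<kappa>}) \<and>
          sobolev_seminorm 0 2 K (\<lambda>x. v x - \<pi>v x)
            \<le> C0 k \<sigma> * diameter K ^ (k + 1) * sobolev_seminorm (k + 1) 2 (cov K) v \<and>
          (in_sobolev 1 (real CARD('d)) \<Omega> v \<longrightarrow>
             sobolev_seminorm 1 2 K (\<lambda>x. v x - \<pi>v x)
               \<le> C1 k \<sigma> C_star \<kappa> (sobolev_seminorm 1 (real CARD('d)) \<Omega> v)
                   * diameter K ^ k * sobolev_seminorm (k + 1) 2 (cov K) v) \<and>
          (in_sobolev 2 2 \<Omega> v \<longrightarrow>
             sobolev_seminorm 2 2 K (\<lambda>x. v x - \<pi>v x)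
               \<le> C2 k \<sigma> C_star \<kappa> (sobolev_seminorm 2 2 \<Omega> v)
                   * diameter K ^ (k - 1) * sobolev_seminorm (k + 1) 2 (cov K) v)))"
proof -
  let ?z = "(\<lambda>_. 0) :: 'd \<Rightarrow> nat"
  have d3: "CARD('d) \<le> 3" using dim by auto
  \<comment> \<open>Naming the approximation property allows its constant to be chosen as a function
    \<open>Bf\<close> of \<open>k\<close> and \<open>R\<close>.\<close>
  define good where "good k R B \<longleftrightarrow> B \<ge> 0 \<and> (\<forall>(T :: (real^'d) set) v \<kappa> h a r.
     open T \<longrightarrow> convex T \<longrightarrow> bounded T \<longrightarrow> (\<forall>x\<in>T. \<forall>y\<in>T. dist x y \<le> h) \<longrightarrow> h > 0 \<longrightarrow>
     r > 0 \<longrightarrow> ball a r \<subseteq> T \<longrightarrow> h \<le> R * r \<longrightarrow>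
     in_sobolev (k + 1) 2 T v \<longrightarrow> \<kappa> > 0 \<longrightarrow> (AE x in lebesgue_on T. v x \<in> {0..\<kappa>}) \<longrightarrow>
     (\<exists>c. (\<forall>x\<in>T. dpoly k c ?z x \<in> {0..\<kappa>}) \<and>
        (\<forall>m\<le>2. \<exists>G. (\<forall>\<beta>. mi_order \<beta> = m \<longrightarrow>
             has_weak_deriv T \<beta> (\<lambda>x. v x - dpoly k c ?z x) (G \<beta>) \<and> in_Lp 2 T (G \<beta>)) \<and>
           (\<Sum>\<beta> | mi_order \<beta> = m. nsq T (G \<beta>)) \<le> B * h ^ (2 * (k + 1 - m)) * (sobolev_seminorm (k + 1) 2 T v)\<^sup>2)))"
    for k :: nat and R B :: real
  have "\<exists>B. k \<ge> 1 \<and> R \<ge> 1 \<longrightarrow> good k R B" for k R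
  proof (cases "k \<ge> 1 \<and> R \<ge> 1")
    case True
    then obtain B where "good k R B"
      using range_preserving_approximation[OF d3, of k R] unfolding good_def[symmetric] by (elim conjE) blast
    then show ?thesis by blast
  qed blast
  then obtain Bf where Bf: "\<And>k R. k \<ge> 1 \<Longrightarrow> R \<ge> 1 \<Longrightarrow> good k R (Bf k R)" by metis
  \<comment> \<open>The ratio between the diameters of the covering simplex and \<open>K\<close>;
    the absolute value keeps it nonnegative for every real \<open>\<sigma>\<close>.\<close>
  define \<gamma> where "\<gamma> \<sigma> = 2 * (real CARD('d) + 1) * \<bar>\<sigma>\<bar>" for \<sigma>
  \<comment> \<open>The maximum provides \<open>R \<ge> 1\<close>. The absolute value and the
    summand 1 make the constant positive for all arguments, including those for which
    \<open>Bf\<close> is unconstrained.\<close>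
  define C where "C m k \<sigma> = sqrt \<bar>Bf k (max 1 \<sigma>)\<bar> * \<gamma> \<sigma> ^ (k + 1 - m) + 1" for m k \<sigma>
  have \<gamma>0: "\<gamma> \<sigma> \<ge> 0" for \<sigma> by (simp add: \<gamma>_def)
  have Cpos: "C m k \<sigma> > 0" for m k \<sigma> using \<gamma>0[of \<sigma>] by (simp add: C_def add_nonneg_pos)
  have main: "\<exists>\<pi>v \<in> discrete_space \<Omega> \<P> k. (\<forall>x\<in>\<Omega>. \<pi>v x \<in> {0..\<kappa>}) \<and>
      (\<forall>m\<le>2. sobolev_seminorm m 2 K (\<lambda>x. v x - \<pi>v x) \<le> C m k \<sigma> * diameter K ^ (k + 1 - m) * sobolev_seminorm (k + 1) 2 (cov K) v)"
    if \<Omega>: "polyhedral_domain \<Omega>" and mesh: "polytopic_mesh C_star C_qu \<Omega> \<P>" and sc: "simplicial_covering \<sigma> C_sh \<Omega> \<P> \<P>s cov"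
      and K: "K \<in> \<P>" and k: "k \<ge> 1" and \<kappa>: "\<kappa> > 0" and v: "in_sobolev (k + 1) 2 (cov K) v"
      and range: "AE x in lebesgue_on (cov K). v x \<in> {0..\<kappa>}"
    for \<Omega> :: "(real^'d) set" and \<P> \<P>s cov \<sigma> C_star C_qu C_sh \<kappa> k K v
  proof -
    define T where "T = cov K"
    have \<Omega>': "open \<Omega>" "bounded \<Omega>" using \<Omega> by (auto simp: polyhedral_domain_def)
    have "polyhedral_domain K" "disjoint \<P>" using mesh K by (auto simp: polytopic_mesh_def)
    then have K': "open K" "K \<noteq> {}" and dj: "disjoint \<P>" by (auto simp: polyhedral_domain_def)
    have TP: "T \<in> \<P>s" "K \<subseteq> T" using sc K by (auto simp: simplicial_covering_def T_def)
    have T: "open_simplex T" "shape_regular \<sigma> T" using sc TP(1) by (auto simp: simplicial_covering_def)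
    have T\<Omega>: "T \<subseteq> \<Omega>" using sc TP(1) by (auto simp: simplicial_covering_def)
    have minimal: "diameter T \<le> diameter T'"
      if "open_simplex T'" "shape_regular \<sigma> T'" "K \<subseteq> T'" "T' \<subseteq> \<Omega>" for T'
      using sc K that unfolding simplicial_covering_def T_def by blast
    note oT = open_simplexD[OF T(1)]
    obtain T' where T': "open_simplex T'" "shape_regular \<sigma> T'" "K \<subseteq> T'" "T' \<subseteq> T"
      "diameter T' \<le> 2 * (real CARD('d) + 1) * \<bar>\<sigma>\<bar> * diameter K"
      by (rule covering_simplex_comparable[OF T K' TP(2)])
    \<comment> \<open>The shrunken simplex lies in \<open>T\<close>, hence in
      \<open>\<Omega>\<close>, and has the same shape-regularity constant, so it competes in the
      minimality condition.\<close>
    have hK: "diameter T \<le> \<gamma> \<sigma> * diameter K"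
      using minimal[OF T'(1-3)] T'(4,5) T\<Omega> unfolding \<gamma>_def by (meson order_trans subset_trans)
    obtain a r where ar: "r > 0" "ball a r \<subseteq> T" "diameter T \<le> \<sigma> * r" using T(2) by (auto simp: shape_regular_def)
    have "2 * r \<le> diameter T" using diameter_subset[OF ar(2) oT(3)] ar(1) by simp
    then have h0: "diameter T > 0" using ar(1) by linarith
    have "\<sigma> * r \<le> max 1 \<sigma> * r" using ar(1) by (intro mult_right_mono) auto
    then have hr: "diameter T \<le> max 1 \<sigma> * r" using ar(3) by linarith
    have hd: "\<forall>x\<in>T. \<forall>y\<in>T. dist x y \<le> diameter T" using diameter_bounded_bound[OF oT(3)] by blast
    define B where "B = Bf k (max 1 \<sigma>)"
    have g: "good k (max 1 \<sigma>) B" unfolding B_def by (rule Bf[OF k]) simp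
    then have B0: "B \<ge> 0" by (simp add: good_def)
    from g[unfolded good_def, THEN conjunct2, rule_format, OF oT, of "diameter T" r a v \<kappa>]
    obtain c where c: "\<And>x. x \<in> T \<Longrightarrow> dpoly k c ?z x \<in> {0..\<kappa>}"
      and G: "\<And>m. m \<le> 2 \<Longrightarrow> \<exists>G. (\<forall>\<beta>. mi_order \<beta> = m \<longrightarrow>
             has_weak_deriv T \<beta> (\<lambda>x. v x - dpoly k c ?z x) (G \<beta>) \<and> in_Lp 2 T (G \<beta>)) \<and>
           (\<Sum>\<beta> | mi_order \<beta> = m. nsq T (G \<beta>)) \<le> B * diameter T ^ (2 * (k + 1 - m)) * (sobolev_seminorm (k + 1) 2 T v)\<^sup>2"
      using hd h0 ar(1,2) hr v \<kappa> range unfolding T_def by blast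
    define w where "w x = (if x \<in> K then dpoly k c ?z x else 0)" for x
    show ?thesis
    proof (intro bexI[of _ w] conjI ballI allI impI)
      show "w \<in> discrete_space \<Omega> \<P> k"
        unfolding w_def by (rule piecewise_in_discrete_space[OF \<Omega>' K K'(1) dj _ \<kappa>]) (use c TP(2) in blast)
      show "w x \<in> {0..\<kappa>}" if "x \<in> \<Omega>" for x using c[of x] TP(2) \<kappa> by (auto simp: w_def)
      fix m :: nat assume m: "m \<le> 2"
      obtain G where Gw: "\<And>\<beta>. mi_order \<beta> = m \<Longrightarrow> has_weak_deriv T \<beta> (\<lambda>x. v x - dpoly k c ?z x) (G \<beta>)"
        and GL: "\<And>\<beta>. mi_order \<beta> = m \<Longrightarrow> in_Lp 2 T (G \<beta>)"
        and Gb: "(\<Sum>\<beta> | mi_order \<beta> = m. nsq T (G \<beta>)) \<le> B * diameter T ^ (2 * (k + 1 - m)) * (sobolev_seminorm (k + 1) 2 T v)\<^sup>2"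
        using G[OF m] by blast
      define S where "S = sobolev_seminorm (k + 1) 2 T v"
      have S: "S \<ge> 0" by (simp add: S_def sobolev_seminorm_def)
      have "sobolev_seminorm m 2 K (\<lambda>x. v x - w x) = sqrt (\<Sum>\<beta> | mi_order \<beta> = m. nsq K (G \<beta>))"
      proof (rule sobolev_seminorm_eq[OF K'(1)])
        \<comment> \<open>On \<open>K\<close> the function \<open>w\<close> is the polynomial, so
          the weak derivatives found on the simplex restrict to weak derivatives of the error on
          \<open>K\<close>.\<close>
        fix \<beta> :: "'d \<Rightarrow> nat" assume \<beta>: "mi_order \<beta> = m"
        show "has_weak_deriv K \<beta> (\<lambda>x. v x - w x) (G \<beta>)"
          by (rule has_weak_deriv_cong[OF _ has_weak_deriv_subset[OF oT(1) K'(1) TP(2) Gw[OF \<beta>]]]) (simp add: w_def)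
        show "in_Lp 2 K (G \<beta>)" by (rule in_Lp_two_subset(1)[OF oT(1) K'(1) TP(2) GL[OF \<beta>]])
      qed
      also have "\<dots> \<le> sqrt (B * diameter T ^ (2 * (k + 1 - m)) * S\<^sup>2)"
      proof (rule real_sqrt_le_mono)
        have "(\<Sum>\<beta> | mi_order \<beta> = m. nsq K (G \<beta>)) \<le> (\<Sum>\<beta> | mi_order \<beta> = m. nsq T (G \<beta>))"
          by (rule sum_mono) (use in_Lp_two_subset(2)[OF oT(1) K'(1) TP(2) GL] in auto)
        with Gb show "(\<Sum>\<beta> | mi_order \<beta> = m. nsq K (G \<beta>)) \<le> B * diameter T ^ (2 * (k + 1 - m)) * S\<^sup>2"
          unfolding S_def by linarith
      qed
      also have "\<dots> = sqrt B * diameter T ^ (k + 1 - m) * S"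
      proof -
        have "diameter T ^ (2 * (k + 1 - m)) = (diameter T ^ (k + 1 - m))\<^sup>2" by (simp only: power_mult[symmetric] mult.commute)
        then show ?thesis using S h0 by (simp only: real_sqrt_mult real_sqrt_abs) simp
      qed
      also have "\<dots> \<le> sqrt B * (\<gamma> \<sigma> * diameter K) ^ (k + 1 - m) * S"
        using hK h0 S B0 by (intro mult_right_mono mult_left_mono power_mono) auto
      also have "\<dots> = (sqrt B * \<gamma> \<sigma> ^ (k + 1 - m)) * (diameter K ^ (k + 1 - m) * S)"
        by (simp only: power_mult_distrib mult_ac)
      also have "\<dots> \<le> C m k \<sigma> * (diameter K ^ (k + 1 - m) * S)"
        using S B0 diameter_ge_0[OF bounded_subset[OF oT(3) TP(2)]]
        by (intro mult_right_mono) (auto simp: C_def B_def)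
      finally show "sobolev_seminorm m 2 K (\<lambda>x. v x - w x) \<le> C m k \<sigma> * diameter K ^ (k + 1 - m) * sobolev_seminorm (k + 1) 2 (cov K) v"
        by (simp only: S_def T_def mult.assoc)
    qed
  qed
  show ?thesis
  proof (rule exI[of _ "C 0"], rule exI[of _ "\<lambda>k \<sigma> _ _ _. C 1 k \<sigma>"],
      rule exI[of _ "\<lambda>k \<sigma> _ _ _. C 2 k \<sigma>"], intro conjI allI impI, goal_cases)
    case (4 \<Omega> \<P> \<P>s cov \<sigma> C_star C_qu C_sh \<kappa> k K v)
    then obtain \<pi>v where p: "\<pi>v \<in> discrete_space \<Omega> \<P> k" "\<forall>x\<in>\<Omega>. \<pi>v x \<in> {0..\<kappa>}"
      "\<forall>m\<le>2. sobolev_seminorm m 2 K (\<lambda>x. v x - \<pi>v x) \<le> C m k \<sigma> * diameter K ^ (k + 1 - m) * sobolev_seminorm (k + 1) 2 (cov K) v"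
      using main[of \<Omega> C_star C_qu \<P> \<sigma> C_sh \<P>s cov K k \<kappa> v] by blast
    have e: "k + 1 - 0 = k + 1" "k + 1 - 1 = k" "k + 1 - 2 = k - 1" by auto
    have le: "(0::nat) \<le> 2" "(1::nat) \<le> 2" "(2::nat) \<le> 2" by auto
    note b = p(3)[rule_format, OF le(1), unfolded e] p(3)[rule_format, OF le(2), unfolded e] p(3)[rule_format, OF le(3), unfolded e]
    show ?case by (rule bexI[OF _ p(1)]) (intro conjI impI p(2) b)
  qed (rule Cpos)+
qed

end
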